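(* Let $\alpha\in(1,2]$ and $\beta>0$. Let $Y=(Y_t)_{t\ge0}$ be a $d$-dimensional isotropic $\alpha$-stable Lévy process, and let $U=(U_t)_{t\ge0}$ be a positive, $\beta$-self-similar, increasing process with càdlàg paths, independent of $Y$, with $U_0=0$ and $\mathbb{E}[U_1^{p/\alpha}]<\infty$ for some $p>1$. Define $X_t=Y_{U_t}$. Then for any bounded domain $\Omega\subset\mathbb{R}^d$ with $C^{1,1}$ boundary, $$\lim_{t\downarrow0}\frac{\mathrm{Vol}(\Omega)-Q^X_\Omega(t)}{t^{\beta/\alpha}}=\mathbb{E}_0\Big[\sup_{0\le s\le1}X^{(1)}_s\Big]\,\mathrm{Per}(\Omega).$$
   Context: $Y$ is the Lévy process with $\mathbb{E}_0[e^{i\langle\xi,Y_t\rangle}]=e^{-t|\xi|^\alpha}$ for $\xi\in\mathbb{R}^d$; under $\mathbb{P}_x$ (expectation $\mathbb{E}_x$), $Y$, and hence $X$, starts at $x$. A superscript $(1)$ denotes the first coordinate. "Increasing" means non-decreasing, "positive" means $U_t>0$ for $t>0$, and "$\beta$-self-similar" means that $(U_{ct})_{t\ge0}$ and $(c^\beta U_t)_{t\ge0}$ have the same law for every $c>0$. "Domain" means open set. The spectral heat content of a bounded open set $\Omega\subset\mathbb{R}^d$ is $Q^X_\Omega(t)=\int_\Omega\mathbb{P}_x(\tau^X_\Omega>t)\,dx$, where $\tau^X_\Omega=\inf\{t\ge0:X_t\notin\Omega\}$. $\mathrm{Vol}(\Omega)$ is the Lebesgue measure of $\Omega$. The perimeter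 is $\mathrm{Per}(\Omega)=\sup\{\int_\Omega\sum_{i=1}^dD_i\varphi_i\,dx:\ \varphi_i\in C_c^\infty(\mathbb{R}^d),\ \sum_{i=1}^d\varphi_i^2\le1\}$ (equal to the $(d-1)$-dimensional Hausdorff measure of $\partial\Omega$ when $\partial\Omega$ is $C^1$). A function $f$ is $C^{1,\kappa}$ ($\kappa>0$) if it is $C^1$ and there is $L>0$ with $|\nabla f(x)-\nabla f(y)|\le L|x-y|^\kappa$ for all $x,y$. $\Omega$ has $C^{1,\kappa}$ boundary if for every $x\in\partial\Omega$ there are a neighborhood $V_x$ of $x$ and a $C^{1,\kappa}$ function $\gamma:\mathbb{R}^{d-1}\to\mathbb{R}$ such that, in suitable orthonormal coordinates (depending on $x$), $\Omega\cap V_x=\{(y_1,\dots,y_d):y_d>\gamma(y_1,\dots,y_{d-1})\}\cap V_x$. *)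

theory Defs
  imports "HOL-Probability.Probability"
begin

section \<open>Processes indexed by nonnegative times\<close>

text \<open>
  A process is a map \<open>Z :: real \<Rightarrow> 'w \<Rightarrow> 'b\<close>; only the times \<open>t \<ge> 0\<close> matter. Path properties and
  initial values are required almost surely.
\<close>

definition cadlag :: "(real \<Rightarrow> 'b::topological_space) \<Rightarrow> bool" where
  "cadlag f \<longleftrightarrow>
     (\<forall>t\<ge>0. (f \<longlongrightarrow> f t) (at_right t)) \<and>
     (\<forall>t>0. \<exists>l. (f \<longlongrightarrow> l) (at_left t))"

definition stochastic_process :: "'w measure \<Rightarrow> (real \<Rightarrow> 'w \<Rightarrow> 'b::topological_space) \<Rightarrow> bool" where
  "stochastic_process M Z \<longleftrightarrow> (\<forall>t\<ge>0. Z t \<in> borel_measurable M)"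

definition process_law ::
    "'w measure \<Rightarrow> (real \<Rightarrow> 'w \<Rightarrow> 'b::topological_space) \<Rightarrow> (real \<Rightarrow> 'b) measure" where
  "process_law M Z =
     distr M (PiM {0..} (\<lambda>_. borel)) (\<lambda>\<omega>. restrict (\<lambda>t. Z t \<omega>) {0..})"

definition process_events ::
    "'w measure \<Rightarrow> (real \<Rightarrow> 'w \<Rightarrow> 'b::topological_space) \<Rightarrow> 'w set set" where
  "process_events M Z =
     sigma_sets (space M) {Z t -` A \<inter> space M | t A. 0 \<le> t \<and> A \<in> sets borel}"

definition independent_processes ::
    "'w measure \<Rightarrow> (real \<Rightarrow> 'w \<Rightarrow> 'b::topological_space) \<Rightarrow>
     (real \<Rightarrow> 'w \<Rightarrow> 'c::topological_space) \<Rightarrow> bool" where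
  "independent_processes M Z W \<longleftrightarrow>
     prob_space.indep_set M (process_events M Z) (process_events M W)"

definition self_similar :: "'w measure \<Rightarrow> real \<Rightarrow> (real \<Rightarrow> 'w \<Rightarrow> real) \<Rightarrow> bool" where
  "self_similar M \<beta> U \<longleftrightarrow>
     (\<forall>c>0. process_law M (\<lambda>t. U (c * t)) = process_law M (\<lambda>t \<omega>. c powr \<beta> * U t \<omega>))"

definition levy_process :: "'w measure \<Rightarrow> (real \<Rightarrow> 'w \<Rightarrow> 'b::euclidean_space) \<Rightarrow> bool" where
  "levy_process M Y \<longleftrightarrow>
     stochastic_process M Y \<and>
     (AE \<omega> in M. Y 0 \<omega> = 0) \<and>
     (AE \<omega> in M. cadlag (\<lambda>t. Y t \<omega>)) \<and>
     (\<forall>(n::nat) t. 0 \<le> t 0 \<and> (\<forall>i<n. t i \<le> t (Suc i)) \<longrightarrow>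
        prob_space.indep_vars M (\<lambda>_. borel) (\<lambda>i \<omega>. Y (t (Suc i)) \<omega> - Y (t i) \<omega>) {..<n}) \<and>
     (\<forall>s\<ge>0. \<forall>h\<ge>0. distr M borel (\<lambda>\<omega>. Y (s + h) \<omega> - Y s \<omega>) = distr M borel (Y h))"

definition isotropic_stable ::
    "'w measure \<Rightarrow> real \<Rightarrow> (real \<Rightarrow> 'w \<Rightarrow> 'b::euclidean_space) \<Rightarrow> bool" where
  "isotropic_stable M \<alpha> Y \<longleftrightarrow>
     levy_process M Y \<and>
     (\<forall>t\<ge>0. \<forall>\<xi>. (LINT \<omega>|M. iexp (\<xi> \<bullet> Y t \<omega>)) = complex_of_real (exp (- t * norm \<xi> powr \<alpha>)))"

definition time_change ::
    "(real \<Rightarrow> 'w \<Rightarrow> 'b) \<Rightarrow> (real \<Rightarrow> 'w \<Rightarrow> real) \<Rightarrow> real \<Rightarrow> 'w \<Rightarrow> 'b" where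
  "time_change Y U t \<omega> = Y (U t \<omega>) \<omega>"

section \<open>Spectral heat content\<close>

text \<open>The infimum is taken in \<open>ereal\<close>, so that it is \<open>\<infinity>\<close> for a path that never leaves \<open>\<Omega>\<close>.\<close>

definition exit_time :: "'b set \<Rightarrow> (real \<Rightarrow> 'b) \<Rightarrow> ereal" where
  "exit_time \<Omega> f = Inf (ereal ` {t. 0 \<le> t \<and> f t \<notin> \<Omega>})"

text \<open>
  The process \<open>X\<close> starts at the origin, and its law under \<open>\<bbbP>\<^sub>x\<close> is that of \<open>x + X\<close> under \<open>\<bbbP>\<^sub>0\<close>.
  Exit from an open set by a cadlag path is in general not an event of the uncompleted
  sigma-algebra (it is the projection of one), so probabilities are taken in the completion.
  Similarly, \<open>x\<close> is integrated against complete Lebesgue measure.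
\<close>

definition survival_prob ::
    "'w measure \<Rightarrow> (real \<Rightarrow> 'w \<Rightarrow> 'b::real_vector) \<Rightarrow> 'b set \<Rightarrow> 'b \<Rightarrow> real \<Rightarrow> real" where
  "survival_prob M X \<Omega> x t =
     measure (completion M) {\<omega> \<in> space M. exit_time \<Omega> (\<lambda>s. x + X s \<omega>) > ereal t}"

definition spectral_heat_content ::
    "'w measure \<Rightarrow> (real \<Rightarrow> 'w \<Rightarrow> 'b::euclidean_space) \<Rightarrow> 'b set \<Rightarrow> real \<Rightarrow> real" where
  "spectral_heat_content M X \<Omega> t = (LINT x:\<Omega>|lebesgue. survival_prob M X \<Omega> x t)"

section \<open>Perimeter\<close>

definition partial_deriv :: "'n::finite \<Rightarrow> (real^'n \<Rightarrow> real) \<Rightarrow> real^'n \<Rightarrow> real" where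
  "partial_deriv i f x = frechet_derivative f (at x) (axis i 1)"

text \<open>
  If all iterated partial derivatives are differentiable everywhere, then they are continuous,
  so this is the usual smoothness.
\<close>

definition test_function :: "(real^'n::finite \<Rightarrow> real) \<Rightarrow> bool" where
  "test_function f \<longleftrightarrow>
     (\<forall>js x. foldr partial_deriv js f differentiable (at x)) \<and>
     compact (closure {x. f x \<noteq> 0})"

definition perimeter :: "(real^'n::finite) set \<Rightarrow> ereal" where
  "perimeter \<Omega> =
     (SUP \<phi> \<in> {\<phi> :: 'n \<Rightarrow> real^'n \<Rightarrow> real.
                 (\<forall>i. test_function (\<phi> i)) \<and> (\<forall>x. (\<Sum>i\<in>UNIV. (\<phi> i x)\<^sup>2) \<le> 1)}.
        ereal (LINT x:\<Omega>|lborel. (\<Sum>i\<in>UNIV. partial_deriv i (\<phi> i) x)))"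

section \<open>Domains with Hoelder-smooth boundary\<close>

text \<open>
  Here \<open>H\<close> is a linear subspace; \<open>G\<close> is the gradient of \<open>f\<close> as a function on \<open>H\<close>, made unique by
  taking its values in \<open>H\<close>.
\<close>

definition C1_holder_on :: "'b::euclidean_space set \<Rightarrow> real \<Rightarrow> ('b \<Rightarrow> real) \<Rightarrow> bool" where
  "C1_holder_on H \<kappa> f \<longleftrightarrow>
     (\<exists>G. (\<forall>x\<in>H. G x \<in> H \<and> (f has_derivative (\<lambda>h. G x \<bullet> h)) (at x within H)) \<and>
          continuous_on H G \<and>
          (\<exists>L>0. \<forall>x\<in>H. \<forall>y\<in>H. norm (G x - G y) \<le> L * norm (x - y) powr \<kappa>))"

text \<open>
  The orthogonal map \<open>T\<close> sends a point to its vector of new orthonormal coordinates, of which the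
  one with index \<open>j\<close> plays the role of the last. The space of the remaining
  \<open>CARD('n) - 1\<close> coordinates is rendered as the hyperplane \<open>{y. y $ j = 0}\<close>, which also covers
  dimension one.
\<close>

definition C1_holder_boundary :: "real \<Rightarrow> (real^'n::finite) set \<Rightarrow> bool" where
  "C1_holder_boundary \<kappa> \<Omega> \<longleftrightarrow>
     (\<forall>x \<in> frontier \<Omega>. \<exists>V (T :: real^'n \<Rightarrow> real^'n) j \<gamma>.
        open V \<and> x \<in> V \<and> orthogonal_transformation T \<and>
        C1_holder_on {y. y $ j = 0} \<kappa> \<gamma> \<and>
        \<Omega> \<inter> V = {z. T z $ j > \<gamma> (\<chi> i. if i = j then 0 else T z $ i)} \<inter> V)"

end

theory Submission
  imports Defs
begin

text \<open>
  A \<open>C^{1,1}\<close> domain satisfies a uniform two-sided ball condition. Hence, near the boundary, the event that the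
  path started at \<open>x\<close> leaves \<open>\<Omega>\<close> before time \<open>t\<close> differs little from the event that the component of \<open>X\<close> along the
  outer normal at the nearest boundary point exceeds the distance \<open>d x\<close> from \<open>x\<close> to the complement. By isotropy and self-similarity the supremum
  up to time \<open>t\<close> of this component is distributed as \<open>t powr (\<beta> / \<alpha>)\<close> times the supremum \<open>H\<close> of one coordinate up to time 1,
  so by Fubini the heat content deficit is, to first order, the expectation of the volume of the inner tube
  \<open>{x \<in> \<Omega>. d x \<le> t powr (\<beta> / \<alpha>) * H}\<close>. The volume of the inner tube of width \<open>s\<close> is \<open>s * Per \<Omega> + o(s)\<close> and at most a multiple of \<open>s\<close>,
  and \<open>H\<close> is integrable, so dominated convergence applies.

  The tube asymptotics come from the maps \<open>x \<mapsto> x - h \<phi>(x)\<close> for test fields \<open>\<phi>\<close>, which change the volume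
  of \<open>\<Omega>\<close> by \<open>- h\<close> times the integral of the divergence of \<open>\<phi>\<close>, up to \<open>O(h^2)\<close>. If \<open>|\<phi>| \<le> 1\<close>, the image of \<open>\<Omega>\<close> covers the
  complement of the tube of width \<open>h\<close>; if \<open>\<phi>\<close> is close to the outer normal near the boundary, it avoids the
  tube of a slightly smaller width.
\<close>

section \<open>The uniform ball condition\<close>

text \<open>Three obstacles shape the argument. The perimeter is given only as a supremum of fluxes,
  with no surface measure at hand, so the tube volume is squeezed between fluxes of test fields; the
  squeeze also shows that the perimeter is finite. Curvature makes the half space comparison wrong
  by a term quadratic in the displacement, while only a first moment of \<open>H\<close> is
  available. Displacements are therefore cut at a level \<open>A\<close> in units of
  \<open>t powr (\<beta> / \<alpha>)\<close>, which grows as \<open>t\<close> tends to 0, but slowly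
  enough for the quadratic error to stay below \<open>\<eta>\<close>; the part beyond the cutoff is
  negligible by integrability alone. Finally, survival involves uncountably many times. It is
  sandwiched between two events read off countably many times, and these agree almost surely for
  almost every starting point, because for a fixed path the starting points from which it gets
  arbitrarily close to the complement without leaving form a null set. The integrability of
  \<open>H\<close> comes from \<alpha> > 1, which gives the stable law a first moment, from a
  maximal inequality for symmetric increments, and from the moment of \<open>U 1\<close>.\<close>

definition two_sided_ball :: "real \<Rightarrow> ('b::real_inner) set \<Rightarrow> ('b \<Rightarrow> 'b) \<Rightarrow> bool" where
  "two_sided_ball R \<Omega> \<nu> \<longleftrightarrow> 0 < R \<and>
     (\<forall>z\<in>frontier \<Omega>. norm (\<nu> z) = 1 \<and> ball (z - R *\<^sub>R \<nu> z) R \<subseteq> \<Omega> \<and>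
        ball (z + R *\<^sub>R \<nu> z) R \<inter> \<Omega> = {})"

text \<open>The squared distance to the centre is expanded and the terms \<open>R\<^sup>2\<close>
  cancel. In this form the ball condition bounds the component along the normal by a squared
  distance, which is how it enters the later estimates.\<close>

lemma mem_tangent_ball_iff:
  fixes n :: "'b::real_inner"
  assumes "norm n = 1" "0 < R"
  shows "w \<in> ball (z + R *\<^sub>R n) R \<longleftrightarrow> (norm (w - z))\<^sup>2 < 2 * R * (n \<bullet> (w - z))"
proof -
  have "w \<in> ball (z + R *\<^sub>R n) R \<longleftrightarrow> norm ((w - z) - R *\<^sub>R n) < R"
    by (simp add: dist_norm norm_minus_commute algebra_simps)
  also have "\<dots> \<longleftrightarrow> (norm ((w - z) - R *\<^sub>R n))\<^sup>2 < R\<^sup>2"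
    using assms(2) by (metis norm_ge_zero abs_of_nonneg abs_of_pos power2_less_imp_less power_strict_mono zero_less_numeral less_imp_le)
  also have "(norm ((w - z) - R *\<^sub>R n))\<^sup>2 = (norm (w - z))\<^sup>2 - 2 * R * (n \<bullet> (w - z)) + R\<^sup>2"
  proof -
    have "n \<bullet> n = 1" using assms(1) by (simp add: dot_square_norm)
    then show ?thesis
      unfolding power2_norm_eq_inner
      by (simp add: inner_diff_left inner_diff_right inner_add_left inner_add_right inner_commute power2_eq_square algebra_simps)
  qed
  finally show ?thesis by simp
qed

lemma tangent_ball_mono:
  fixes n :: "'b::real_inner"
  assumes "norm n = 1" "0 < r" "r \<le> R"
  shows "ball (z + r *\<^sub>R n) r \<subseteq> ball (z + R *\<^sub>R n) R"
proof
  fix w assume "w \<in> ball (z + r *\<^sub>R n) r"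
  then have *: "(norm (w - z))\<^sup>2 < 2 * r * (n \<bullet> (w - z))"
    using mem_tangent_ball_iff[OF assms(1,2)] by blast
  then have "0 < n \<bullet> (w - z)"
    using assms(2) zero_le_power2[of "norm (w - z)"]
    by (smt (verit) mult_nonneg_nonpos)
  then have "2 * r * (n \<bullet> (w - z)) \<le> 2 * R * (n \<bullet> (w - z))"
    using assms(3) by (simp add: mult_right_mono)
  then show "w \<in> ball (z + R *\<^sub>R n) R"
    using * mem_tangent_ball_iff[OF assms(1), of R] assms by force
qed

text \<open>The mean value inequality is applied on the segment to \<open>f\<close> minus its linear
  part at \<open>a\<close>, whose derivative there has norm at most \<open>L * norm (b - a)\<close>.
  Integration would give \<open>L / 2\<close>; only the quadratic order matters.\<close>

lemma C1_holder_on_taylor: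
  fixes f :: "'b::euclidean_space \<Rightarrow> real"
  assumes "convex H"
    and der: "\<And>x. x \<in> H \<Longrightarrow> (f has_derivative (\<lambda>h. G x \<bullet> h)) (at x within H)"
    and lip: "\<And>x y. x \<in> H \<Longrightarrow> y \<in> H \<Longrightarrow> norm (G x - G y) \<le> L * norm (x - y)"
    and "0 \<le> L" "a \<in> H" "b \<in> H"
  shows "\<bar>f b - f a - G a \<bullet> (b - a)\<bar> \<le> L * (norm (b - a))\<^sup>2"
proof -
  let ?S = "closed_segment a b"
  let ?g = "\<lambda>y. f y - G a \<bullet> y"
  have sub: "?S \<subseteq> H" using assms by (simp add: closed_segment_subset)
  have "norm (?g b - ?g a) \<le> (L * norm (b - a)) * norm (b - a)"
  proof (rule differentiable_bound[where f' = "\<lambda>x h. G x \<bullet> h - G a \<bullet> h" and S = ?S])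
    fix x assume x: "x \<in> ?S"
    then have xH: "x \<in> H" using sub by auto
    show "(?g has_derivative (\<lambda>h. G x \<bullet> h - G a \<bullet> h)) (at x within ?S)"
      by (intro has_derivative_diff has_derivative_subset[OF der[OF xH] sub] derivative_intros)
    have "norm (G x - G a) \<le> L * norm (x - a)" using lip xH assms by auto
    also have "\<dots> \<le> L * norm (b - a)"
      using segment_bound(1)[OF x] assms by (intro mult_left_mono) (auto simp: norm_minus_commute)
    finally have "norm (G x - G a) \<le> L * norm (b - a)" .
    moreover have "onorm (\<lambda>h. G x \<bullet> h - G a \<bullet> h) \<le> norm (G x - G a)"
      by (rule onorm_le) (metis Cauchy_Schwarz_ineq2 inner_diff_left real_norm_def)
    ultimately show "onorm (\<lambda>h. G x \<bullet> h - G a \<bullet> h) \<le> L * norm (b - a)" by linarith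
  qed auto
  then show ?thesis by (simp add: inner_diff_right power2_eq_square algebra_simps)
qed

text \<open>Locally the domain is the set where \<open>\<psi>\<close> is positive;
  \<open>\<psi>\<close> has a Taylor error of at most \<open>L\<close> times the squared distance,
  and its gradient has norm at least 1. On a small enough ball tangent at \<open>z\<close> the
  linear term beats the error, so \<open>\<psi>\<close> has a fixed sign there. Here
  \<open>n\<close> points into the domain.\<close>

lemma C1_holder_local_balls:
  fixes \<Omega> :: "(real^'n::finite) set"
  assumes "open \<Omega>" "C1_holder_boundary 1 \<Omega>" "z0 \<in> frontier \<Omega>"
  obtains R \<rho> where "0 < R" "0 < \<rho>"
    "\<And>z. z \<in> frontier \<Omega> \<Longrightarrow> z \<in> ball z0 \<rho> \<Longrightarrow>
       \<exists>n. norm n = 1 \<and> ball (z + R *\<^sub>R n) R \<subseteq> \<Omega> \<and> ball (z - R *\<^sub>R n) R \<inter> \<Omega> = {}"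
proof -
  have "\<exists>V (T :: real^'n \<Rightarrow> real^'n) j \<gamma>.
        open V \<and> z0 \<in> V \<and> orthogonal_transformation T \<and>
        C1_holder_on {y. y $ j = 0} 1 \<gamma> \<and>
        \<Omega> \<inter> V = {z. T z $ j > \<gamma> (\<chi> i. if i = j then 0 else T z $ i)} \<inter> V"
    using assms(2,3) unfolding C1_holder_boundary_def by (rule bspec)
  then obtain V and T :: "real^'n \<Rightarrow> real^'n" and j \<gamma> where "open V \<and> z0 \<in> V \<and> orthogonal_transformation T \<and>
        C1_holder_on {y. y $ j = 0} 1 \<gamma> \<and>
        \<Omega> \<inter> V = {z. T z $ j > \<gamma> (\<chi> i. if i = j then 0 else T z $ i)} \<inter> V"
    by (elim exE) (rule that)
  then have V: "open V" "z0 \<in> V"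
    and T: "orthogonal_transformation T"
    and C: "C1_holder_on {y. y $ j = 0} 1 \<gamma>"
    and graph: "\<Omega> \<inter> V = {z. T z $ j > \<gamma> (\<chi> i. if i = j then 0 else T z $ i)} \<inter> V"
    by blast+
  define H where "H = {y :: real^'n. y $ j = 0}"
  obtain G where G: "(\<forall>x\<in>H. G x \<in> H \<and> (\<gamma> has_derivative (\<lambda>h. G x \<bullet> h)) (at x within H)) \<and>
          continuous_on H G \<and>
          (\<exists>L>0. \<forall>x\<in>H. \<forall>y\<in>H. norm (G x - G y) \<le> L * norm (x - y) powr 1)"
    using C unfolding C1_holder_on_def H_def[symmetric] by (elim exE) (rule that)
  then have GH: "\<And>x. x \<in> H \<Longrightarrow> G x \<in> H"
    and der: "\<And>x. x \<in> H \<Longrightarrow> (\<gamma> has_derivative (\<lambda>h. G x \<bullet> h)) (at x within H)"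
    by blast+
  obtain L where "L > 0" and lip0: "\<And>x y. x \<in> H \<Longrightarrow> y \<in> H \<Longrightarrow> norm (G x - G y) \<le> L * norm (x - y) powr 1"
    using G by blast
  have lip: "norm (G x - G y) \<le> L * norm (x - y)" if "x \<in> H" "y \<in> H" for x y
    using lip0[OF that] by simp
  have convH: "convex H"
    unfolding H_def convex_def by simp
  define P :: "real^'n \<Rightarrow> real^'n" where "P y = (\<chi> i. if i = j then 0 else y $ i)" for y
  have PH: "P y \<in> H" for y by (simp add: P_def H_def)
  have Pdiff: "P a - P b = P (a - b)" for a b by (simp add: P_def vec_eq_iff)
  have Pnorm: "norm (P y) \<le> norm y" for y
    unfolding norm_vec_def by (rule L2_set_mono) (auto simp: P_def)
  have GP: "a \<bullet> P y = a \<bullet> y" if "a \<in> H" for a y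
    unfolding inner_vec_def using that by (intro sum.cong) (auto simp: P_def H_def)
  have linT: "linear T" using T orthogonal_transformation_linear by blast
  have Tdiff: "T a - T b = T (a - b)" for a b using linT by (simp add: linear_diff)
  have Tnorm: "norm (T a) = norm a" for a using T orthogonal_transformation_norm by blast
  define \<psi> where "\<psi> w = T w $ j - \<gamma> (P (T w))" for w
  define g where "g z = axis j 1 - G (P (T z))" for z
  have graph': "w \<in> \<Omega> \<longleftrightarrow> \<psi> w > 0" if "w \<in> V" for w
    using graph that unfolding \<psi>_def P_def by auto
  have taylor: "\<bar>\<psi> w - \<psi> z - g z \<bullet> T (w - z)\<bar> \<le> L * (norm (w - z))\<^sup>2" for w z
  proof -
    have "\<bar>\<gamma> (P (T w)) - \<gamma> (P (T z)) - G (P (T z)) \<bullet> (P (T w) - P (T z))\<bar> \<le> L * (norm (P (T w) - P (T z)))\<^sup>2"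
      by (rule C1_holder_on_taylor[OF convH der lip]) (use \<open>L > 0\<close> PH in auto)
    moreover have "norm (P (T w) - P (T z)) \<le> norm (w - z)"
      by (metis Pdiff Pnorm Tdiff Tnorm)
    then have "L * (norm (P (T w) - P (T z)))\<^sup>2 \<le> L * (norm (w - z))\<^sup>2"
      using \<open>L > 0\<close> by (intro mult_left_mono power_mono) auto
    moreover have "G (P (T z)) \<bullet> (P (T w) - P (T z)) = G (P (T z)) \<bullet> T (w - z)"
      by (simp add: Pdiff Tdiff GP GH PH)
    moreover have "axis j 1 \<bullet> T (w - z) = T w $ j - T z $ j"
      by (simp add: inner_axis' flip: Tdiff)
    ultimately show ?thesis
      unfolding \<psi>_def g_def by (simp add: inner_diff_left algebra_simps abs_if split: if_splits)
  qed
  \<comment> \<open>The gradient of \<open>\<gamma>\<close> lies in the hyperplane, so the component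
    \<open>j\<close> of \<open>g z\<close> comes from \<open>axis j 1\<close> alone.\<close>
  have g1: "norm (g z) \<ge> 1" for z
  proof -
    have "g z $ j = 1" using GH[OF PH, of "T z"] by (simp add: g_def H_def axis_def)
    then show ?thesis using component_le_norm_cart[of "g z" j] by simp
  qed
  obtain e where e: "e > 0" "ball z0 e \<subseteq> V" using V open_contains_ball by blast
  have cont: "continuous_on UNIV \<psi>"
  proof -
    have "continuous_on H \<gamma>"
      using der has_derivative_continuous continuous_on_eq_continuous_within by blast
    moreover have "continuous_on UNIV T" using linT by (simp add: linear_continuous_on linear_conv_bounded_linear)
    moreover have "continuous_on UNIV P"
    proof -
      have "linear P" by (rule linearI) (auto simp: P_def vec_eq_iff)
      then show ?thesis by (simp add: linear_continuous_on linear_conv_bounded_linear)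
    qed
    ultimately have cT: "continuous_on UNIV T" and cPT: "continuous_on UNIV (\<lambda>w. P (T w))"
      and c\<gamma>: "continuous_on H \<gamma>"
      by (auto intro: continuous_on_compose2[of UNIV P])
    have "continuous_on UNIV (\<lambda>w. \<gamma> (P (T w)))"
      by (rule continuous_on_compose2[OF c\<gamma> cPT]) (use PH in auto)
    then show ?thesis unfolding \<psi>_def
      using cT by (intro continuous_on_diff continuous_on_component)
  qed
  \<comment> \<open>The bound \<open>e / 4\<close> keeps the tangent balls, of diameter
    \<open>2 * R\<close>, inside \<open>ball z0 e\<close> when \<open>z\<close> is within
    \<open>e / 2\<close> of \<open>z0\<close>. The bound \<open>1 / (2 * L)\<close> makes the Taylor
    error at most the quantity that \<open>mem_tangent_ball_iff\<close> controls.\<close>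
  define R where "R = min (e/4) (1 / (2 * L))"
  have R: "R > 0" using e \<open>L > 0\<close> by (simp add: R_def)
  show ?thesis
  proof (rule that[of R "e/2"])
    show "0 < R" "0 < e/2" using R e by auto
    fix z assume z: "z \<in> frontier \<Omega>" "z \<in> ball z0 (e/2)"
    have zV: "z \<in> V" using z e by (auto simp: subset_iff)
    have "z \<notin> \<Omega>" using z(1) assms(1) by (simp add: frontier_def interior_open)
    then have le: "\<psi> z \<le> 0" using graph'[OF zV] by simp
    \<comment> \<open>Otherwise a whole neighbourhood of \<open>z\<close> would miss the domain,
      although \<open>z\<close> is in its closure.\<close>
    have "\<not> \<psi> z < 0"
    proof
      assume neg: "\<psi> z < 0"
      have "open {w. \<psi> w < 0}" using cont by (simp add: open_Collect_less)
      then have "open ({w. \<psi> w < 0} \<inter> V)" using V by blast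
      moreover have "z \<in> {w. \<psi> w < 0} \<inter> V" using neg zV by simp
      moreover have "z \<in> closure \<Omega>" using z(1) by (simp add: frontier_def)
      ultimately obtain w where "w \<in> \<Omega>" "w \<in> {w. \<psi> w < 0} \<inter> V"
        by (meson closure_iff_nhds_not_empty disjoint_iff subset_refl)
      then show False using graph' by force
    qed
    then have z0: "\<psi> z = 0" using le by simp
    obtain n where n: "T n = g z /\<^sub>R norm (g z)"
      using orthogonal_transformation_surj[OF T] by (metis surjD)
    have nn: "norm n = 1"
    proof -
      have "g z \<noteq> 0" using g1[of z] by auto
      then have "norm (T n) = 1" unfolding n by simp
      then show ?thesis using Tnorm by simp
    qed
    have gn: "g z \<bullet> T v = norm (g z) * (n \<bullet> v)" for v
    proof -
      have "g z \<noteq> 0" using g1[of z] by auto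
      then have "g z = norm (g z) *\<^sub>R T n" by (simp add: n)
      then show ?thesis
        by (metis T inner_scaleR_left orthogonal_transformation_def)
    qed
    have ball_V: "ball (z + R *\<^sub>R n) R \<subseteq> V" if "norm n = 1" for n
    proof
      fix w assume "w \<in> ball (z + R *\<^sub>R n) R"
      then have "dist (z + R *\<^sub>R n) w < R" by simp
      moreover have "dist z (z + R *\<^sub>R n) = R" using that R by (simp add: dist_norm)
      ultimately have "dist z w < 2 * R" using dist_triangle[of z w "z + R *\<^sub>R n"] by linarith
      then have "dist z0 w < e" using z(2) dist_triangle[of z0 w z] by (auto simp: R_def)
      then show "w \<in> V" using e by auto
    qed
    have RL: "L \<le> 1 / (2 * R)"
      using R \<open>L > 0\<close> by (simp add: R_def min_def field_simps split: if_splits)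
    have in1: "w \<in> \<Omega>" if w: "w \<in> ball (z + R *\<^sub>R n) R" for w
    proof -
      have 1: "(norm (w - z))\<^sup>2 < 2 * R * (n \<bullet> (w - z))"
        using w mem_tangent_ball_iff[OF nn R] by blast
      have "L * (norm (w - z))\<^sup>2 \<le> 1 / (2 * R) * (norm (w - z))\<^sup>2"
        using RL by (intro mult_right_mono) auto
      also have "\<dots> < n \<bullet> (w - z)" using 1 R by (simp add: field_simps)
      finally have a: "L * (norm (w - z))\<^sup>2 < n \<bullet> (w - z)" .
      moreover have "0 \<le> L * (norm (w - z))\<^sup>2" using \<open>L > 0\<close> by simp
      ultimately have "0 < n \<bullet> (w - z)" by linarith
      then have "n \<bullet> (w - z) \<le> norm (g z) * (n \<bullet> (w - z))" using g1[of z] by simp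
      then have "\<psi> w > 0" using a taylor[of w z] z0 gn[of "w - z"] by linarith
      then show ?thesis using graph' ball_V[OF nn] w by blast
    qed
    have in2: "w \<notin> \<Omega>" if w: "w \<in> ball (z - R *\<^sub>R n) R" for w
    proof -
      have w': "w \<in> ball (z + R *\<^sub>R (- n)) R" using w by simp
      have nn': "norm (- n) = 1" using nn by simp
      have 1: "(norm (w - z))\<^sup>2 < 2 * R * ((- n) \<bullet> (w - z))"
        using w' mem_tangent_ball_iff[OF nn' R] by blast
      have "L * (norm (w - z))\<^sup>2 \<le> 1 / (2 * R) * (norm (w - z))\<^sup>2"
        using RL by (intro mult_right_mono) auto
      also have "\<dots> < - (n \<bullet> (w - z))" using 1 R by (simp add: field_simps)
      finally have a: "L * (norm (w - z))\<^sup>2 < - (n \<bullet> (w - z))" .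
      moreover have "0 \<le> L * (norm (w - z))\<^sup>2" using \<open>L > 0\<close> by simp
      ultimately have "n \<bullet> (w - z) < 0" by linarith
      then have "norm (g z) * (n \<bullet> (w - z)) \<le> n \<bullet> (w - z)" using g1[of z]
        by (simp add: mult_le_cancel_right1)
      then have "\<psi> w < 0" using a taylor[of w z] z0 gn[of "w - z"] by linarith
      moreover have "w \<in> V" using ball_V[OF nn'] w' by blast
      ultimately show ?thesis using graph' by force
    qed
    show "\<exists>n. norm n = 1 \<and> ball (z + R *\<^sub>R n) R \<subseteq> \<Omega> \<and> ball (z - R *\<^sub>R n) R \<inter> \<Omega> = {}"
      using nn in1 in2 by blast
  qed
qed

text \<open>Compactness of the frontier leaves finitely many local radii. Balls tangent at the same
  point in the same direction are nested, so the smallest radius serves everywhere.\<close>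

lemma C1_holder_two_sided_ball:
  fixes \<Omega> :: "(real^'n::finite) set"
  assumes "open \<Omega>" "bounded \<Omega>" "C1_holder_boundary 1 \<Omega>"
  obtains R \<nu> where "two_sided_ball R \<Omega> \<nu>"
proof -
  define Q where "Q R z \<longleftrightarrow> (\<exists>n. norm n = 1 \<and> ball (z + R *\<^sub>R n) R \<subseteq> \<Omega> \<and> ball (z - R *\<^sub>R n) R \<inter> \<Omega> = {})"
    for R z
  have Qmono: "Q r z" if "Q R z" "0 < r" "r \<le> R" for r R z
  proof -
    obtain n where n: "norm n = 1" "ball (z + R *\<^sub>R n) R \<subseteq> \<Omega>" "ball (z - R *\<^sub>R n) R \<inter> \<Omega> = {}"
      using \<open>Q R z\<close> Q_def by blast
    then have "ball (z + r *\<^sub>R n) r \<subseteq> \<Omega>" "ball (z - r *\<^sub>R n) r \<inter> \<Omega> = {}"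
      using tangent_ball_mono[of n r R z] tangent_ball_mono[of "-n" r R z] that by auto
    then show ?thesis using n Q_def by blast
  qed
  have "\<forall>z0\<in>frontier \<Omega>. \<exists>R \<rho>. 0 < R \<and> 0 < \<rho> \<and> (\<forall>z\<in>frontier \<Omega> \<inter> ball z0 \<rho>. Q R z)"
  proof
    fix z0 assume "z0 \<in> frontier \<Omega>"
    from C1_holder_local_balls[OF assms(1,3) this]
    show "\<exists>R \<rho>. 0 < R \<and> 0 < \<rho> \<and> (\<forall>z\<in>frontier \<Omega> \<inter> ball z0 \<rho>. Q R z)"
      by (metis IntE Q_def)
  qed
  then obtain R where "\<forall>z0\<in>frontier \<Omega>. \<exists>\<rho>. 0 < R z0 \<and> 0 < \<rho> \<and> (\<forall>z\<in>frontier \<Omega> \<inter> ball z0 \<rho>. Q (R z0) z)"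
    by (rule bchoice[THEN exE])
  then obtain \<rho> where R: "\<forall>z0\<in>frontier \<Omega>. 0 < R z0 \<and> 0 < \<rho> z0 \<and> (\<forall>z\<in>frontier \<Omega> \<inter> ball z0 (\<rho> z0). Q (R z0) z)"
    by (rule bchoice[THEN exE])
  have cpt: "compact (frontier \<Omega>)" using assms compact_frontier_bounded by blast
  have cov: "frontier \<Omega> \<subseteq> (\<Union>z\<in>frontier \<Omega>. ball z (\<rho> z))" using R by force
  obtain D where D: "D \<subseteq> frontier \<Omega>" "finite D" "frontier \<Omega> \<subseteq> (\<Union>z\<in>D. ball z (\<rho> z))"
    by (rule compactE_image[OF cpt _ cov]) (rule open_ball, rule that)
  define r where "r = Min (insert 1 (R ` D))"
  have r: "0 < r" "\<And>z. z \<in> D \<Longrightarrow> r \<le> R z"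
    unfolding r_def using D R by (auto simp: Min_le_iff)
  have "Q r z" if z: "z \<in> frontier \<Omega>" for z
  proof -
    obtain z0 where "z0 \<in> D" "z \<in> ball z0 (\<rho> z0)" using D z by auto
    then have "Q (R z0) z" using R D z by blast
    then show ?thesis using Qmono r \<open>z0 \<in> D\<close> by blast
  qed
  then have "\<forall>z\<in>frontier \<Omega>. Q r z" by blast
  then obtain n where n: "\<forall>z\<in>frontier \<Omega>. norm (n z) = 1 \<and> ball (z + r *\<^sub>R n z) r \<subseteq> \<Omega> \<and> ball (z - r *\<^sub>R n z) r \<inter> \<Omega> = {}"
    unfolding Q_def by (rule bchoice[THEN exE])
  \<comment> \<open>The sign changes because \<open>n\<close> points inward and \<open>\<nu>\<close>
    outward.\<close>
  have "two_sided_ball r \<Omega> (\<lambda>z. - n z)"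
    unfolding two_sided_ball_def using r n by simp
  then show ?thesis using that by blast
qed

section \<open>Smooth fields close to the normal\<close>

text \<open>\<open>flat_exp 0\<close> is the classical smooth function that is flat at 0. The
  exponent \<open>n\<close> is carried along because the derivative of \<open>flat_exp n\<close> is
  a combination of \<open>flat_exp (n + 2)\<close> and \<open>flat_exp (n + 1)\<close>.\<close>

definition flat_exp :: "nat \<Rightarrow> real \<Rightarrow> real" where
  "flat_exp n t = (if 0 < t then exp (- 1 / t) / t ^ n else 0)"

lemma flat_over_tendsto_0: "((\<lambda>h. flat_exp n h / h) \<longlongrightarrow> 0) (at 0)"
proof (rule filterlim_split_at)
  have "eventually (\<lambda>h::real. flat_exp n h / h = 0) (at_left 0)"
    by (auto simp: flat_exp_def eventually_at_left_field intro: exI[of _ "-1"])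
  then show "((\<lambda>h. flat_exp n h / h) \<longlongrightarrow> 0) (at_left 0)"
    by (simp add: tendsto_eventually)
  \<comment> \<open>With \<open>y = 1 / h\<close> the quotient becomes
    \<open>y ^ Suc n / exp y\<close>.\<close>
  have "((\<lambda>y::real. y ^ Suc n / exp y) \<longlongrightarrow> 0) at_top"
    by (rule tendsto_power_div_exp_0)
  then have "((\<lambda>h::real. inverse h ^ Suc n / exp (inverse h)) \<longlongrightarrow> 0) (at_right 0)"
    by (rule filterlim_compose[OF _ filterlim_inverse_at_top_right])
  moreover have "eventually (\<lambda>h::real. inverse h ^ Suc n / exp (inverse h) = flat_exp n h / h) (at_right 0)"
    using eventually_at_right_less[of "0::real"]
    by eventually_elim (auto simp: flat_exp_def exp_minus field_simps)
  ultimately show "((\<lambda>h. flat_exp n h / h) \<longlongrightarrow> 0) (at_right 0)"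
    by (rule Lim_transform_eventually)
qed

lemma has_real_derivative_flat:
  "(flat_exp n has_real_derivative (flat_exp (n + 2) t - real n * flat_exp (n + 1) t)) (at t)"
proof -
  consider "t < 0" | "t = 0" | "t > 0" by linarith
  then show ?thesis
  proof cases
    case 1
    have "((\<lambda>_. 0) has_real_derivative 0) (at t)" by simp
    then have "(flat_exp n has_real_derivative 0) (at t)"
      by (rule has_field_derivative_transform_within_open[of _ _ _ "{..<0}"]) (use 1 in \<open>auto simp: flat_exp_def\<close>)
    then show ?thesis using 1 by (simp add: flat_exp_def)
  next
    case 2
    then show ?thesis
      using flat_over_tendsto_0[of n] by (simp add: has_field_derivative_iff flat_exp_def[of _ 0])
  next
    case 3
    have "((\<lambda>t. exp (- 1 / t) / t ^ n) has_real_derivative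
        (exp (- 1 / t) * (1 / t ^ 2) * t ^ n - exp (- 1 / t) * (real n * t ^ (n - 1))) / (t ^ n * t ^ n)) (at t)"
      using 3 by (auto intro!: derivative_eq_intros simp: power2_eq_square)
    moreover have "(exp (- 1 / t) * (1 / t ^ 2) * t ^ n - exp (- 1 / t) * (real n * t ^ (n - 1))) / (t ^ n * t ^ n)
        = flat_exp (n + 2) t - real n * flat_exp (n + 1) t"
    proof (cases n)
      case 0 then show ?thesis using 3 by (simp add: flat_exp_def power2_eq_square)
    next
      case (Suc m) then show ?thesis using 3 by (simp add: flat_exp_def field_simps power2_eq_square)
    qed
    ultimately have "((\<lambda>t. exp (- 1 / t) / t ^ n) has_real_derivative (flat_exp (n + 2) t - real n * flat_exp (n + 1) t)) (at t)"
      by simp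
    then show ?thesis
      by (rule has_field_derivative_transform_within_open[of _ _ _ "{0<..}"]) (use 3 in \<open>auto simp: flat_exp_def\<close>)
  qed
qed

lemma flat0_bounds: "0 \<le> flat_exp 0 t" "flat_exp 0 t \<le> 1"
  by (auto simp: flat_exp_def)

lemma flat0_mono: "s \<le> t \<Longrightarrow> flat_exp 0 s \<le> flat_exp 0 t"
  by (auto simp: flat_exp_def field_simps)

text \<open>The class consists of differentiable functions and is closed under partial derivatives,
  so all the iterated derivatives demanded by \<open>test_function\<close> are covered by one
  induction.\<close>

inductive smooth_fun :: "(real^'n::finite \<Rightarrow> real) \<Rightarrow> bool" where
  const: "smooth_fun (\<lambda>x. c)"
| coord: "smooth_fun (\<lambda>x. x $ i)"
| add: "smooth_fun f \<Longrightarrow> smooth_fun g \<Longrightarrow> smooth_fun (\<lambda>x. f x + g x)"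
| mult: "smooth_fun f \<Longrightarrow> smooth_fun g \<Longrightarrow> smooth_fun (\<lambda>x. f x * g x)"
| flat: "smooth_fun (\<lambda>x. flat_exp n (r - (norm (x - z))\<^sup>2))"

lemma partial_deriv_eq:
  "(f has_derivative f') (at x) \<Longrightarrow> partial_deriv i f x = f' (axis i 1)"
  unfolding partial_deriv_def by (metis frechet_derivative_at)

lemma smooth_fun_deriv:
  fixes f :: "real^'n::finite \<Rightarrow> real"
  assumes "smooth_fun f"
  shows "(\<forall>x. f differentiable (at x)) \<and> (\<forall>i. smooth_fun (partial_deriv i f))"
  using assms
proof induction
  case (const c)
  have "partial_deriv i (\<lambda>x::real^'n. c) = (\<lambda>x. 0)" for i
    by (auto simp: partial_deriv_eq[of _ "\<lambda>_. 0"])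
  then show ?case by (auto intro: smooth_fun.const)
next
  case (coord j)
  have d: "((\<lambda>x::real^'n. x $ j) has_derivative (\<lambda>h. h $ j)) (at x)" for x
    by (simp add: bounded_linear_imp_has_derivative bounded_linear_vec_nth)
  have "partial_deriv i (\<lambda>x::real^'n. x $ j) = (\<lambda>x. axis i 1 $ j)" for i
    using partial_deriv_eq[OF d] by auto
  then show ?case using d by (auto intro: smooth_fun.const simp: differentiable_def)
next
  case (add f g)
  have "partial_deriv i (\<lambda>x. f x + g x) = (\<lambda>x. partial_deriv i f x + partial_deriv i g x)" for i
  proof
    fix x
    obtain f' g' where d: "(f has_derivative f') (at x)" "(g has_derivative g') (at x)"
      using add.IH unfolding differentiable_def by blast
    show "partial_deriv i (\<lambda>x. f x + g x) x = partial_deriv i f x + partial_deriv i g x"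
      using partial_deriv_eq[OF has_derivative_add[OF d]] d by (simp add: partial_deriv_eq)
  qed
  then show ?case using add.IH by (auto intro: smooth_fun.add)
next
  case (mult f g)
  have "partial_deriv i (\<lambda>x. f x * g x) = (\<lambda>x. f x * partial_deriv i g x + partial_deriv i f x * g x)" for i
  proof
    fix x
    obtain f' g' where d: "(f has_derivative f') (at x)" "(g has_derivative g') (at x)"
      using mult.IH unfolding differentiable_def by blast
    show "partial_deriv i (\<lambda>x. f x * g x) x = f x * partial_deriv i g x + partial_deriv i f x * g x"
      using partial_deriv_eq[OF has_derivative_mult[OF d]] d by (simp add: partial_deriv_eq)
  qed
  then show ?case using mult by (auto intro!: smooth_fun.add smooth_fun.mult)
next
  case (flat n r z)
  let ?q = "\<lambda>x::real^'n. r - (norm (x - z))\<^sup>2"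
  let ?D = "\<lambda>t. flat_exp (n + 2) t - real n * flat_exp (n + 1) t"
  have q: "(?q has_derivative (\<lambda>h. - 2 * ((x - z) \<bullet> h))) (at x)" for x
    unfolding power2_norm_eq_inner by (auto intro!: derivative_eq_intros simp: inner_commute)
  have d: "((\<lambda>x. flat_exp n (?q x)) has_derivative (\<lambda>h. - 2 * ((x - z) \<bullet> h) * ?D (?q x))) (at x)" for x
    using has_derivative_compose[OF q has_real_derivative_flat[unfolded has_field_derivative_def]]
    by (simp add: mult.commute)
  \<comment> \<open>The derivative is spelled with sums and products only, so that it matches the
    rules of \<open>smooth_fun\<close>.\<close>
  have pd: "partial_deriv i (\<lambda>x. flat_exp n (?q x)) =
      (\<lambda>x. ((-2) * (x $ i + - (z $ i))) * (flat_exp (n + 2) (?q x) + (- real n) * flat_exp (n + 1) (?q x)))" for i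
    by (rule ext, subst partial_deriv_eq[OF d]) (simp add: inner_axis algebra_simps)
  have sm: "smooth_fun (\<lambda>x::real^'n. ((-2) * (x $ i + - (z $ i))) *
      (flat_exp (n + 2) (?q x) + (- real n) * flat_exp (n + 1) (?q x)))" for i
    by (rule smooth_fun.mult[OF smooth_fun.mult[OF smooth_fun.const smooth_fun.add[OF smooth_fun.coord smooth_fun.const]]
        smooth_fun.add[OF smooth_fun.flat smooth_fun.mult[OF smooth_fun.const smooth_fun.flat]]])
  show ?case
  proof (intro conjI allI)
    show "(\<lambda>x. flat_exp n (?q x)) differentiable (at x)" for x
      by (rule differentiableI[OF d])
    show "smooth_fun (partial_deriv i (\<lambda>x. flat_exp n (?q x)))" for i
      unfolding pd by (rule sm)
  qed
qed

lemma test_function_smooth_fun: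
  assumes "smooth_fun f" "bounded {x. f x \<noteq> 0}"
  shows "test_function f"
proof -
  have "smooth_fun (foldr partial_deriv js f)" for js
    using assms(1) by (induction js) (auto dest: smooth_fun_deriv)
  then have "foldr partial_deriv js f differentiable (at x)" for js x
    using smooth_fun_deriv[of "foldr partial_deriv js f"] by simp
  then show ?thesis
    unfolding test_function_def using assms(2) by (simp add: compact_closure)
qed

lemma smooth_fun_power: "smooth_fun f \<Longrightarrow> smooth_fun (\<lambda>x. f x ^ n)"
  by (induction n) (simp_all add: smooth_fun.const smooth_fun.mult)

text \<open>Since \<open>flat_exp 0\<close> has no plateau, the power \<open>N\<close> is used to push the bump up towards 1.\<close>

definition bump :: "real \<Rightarrow> nat \<Rightarrow> real^'n::finite \<Rightarrow> real^'n \<Rightarrow> real" where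
  "bump r N z x = 1 - (1 - flat_exp 0 (r\<^sup>2 - (norm (x - z))\<^sup>2)) ^ N"

lemma smooth_fun_one_minus: "smooth_fun f \<Longrightarrow> smooth_fun (\<lambda>x. 1 - f x)"
  using smooth_fun.add[OF smooth_fun.const[of 1] smooth_fun.mult[OF smooth_fun.const[of "-1"]], of f]
  by simp

lemma smooth_fun_bump: "smooth_fun (bump r N z)"
  unfolding bump_def[abs_def]
  by (intro smooth_fun_one_minus smooth_fun_power smooth_fun.flat)

lemma bump_bounds: "0 \<le> bump r N z x" "bump r N z x \<le> 1"
  using flat0_bounds[of "r\<^sup>2 - (norm (x - z))\<^sup>2"] by (auto simp: bump_def power_le_one)

lemma bump_outside:
  assumes "0 \<le> r" "r \<le> norm (x - z)"
  shows "bump r N z x = 0"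
proof -
  have "r\<^sup>2 \<le> (norm (x - z))\<^sup>2" using assms by (intro power_mono) auto
  then show ?thesis by (simp add: bump_def flat_exp_def)
qed

lemma bump_inside:
  assumes "0 < r" "0 < \<delta>"
  obtains N where "\<And>z x :: real^'n::finite. norm (x - z) \<le> 3 / 4 * r \<Longrightarrow> 1 - \<delta> \<le> bump r N z x"
proof -
  \<comment> \<open>\<open>7 / 16\<close> is \<open>1 - (3 / 4)\<^sup>2\<close>.\<close>
  define c where "c = flat_exp 0 (7 / 16 * r\<^sup>2)"
  have c: "0 < c" "c \<le> 1" using assms flat0_bounds by (auto simp: c_def flat_exp_def)
  obtain N where N: "(1 - c) ^ N < \<delta>" using real_arch_pow_inv[of \<delta> "1 - c"] assms c by auto
  have "1 - \<delta> \<le> bump r N z x" if "norm (x - z) \<le> 3 / 4 * r" for z x :: "real^'n"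
  proof -
    have "(norm (x - z))\<^sup>2 \<le> (3 / 4 * r)\<^sup>2" using that by (intro power_mono) auto
    then have "c \<le> flat_exp 0 (r\<^sup>2 - (norm (x - z))\<^sup>2)"
      unfolding c_def by (intro flat0_mono) (simp add: power2_eq_square)
    then have "(1 - flat_exp 0 (r\<^sup>2 - (norm (x - z))\<^sup>2)) ^ N \<le> (1 - c) ^ N"
      using flat0_bounds[of "r\<^sup>2 - (norm (x - z))\<^sup>2"] by (intro power_mono) auto
    then show ?thesis using N by (simp add: bump_def)
  qed
  then show ?thesis using that by blast
qed

text \<open>A substitute for a partition of unity: each centre moves the value obtained from the
  rest of the list towards its own vector by a convex combination. The norm stays at most 1 without
  normalisation, and smoothness is inherited from the weights.\<close>

primrec blend :: "('a \<Rightarrow> 'b \<Rightarrow> real) \<Rightarrow> ('a \<Rightarrow> 'c) \<Rightarrow> 'a list \<Rightarrow> 'b \<Rightarrow> 'c::real_vector" where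
  "blend b \<nu> [] x = 0"
| "blend b \<nu> (z # zs) x = (1 - b z x) *\<^sub>R blend b \<nu> zs x + b z x *\<^sub>R \<nu> z"

lemma norm_blend_le_1:
  fixes \<nu> :: "'a \<Rightarrow> 'c::real_normed_vector"
  assumes "\<And>z. z \<in> set zs \<Longrightarrow> 0 \<le> b z x \<and> b z x \<le> 1 \<and> norm (\<nu> z) \<le> 1"
  shows "norm (blend b \<nu> zs x) \<le> 1"
  using assms
proof (induction zs)
  case (Cons z zs)
  have "norm (blend b \<nu> (z # zs) x) \<le> (1 - b z x) * norm (blend b \<nu> zs x) + b z x * norm (\<nu> z)"
    using Cons.prems[of z] norm_triangle_ineq[of "(1 - b z x) *\<^sub>R blend b \<nu> zs x" "b z x *\<^sub>R \<nu> z"]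
    by simp
  also have "\<dots> \<le> (1 - b z x) * 1 + b z x * 1"
    using Cons.prems[of z] Cons.IH Cons.prems by (intro add_mono mult_left_mono) auto
  finally show ?case by simp
qed simp

lemma inner_blend_nonneg:
  fixes \<nu> :: "'a \<Rightarrow> 'c::real_inner"
  assumes "\<And>z. z \<in> set zs \<Longrightarrow> 0 \<le> b z x \<and> b z x \<le> 1"
    and "\<And>z. z \<in> set zs \<Longrightarrow> b z x \<noteq> 0 \<Longrightarrow> 0 \<le> \<nu> z \<bullet> u"
  shows "0 \<le> blend b \<nu> zs x \<bullet> u"
  using assms
proof (induction zs)
  case (Cons z zs)
  have "0 \<le> b z x * (\<nu> z \<bullet> u)" using Cons.prems[of z] by (cases "b z x = 0") auto
  moreover have "0 \<le> blend b \<nu> zs x \<bullet> u" using Cons by auto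
  ultimately show ?case using Cons.prems(1)[of z] by (simp add: inner_add_left)
qed simp

text \<open>At a layer of weight at least \<open>1 - \<delta>\<close> the component reaches
  \<open>(1 - \<delta>) * c\<close>, because the layers below contribute nonnegatively. Every later
  layer is a convex combination of this value with one that is at least \<open>c\<close>.\<close>

lemma inner_blend_ge:
  fixes \<nu> :: "'a \<Rightarrow> 'c::real_inner"
  assumes "\<And>z. z \<in> set zs \<Longrightarrow> 0 \<le> b z x \<and> b z x \<le> 1"
    and "\<And>z. z \<in> set zs \<Longrightarrow> b z x \<noteq> 0 \<Longrightarrow> c \<le> \<nu> z \<bullet> u"
    and "0 \<le> c" "0 \<le> \<delta>"
    and "\<exists>z\<in>set zs. 1 - \<delta> \<le> b z x"
  shows "(1 - \<delta>) * c \<le> blend b \<nu> zs x \<bullet> u"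
  using assms
proof (induction zs)
  case (Cons z zs)
  have bz: "b z x * c \<le> b z x * (\<nu> z \<bullet> u)"
    using Cons.prems(1,2)[of z] by (cases "b z x = 0") (auto intro: mult_left_mono)
  have b: "0 \<le> b z x" "b z x \<le> 1" using Cons.prems(1)[of z] by auto
  have eq: "blend b \<nu> (z # zs) x \<bullet> u = (1 - b z x) * (blend b \<nu> zs x \<bullet> u) + b z x * (\<nu> z \<bullet> u)"
    by (simp add: inner_add_left)
  show ?case
  proof (cases "1 - \<delta> \<le> b z x")
    case True
    have "0 \<le> blend b \<nu> zs x \<bullet> u"
    proof (rule inner_blend_nonneg)
      show "0 \<le> b z x \<and> b z x \<le> 1" if "z \<in> set zs" for z using Cons.prems(1) that by simp
      show "0 \<le> \<nu> z \<bullet> u" if "z \<in> set zs" "b z x \<noteq> 0" for z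
        using Cons.prems(2)[of z] that Cons.prems(3) by simp
    qed
    moreover have "(1 - \<delta>) * c \<le> b z x * c" using True Cons.prems(3) by (rule mult_right_mono)
    ultimately show ?thesis using bz b unfolding eq by (smt (verit) mult_nonneg_nonneg)
  next
    case False
    then have "(1 - \<delta>) * c \<le> blend b \<nu> zs x \<bullet> u"
      using Cons.prems by (intro Cons.IH) auto
    then have "(1 - b z x) * ((1 - \<delta>) * c) \<le> (1 - b z x) * (blend b \<nu> zs x \<bullet> u)"
      using b by (intro mult_left_mono) auto
    moreover have "b z x * ((1 - \<delta>) * c) \<le> b z x * c"
      using b Cons.prems(3,4) by (intro mult_left_mono) (auto simp: mult_le_cancel_right2 mult_left_le_one_le)
    ultimately show ?thesis using bz unfolding eq by (simp add: algebra_simps)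
  qed
qed simp

lemma blend_eq_0: "(\<And>z. z \<in> set zs \<Longrightarrow> b z x = 0) \<Longrightarrow> blend b \<nu> zs x = 0"
  by (induction zs) auto

lemma smooth_fun_blend:
  fixes \<nu> :: "'a \<Rightarrow> real^'m"
  assumes "\<And>z. smooth_fun (b z)"
  shows "smooth_fun (\<lambda>x. blend b \<nu> zs x $ i)"
proof (induction zs)
  case Nil
  then show ?case using smooth_fun.const[of 0] by simp
next
  case (Cons z zs)
  have "smooth_fun (\<lambda>x. (1 - b z x) * (blend b \<nu> zs x $ i) + b z x * (\<nu> z $ i))"
    by (intro smooth_fun.add smooth_fun.mult smooth_fun.const smooth_fun_one_minus assms Cons.IH)
  then show ?case by simp
qed

section \<open>A test field close to the outer normal\<close>

lemma inner_unit_ge: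
  fixes u v :: "'b::real_inner"
  assumes "norm u = 1" "norm v = 1"
  shows "1 - norm (u - v) \<le> u \<bullet> v"
proof -
  have "(norm (u - v))\<^sup>2 = 2 - 2 * (u \<bullet> v)"
    using assms by (simp add: power2_norm_eq_inner inner_diff_left inner_diff_right inner_commute norm_eq_1)
  moreover have "norm (u - v) \<le> 2" using norm_triangle_ineq4[of u v] assms by simp
  then have "(norm (u - v))\<^sup>2 \<le> 2 * norm (u - v)"
    unfolding power2_eq_square by (rule mult_right_mono) simp
  ultimately show ?thesis by linarith
qed

text \<open>The interior ball at one boundary point and the exterior ball at another are disjoint,
  so their centres are at least \<open>2 * R\<close> apart; adding the two inequalities obtained by exchanging the points
  gives the Lipschitz bound.\<close>

lemma two_sided_ball_lipschitz:
  fixes \<nu> :: "'b::real_inner \<Rightarrow> 'b"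
  assumes tb: "two_sided_ball R \<Omega> \<nu>" and z: "z \<in> frontier \<Omega>" and z': "z' \<in> frontier \<Omega>"
  shows "R * norm (\<nu> z - \<nu> z') \<le> norm (z - z')"
proof -
  have R: "0 < R" using tb by (simp add: two_sided_ball_def)
  have far: "2 * R \<le> norm ((a - b) - R *\<^sub>R (\<nu> a + \<nu> b))" if "a \<in> frontier \<Omega>" "b \<in> frontier \<Omega>" for a b
  proof (rule ccontr)
    let ?c = "a - R *\<^sub>R \<nu> a" and ?d = "b + R *\<^sub>R \<nu> b"
    assume "\<not> ?thesis"
    then have "dist ?c ?d < 2 * R" by (simp add: dist_norm algebra_simps)
    then have "midpoint ?c ?d \<in> ball ?c R" "midpoint ?c ?d \<in> ball ?d R"
      by (auto simp: dist_midpoint)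
    then show False using tb that unfolding two_sided_ball_def by blast
  qed
  let ?a = "z - z'" and ?s = "\<nu> z + \<nu> z'"
  have n: "\<nu> z \<bullet> \<nu> z = 1" "\<nu> z' \<bullet> \<nu> z' = 1"
    using tb z z' by (auto simp: two_sided_ball_def norm_eq_1)
  have "(2 * R)\<^sup>2 \<le> (norm (?a - R *\<^sub>R ?s))\<^sup>2" using far[OF z z'] R by (intro power_mono) auto
  moreover have "(2 * R)\<^sup>2 \<le> (norm (- ?a - R *\<^sub>R ?s))\<^sup>2"
    using far[OF z' z] R by (intro power_mono) (auto simp: add.commute)
  ultimately have "R\<^sup>2 * (4 - ?s \<bullet> ?s) \<le> ?a \<bullet> ?a"
    unfolding power2_norm_eq_inner
    by (simp add: inner_diff_left inner_diff_right inner_commute power2_eq_square algebra_simps)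
  moreover have "4 - ?s \<bullet> ?s = (\<nu> z - \<nu> z') \<bullet> (\<nu> z - \<nu> z')"
    using n by (simp add: inner_diff_left inner_diff_right inner_add_left inner_add_right inner_commute)
  ultimately have "(R * norm (\<nu> z - \<nu> z'))\<^sup>2 \<le> (norm (z - z'))\<^sup>2"
    by (simp add: power_mult_distrib power2_norm_eq_inner)
  then show ?thesis by (rule power2_le_imp_le) simp
qed

lemma exists_normal_test_field:
  fixes \<Omega> :: "(real^'n::finite) set"
  assumes tb: "two_sided_ball R \<Omega> \<nu>" and "bounded \<Omega>" and \<delta>: "0 < \<delta>" "\<delta> < 1"
  obtains \<phi> \<rho> where "\<And>i. test_function (\<lambda>x. \<phi> x $ i)" "\<And>x. norm (\<phi> x) \<le> 1" "0 < \<rho>"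
    "\<And>z x. z \<in> frontier \<Omega> \<Longrightarrow> norm (x - z) \<le> \<rho> \<Longrightarrow> 1 - \<delta> \<le> \<phi> x \<bullet> \<nu> z"
proof -
  have R: "0 < R" and \<nu>1: "\<And>z. z \<in> frontier \<Omega> \<Longrightarrow> norm (\<nu> z) = 1"
    using tb by (auto simp: two_sided_ball_def)
  \<comment> \<open>A bump that is nonzero at \<open>x\<close> has its centre within
    \<open>r\<close> of \<open>x\<close>, hence within \<open>2 * r = R * \<delta> / 2\<close> of
    \<open>z\<close>. By the Lipschitz bound its normal then differs from \<open>\<nu> z\<close> by
    at most \<open>\<delta> / 2\<close>.\<close>
  define r where "r = R * \<delta> / 4"
  have r: "0 < r" using R \<delta> by (simp add: r_def)
  have cpt: "compact (frontier \<Omega>)" using assms compact_frontier_bounded by blast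
  have cov: "frontier \<Omega> \<subseteq> (\<Union>z\<in>frontier \<Omega>. ball z (r / 2))" using r by force
  \<comment> \<open>Every frontier point is within \<open>r / 2\<close> of a centre. A point within
    \<open>r / 4\<close> of the frontier is then within \<open>3 / 4 * r\<close> of a centre, where
    the bump is nearly 1.\<close>
  obtain D where D: "D \<subseteq> frontier \<Omega>" "finite D" "frontier \<Omega> \<subseteq> (\<Union>z\<in>D. ball z (r / 2))"
    by (rule compactE_image[OF cpt _ cov]) (rule open_ball, rule that)
  obtain zs where zs: "set zs = D" using D(2) finite_list by blast
  obtain N where N: "\<And>z x :: real^'n. norm (x - z) \<le> 3 / 4 * r \<Longrightarrow> 1 - \<delta> / 2 \<le> bump r N z x"
    using bump_inside[OF r, of "\<delta> / 2"] \<delta> by auto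
  define \<phi> where "\<phi> = blend (bump r N) \<nu> zs"
  show ?thesis
  proof (rule that[of \<phi> "r / 4"])
    show "0 < r / 4" using r by simp
    show "norm (\<phi> x) \<le> 1" for x
      unfolding \<phi>_def
    proof (rule norm_blend_le_1)
      fix z assume "z \<in> set zs"
      then have "norm (\<nu> z) = 1" using \<nu>1 D(1) zs by blast
      then show "0 \<le> bump r N z x \<and> bump r N z x \<le> 1 \<and> norm (\<nu> z) \<le> 1"
        using bump_bounds[of r N z x] by simp
    qed
    show "test_function (\<lambda>x. \<phi> x $ i)" for i
    proof (rule test_function_smooth_fun)
      show "smooth_fun (\<lambda>x. \<phi> x $ i)" unfolding \<phi>_def by (rule smooth_fun_blend[OF smooth_fun_bump])
      have "{x. \<phi> x $ i \<noteq> 0} \<subseteq> (\<Union>z\<in>D. cball z r)"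
      proof
        fix x assume "x \<in> {x. \<phi> x $ i \<noteq> 0}"
        then have "\<phi> x \<noteq> 0" by auto
        then obtain z where "z \<in> D" "bump r N z x \<noteq> 0"
          unfolding \<phi>_def using blend_eq_0[of zs "bump r N" x \<nu>] zs by blast
        moreover from this have "norm (x - z) < r" using bump_outside[of r x z N] r by fastforce
        ultimately show "x \<in> (\<Union>z\<in>D. cball z r)"
          by (auto simp: dist_norm norm_minus_commute intro!: bexI[of _ z])
      qed
      then show "bounded {x. \<phi> x $ i \<noteq> 0}"
        using D(2) by (intro bounded_subset[OF bounded_UN]) auto
    qed
    fix z x assume z: "z \<in> frontier \<Omega>" and x: "norm (x - z) \<le> r / 4"
    have "(1 - \<delta> / 2) * (1 - \<delta> / 2) \<le> \<phi> x \<bullet> \<nu> z"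
      unfolding \<phi>_def
    proof (rule inner_blend_ge)
      show "0 \<le> bump r N z x \<and> bump r N z x \<le> 1" for z using bump_bounds by blast
      obtain y where y: "y \<in> D" "dist y z < r / 2" using D(3) z by auto
      have "norm (x - y) \<le> norm (x - z) + norm (z - y)" using norm_triangle_ineq[of "x - z" "z - y"] by simp
      then have "norm (x - y) \<le> 3 / 4 * r" using x y(2) by (simp add: dist_norm norm_minus_commute)
      then show "\<exists>y\<in>set zs. 1 - \<delta> / 2 \<le> bump r N y x" using N y zs by blast
      fix y assume y: "y \<in> set zs" "bump r N y x \<noteq> 0"
      then have "norm (x - y) < r" using bump_outside[of r x y N] r by force
      then have "norm (y - z) \<le> 2 * r"
        using x norm_triangle_ineq[of "y - x" "x - z"] r by (simp add: norm_minus_commute)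
      then have "R * norm (\<nu> y - \<nu> z) \<le> R * (\<delta> / 2)"
        using two_sided_ball_lipschitz[OF tb, of y z] y D zs z by (auto simp: r_def)
      then have "norm (\<nu> y - \<nu> z) \<le> \<delta> / 2" using R by simp
      then show "1 - \<delta> / 2 \<le> \<nu> y \<bullet> \<nu> z"
        using inner_unit_ge[of "\<nu> y" "\<nu> z"] \<nu>1 y D zs z by fastforce
    qed (use \<delta> in auto)
    moreover have "1 - \<delta> \<le> (1 - \<delta> / 2) * (1 - \<delta> / 2)" using \<delta> by (simp add: algebra_simps)
    ultimately show "1 - \<delta> \<le> \<phi> x \<bullet> \<nu> z" by linarith
  qed
qed

section \<open>First variation of volume\<close>

text \<open>Induction on the index set; the point is that \<open>C\<close> is fixed before
  \<open>b\<close> and \<open>h\<close>, so that the expansion holds uniformly over the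
  domain.\<close>

lemma prod_one_plus_expansion:
  assumes "finite S" "0 \<le> B"
  shows "\<exists>C\<ge>0. \<forall>b h::real. (\<forall>i\<in>S. \<bar>b i\<bar> \<le> B) \<longrightarrow> \<bar>h\<bar> \<le> 1 \<longrightarrow>
    \<bar>(\<Prod>i\<in>S. 1 + h * b i) - 1 - h * (\<Sum>i\<in>S. b i)\<bar> \<le> C * h\<^sup>2"
  using assms(1)
proof induction
  case empty
  then show ?case by auto
next
  case (insert k S)
  then obtain C where C: "C \<ge> 0" "\<And>b h::real. (\<forall>i\<in>S. \<bar>b i\<bar> \<le> B) \<Longrightarrow> \<bar>h\<bar> \<le> 1 \<Longrightarrow>
    \<bar>(\<Prod>i\<in>S. 1 + h * b i) - 1 - h * (\<Sum>i\<in>S. b i)\<bar> \<le> C * h\<^sup>2" by blast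
  define C' where "C' = (1 + B) * C + B * (real (card S) * B)"
  have "\<bar>(\<Prod>i\<in>insert k S. 1 + h * b i) - 1 - h * (\<Sum>i\<in>insert k S. b i)\<bar> \<le> C' * h\<^sup>2"
    if b: "\<forall>i\<in>insert k S. \<bar>b i\<bar> \<le> B" and h: "\<bar>h\<bar> \<le> 1" for b :: "'a \<Rightarrow> real" and h
  proof -
    let ?P = "\<Prod>i\<in>S. 1 + h * b i" and ?s = "\<Sum>i\<in>S. b i"
    have 1: "\<bar>?P - 1 - h * ?s\<bar> \<le> C * h\<^sup>2" using C(2)[of b h] b h by simp
    have 2: "\<bar>?s\<bar> \<le> real (card S) * B"
      using b sum_norm_bound[of S b B] by simp
    have 3: "\<bar>1 + h * b k\<bar> \<le> 1 + B"
    proof -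
      have "\<bar>h * b k\<bar> \<le> 1 * B" unfolding abs_mult using h b by (intro mult_mono) auto
      then show ?thesis by linarith
    qed
    have "(\<Prod>i\<in>insert k S. 1 + h * b i) - 1 - h * (\<Sum>i\<in>insert k S. b i)
        = (1 + h * b k) * (?P - 1 - h * ?s) + h\<^sup>2 * (b k * ?s)"
      using insert.hyps by (simp add: algebra_simps power2_eq_square)
    also have "\<bar>\<dots>\<bar> \<le> \<bar>1 + h * b k\<bar> * \<bar>?P - 1 - h * ?s\<bar> + h\<^sup>2 * (\<bar>b k\<bar> * \<bar>?s\<bar>)"
      by (rule order_trans[OF abs_triangle_ineq]) (simp add: abs_mult)
    also have "\<dots> \<le> (1 + B) * (C * h\<^sup>2) + h\<^sup>2 * (B * (real (card S) * B))"
      using 1 2 3 b assms(2) by (intro add_mono mult_mono) (auto simp: C(1))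
    finally show ?thesis by (simp add: C'_def algebra_simps)
  qed
  moreover have "C' \<ge> 0" using C(1) assms(2) by (simp add: C'_def)
  ultimately show ?case by blast
qed

text \<open>In the Leibniz formula the identity contributes the product of the diagonal. Any other
  permutation \<open>p\<close> moves some \<open>i\<close>, and then also \<open>p i\<close>, so its
  term contains two off-diagonal entries, each with a factor \<open>h\<close>.\<close>

lemma det_one_plus_expansion:
  assumes "0 \<le> B"
  shows "\<exists>C\<ge>0. \<forall>(A::real^'n::finite^'n) h. (\<forall>i j. \<bar>A $ i $ j\<bar> \<le> B) \<longrightarrow> \<bar>h\<bar> \<le> 1 \<longrightarrow>
    \<bar>det (mat 1 + h *\<^sub>R A) - 1 - h * (\<Sum>i\<in>UNIV. A $ i $ i)\<bar> \<le> C * h\<^sup>2"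
proof -
  obtain C0 where C0: "C0 \<ge> 0" "\<And>(b::'n \<Rightarrow> real) h. (\<forall>i. \<bar>b i\<bar> \<le> B) \<Longrightarrow> \<bar>h\<bar> \<le> 1 \<Longrightarrow>
    \<bar>(\<Prod>i\<in>UNIV. 1 + h * b i) - 1 - h * (\<Sum>i\<in>UNIV. b i)\<bar> \<le> C0 * h\<^sup>2"
    using prod_one_plus_expansion[of "UNIV :: 'n set" B] assms by auto
  let ?Perm = "{p. p permutes (UNIV :: 'n set)}"
  define C where "C = C0 + real (card (?Perm - {id})) * (1 + B) ^ CARD('n)"
  have "\<bar>det (mat 1 + h *\<^sub>R A) - 1 - h * (\<Sum>i\<in>UNIV. A $ i $ i)\<bar> \<le> C * h\<^sup>2"
    if A: "\<forall>i j. \<bar>A $ i $ j\<bar> \<le> B" and h: "\<bar>h\<bar> \<le> 1" for A :: "real^'n^'n" and h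
  proof -
    define T where "T p = of_int (sign p) * (\<Prod>i\<in>UNIV. (mat 1 + h *\<^sub>R A) $ i $ p i)" for p :: "'n \<Rightarrow> 'n"
    have fin: "finite ?Perm" by (simp add: finite_permutations)
    have "det (mat 1 + h *\<^sub>R A) = (\<Sum>p\<in>?Perm. T p)" by (simp add: det_def T_def)
    also have "\<dots> = T id + (\<Sum>p\<in>?Perm - {id}. T p)"
      using fin by (intro sum.remove) (auto simp: permutes_id)
    finally have det: "det (mat 1 + h *\<^sub>R A) = T id + (\<Sum>p\<in>?Perm - {id}. T p)" .
    have Tid: "T id = (\<Prod>i\<in>UNIV. 1 + h * A $ i $ i)"
      by (simp add: T_def mat_def)
    have "norm (T p) \<le> (1 + B) ^ CARD('n) * h\<^sup>2" if p: "p \<in> ?Perm - {id}" for p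
    proof -
      obtain i where i: "p i \<noteq> i" using p by (metis DiffE ext id_apply insertI1)
      have inj: "inj p" using p permutes_inj by auto
      have j: "p (p i) \<noteq> p i" using i inj by (simp add: inj_eq)
      have le: "norm ((mat 1 + h *\<^sub>R A) $ k $ p k) \<le> (if k \<in> {i, p i} then \<bar>h\<bar> else 1) * (1 + B)" for k
      proof (cases "k \<in> {i, p i}")
        case True
        then have "p k \<noteq> k" using i j by auto
        then have "norm ((mat 1 + h *\<^sub>R A) $ k $ p k) = \<bar>h\<bar> * \<bar>A $ k $ p k\<bar>"
          by (auto simp: mat_def abs_mult)
        also have "\<dots> \<le> \<bar>h\<bar> * (1 + B)" using A[rule_format, of k "p k"] by (intro mult_left_mono) auto
        finally show ?thesis using True by simp
      next
        case False
        have "\<bar>h * A $ k $ p k\<bar> \<le> 1 * B" unfolding abs_mult using h A by (intro mult_mono) auto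
        then have "norm ((mat 1 + h *\<^sub>R A) $ k $ p k) \<le> 1 + B"
          by (auto simp: mat_def split: if_splits)
        then show ?thesis using False by simp
      qed
      have "norm (T p) = (\<Prod>k\<in>UNIV. norm ((mat 1 + h *\<^sub>R A) $ k $ p k))"
        unfolding T_def by (simp add: abs_mult sign_def prod_norm abs_prod)
      also have "\<dots> \<le> (\<Prod>k\<in>UNIV. (if k \<in> {i, p i} then \<bar>h\<bar> else 1) * (1 + B))"
        by (intro prod_mono conjI norm_ge_zero le)
      also have "\<dots> = (\<Prod>k\<in>UNIV. if k \<in> {i, p i} then \<bar>h\<bar> else 1) * (1 + B) ^ CARD('n)"
        by (simp add: prod.distrib)
      also have "(\<Prod>k\<in>UNIV. if k \<in> {i, p i} then \<bar>h\<bar> else 1) = (\<Prod>k\<in>{i, p i}. \<bar>h\<bar>)"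
        by (simp only: prod.If_cases[OF finite]) (simp add: Collect_disj_eq insert_commute)
      also have "\<dots> = h\<^sup>2" using i by (simp add: power2_eq_square flip: abs_mult)
      finally show ?thesis by (simp add: mult.commute)
    qed
    then have "norm (\<Sum>p\<in>?Perm - {id}. T p) \<le> real (card (?Perm - {id})) * ((1 + B) ^ CARD('n) * h\<^sup>2)"
      by (rule sum_norm_bound)
    moreover have "\<bar>T id - 1 - h * (\<Sum>i\<in>UNIV. A $ i $ i)\<bar> \<le> C0 * h\<^sup>2"
      unfolding Tid using C0(2)[of "\<lambda>i. A $ i $ i" h] A h by simp
    ultimately show ?thesis unfolding det C_def by (simp add: algebra_simps)
  qed
  moreover have "C \<ge> 0" using C0(1) assms by (simp add: C_def)
  ultimately show ?thesis by blast
qed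

text \<open>For small \<open>h\<close> the map is injective with positive Jacobian determinant, so
  the volume of the image is the integral of this determinant, which is expanded to first order
  uniformly in the point.\<close>

lemma flow_volume_expansion_wellorder:
  fixes \<psi> :: "real^'m::{finite,wellorder} \<Rightarrow> real^'m::_"
  assumes der: "\<And>x. (\<psi> has_derivative \<psi>' x) (at x)"
    and cont: "\<And>i j. continuous_on UNIV (\<lambda>x. \<psi>' x (axis j 1) $ i)"
    and bnd: "\<And>i j x. \<bar>\<psi>' x (axis j 1) $ i\<bar> \<le> B"
    and lip: "\<And>x y. norm (\<psi> x - \<psi> y) \<le> K * norm (x - y)"
    and \<Omega>: "open \<Omega>" "bounded \<Omega>"
  shows "\<exists>C h0. 0 \<le> C \<and> 0 < h0 \<and> (\<forall>h. 0 < h \<longrightarrow> h < h0 \<longrightarrow>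
     open ((\<lambda>x. x + h *\<^sub>R \<psi> x) ` \<Omega>) \<and>
     \<bar>measure lborel ((\<lambda>x. x + h *\<^sub>R \<psi> x) ` \<Omega>) - measure lborel \<Omega>
       - h * (LINT x:\<Omega>|lborel. (\<Sum>i\<in>UNIV. \<psi>' x (axis i 1) $ i))\<bar> \<le> C * h\<^sup>2)"
proof -
  have "0 \<le> B" using bnd[of 0 undefined undefined] by linarith
  then obtain C where C: "0 \<le> C" "\<And>(A::real^'m::{finite,wellorder}^'m::{finite,wellorder}) h. (\<forall>i j. \<bar>A $ i $ j\<bar> \<le> B) \<Longrightarrow> \<bar>h\<bar> \<le> 1 \<Longrightarrow>
    \<bar>det (mat 1 + h *\<^sub>R A) - 1 - h * (\<Sum>i\<in>UNIV. A $ i $ i)\<bar> \<le> C * h\<^sup>2"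
    using det_one_plus_expansion[of B] by blast
  define A where "A x = matrix (\<psi>' x)" for x
  have Aij: "A x $ i $ j = \<psi>' x (axis j 1) $ i" for x i j by (simp add: A_def matrix_def)
  define dv where "dv x = (\<Sum>i\<in>UNIV. A x $ i $ i)" for x
  have dv_bound: "\<bar>dv x\<bar> \<le> real CARD('m) * B" for x
    using sum_norm_bound[of UNIV "\<lambda>i. A x $ i $ i" B] bnd by (simp add: dv_def Aij)
  have contdv: "continuous_on UNIV dv" unfolding dv_def[abs_def] Aij by (intro continuous_on_sum cont)
  \<comment> \<open>The summands of the denominator serve in turn for
    \<open>\<bar>h\<bar> \<le> 1\<close>, for injectivity, and, the last two, for positivity of the
    determinant.\<close>
  define h0 where "h0 = 1 / (1 + \<bar>K\<bar> + C + real CARD('m) * B)"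
  have den: "0 < 1 + \<bar>K\<bar> + C + real CARD('m) * B" using C(1) \<open>0 \<le> B\<close>
    by (intro add_pos_nonneg) auto
  have h0: "0 < h0" using den by (simp add: h0_def)
  have S: "\<Omega> \<in> lmeasurable" using \<Omega> by (simp add: bounded_set_imp_lmeasurable)
  have "open ((\<lambda>x. x + h *\<^sub>R \<psi> x) ` \<Omega>) \<and>
     \<bar>measure lborel ((\<lambda>x. x + h *\<^sub>R \<psi> x) ` \<Omega>) - measure lborel \<Omega>
       - h * (LINT x:\<Omega>|lborel. dv x)\<bar> \<le> (C * measure lebesgue \<Omega>) * h\<^sup>2" if h: "0 < h" "h < h0" for h
  proof -
    let ?\<Phi> = "\<lambda>x. x + h *\<^sub>R \<psi> x"
    have "h * (1 + \<bar>K\<bar> + C + real CARD('m) * B) < 1" using h den by (simp add: h0_def field_simps)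
    then have hs: "h + h * \<bar>K\<bar> + h * C + h * (real CARD('m) * B) < 1" by (simp add: algebra_simps)
    have nn: "0 \<le> h * \<bar>K\<bar>" "0 \<le> h * C" "0 \<le> h * (real CARD('m) * B)" using h C \<open>0 \<le> B\<close> by auto
    have h1: "\<bar>h\<bar> \<le> 1" using hs nn h by linarith
    have hK: "h * \<bar>K\<bar> < 1" using hs nn h by linarith
    have inj: "inj ?\<Phi>"
    proof (rule injI, rule ccontr)
      fix x y assume eq: "x + h *\<^sub>R \<psi> x = y + h *\<^sub>R \<psi> y" and "x \<noteq> y"
      then have "x - y = h *\<^sub>R (\<psi> y - \<psi> x)" by (simp add: algebra_simps)
      then have "norm (x - y) = h * norm (\<psi> y - \<psi> x)" using h by simp
      also have "\<dots> \<le> h * (K * norm (x - y))" using lip[of y x] h by (simp add: norm_minus_commute)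
      also have "\<dots> \<le> h * \<bar>K\<bar> * norm (x - y)" using h by (simp add: mult_right_mono mult_left_mono)
      also have "\<dots> < 1 * norm (x - y)" using hK \<open>x \<noteq> y\<close> by (intro mult_strict_right_mono) auto
      finally show False by simp
    qed
    have derPhi: "(?\<Phi> has_derivative (\<lambda>v. v + h *\<^sub>R \<psi>' x v)) (at x within \<Omega>)" for x
      using has_derivative_at_withinI[OF der] by (intro derivative_intros) auto
    have mat: "matrix (\<lambda>v. v + h *\<^sub>R \<psi>' x v) = mat 1 + h *\<^sub>R A x" for x
      by (simp add: matrix_def A_def mat_def axis_def vec_eq_iff)
    have exp: "\<bar>det (mat 1 + h *\<^sub>R A x) - 1 - h * dv x\<bar> \<le> C * h\<^sup>2" for x
      unfolding dv_def by (rule C(2)) (use bnd h1 in \<open>auto simp: Aij\<close>)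
    have detpos: "0 < det (mat 1 + h *\<^sub>R A x)" for x
    proof -
      have "h * \<bar>dv x\<bar> \<le> h * (real CARD('m) * B)" using dv_bound h by (intro mult_left_mono) auto
      moreover have "\<bar>h * dv x\<bar> = h * \<bar>dv x\<bar>" using h by (simp add: abs_mult)
      moreover have "C * h\<^sup>2 \<le> h * C" using h1 h C(1) mult_left_mono[of "h * h" h C] by (simp add: power2_eq_square mult_left_le mult.commute)
      ultimately show ?thesis using exp[of x] hs nn h by linarith
    qed
    have contdet: "continuous_on UNIV (\<lambda>x. det (mat 1 + h *\<^sub>R A x))"
      unfolding det_def by (auto intro!: continuous_intros cont simp: Aij)
    have bnddet: "\<bar>det (mat 1 + h *\<^sub>R A x)\<bar> \<le> 1 + h * (real CARD('m) * B) + C * h\<^sup>2" for x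
    proof -
      have "h * \<bar>dv x\<bar> \<le> h * (real CARD('m) * B)" using dv_bound h by (intro mult_left_mono) auto
      moreover have "\<bar>h * dv x\<bar> = h * \<bar>dv x\<bar>" using h by (simp add: abs_mult)
      ultimately show ?thesis using exp[of x] by linarith
    qed
    have \<Omega>b: "\<Omega> \<in> sets lborel" "emeasure lborel \<Omega> < \<infinity>"
      using \<Omega> emeasure_bounded_finite[of \<Omega>] by auto
    have int: "set_integrable lborel \<Omega> f" if "continuous_on UNIV f" "\<And>x. \<bar>f x\<bar> \<le> c"
      for f :: "real^'m::{finite,wellorder} \<Rightarrow> real" and c
    proof -
      have fm: "f \<in> borel_measurable borel" by (rule borel_measurable_continuous_onI[OF that(1)])
      show ?thesis unfolding set_integrable_def
        by (rule integrableI_bounded_set[where A = \<Omega> and B = c])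
           (use \<Omega>b that(2) fm in \<open>auto simp: indicator_def\<close>)
    qed
    have intdet: "set_integrable lborel \<Omega> (\<lambda>x. det (mat 1 + h *\<^sub>R A x))" by (rule int[OF contdet bnddet])
    have intdv: "set_integrable lborel \<Omega> dv" by (rule int[OF contdv dv_bound])
    have intc: "set_integrable lborel \<Omega> (\<lambda>_. c)" for c :: real
      by (rule int[of _ "\<bar>c\<bar>"]) auto
    have hi: "((\<lambda>x. det (mat 1 + h *\<^sub>R A x)) has_integral (LINT x:\<Omega>|lborel. det (mat 1 + h *\<^sub>R A x))) \<Omega>"
      using set_borel_integral_eq_integral[OF intdet] by (simp add: integrable_integral)
    have "?\<Phi> ` \<Omega> \<in> lmeasurable \<and> measure lebesgue (?\<Phi> ` \<Omega>) = (LINT x:\<Omega>|lborel. det (mat 1 + h *\<^sub>R A x))"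
      by (subst has_measure_differentiable_image[OF _ derPhi])
         (use hi S detpos in \<open>auto simp: mat abs_of_pos inj_on_subset[OF inj]\<close>)
    \<comment> \<open>Invariance of domain makes the image open, hence Borel, so its
      \<open>lebesgue\<close> measure is its \<open>lborel\<close> measure.\<close>
    moreover have opn: "open (?\<Phi> ` \<Omega>)"
    proof (rule invariance_of_domain)
      have "continuous_on \<Omega> \<psi>"
        by (rule has_derivative_continuous_on) (rule has_derivative_at_withinI[OF der])
      then show "continuous_on \<Omega> ?\<Phi>" by (intro continuous_intros)
    qed (use \<Omega> inj_on_subset[OF inj] in auto)
    ultimately have m: "measure lborel (?\<Phi> ` \<Omega>) = (LINT x:\<Omega>|lborel. det (mat 1 + h *\<^sub>R A x))"
      by simp
    have c1: "(LINT x:\<Omega>|lborel. (1::real)) = measure lborel \<Omega>"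
      using \<Omega>b by (simp add: set_lebesgue_integral_def)
    have "measure lborel (?\<Phi> ` \<Omega>) - measure lborel \<Omega> - h * (LINT x:\<Omega>|lborel. dv x)
       = (LINT x:\<Omega>|lborel. det (mat 1 + h *\<^sub>R A x) - 1 - h * dv x)"
      unfolding m using intdet intdv intc[of 1] c1
      by (simp add: set_integral_diff set_integral_mult_right set_integrable_mult_right)
    also have "\<bar>\<dots>\<bar> \<le> (LINT x:\<Omega>|lborel. C * h\<^sup>2)"
    proof -
      have i1: "set_integrable lborel \<Omega> (\<lambda>x. det (mat 1 + h *\<^sub>R A x) - 1 - h * dv x)"
        using intdet intdv intc[of 1] by (intro set_integral_diff set_integrable_mult_right)
      have "\<bar>LINT x:\<Omega>|lborel. det (mat 1 + h *\<^sub>R A x) - 1 - h * dv x\<bar>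
         \<le> (LINT x:\<Omega>|lborel. \<bar>det (mat 1 + h *\<^sub>R A x) - 1 - h * dv x\<bar>)"
        using set_integral_norm_bound[OF i1] by simp
      also have "\<dots> \<le> (LINT x:\<Omega>|lborel. C * h\<^sup>2)"
        using i1 intc exp by (intro set_integral_mono) (auto intro: set_integrable_abs)
      finally show ?thesis .
    qed
    also have "\<dots> = C * measure lebesgue \<Omega> * h\<^sup>2"
      using c1 \<Omega>b by (simp add: set_lebesgue_integral_def)
    finally show ?thesis using opn by blast
  qed
  then show ?thesis unfolding dv_def Aij using C(1) h0
    by (intro exI[of _ "C * measure lebesgue \<Omega>"] exI[of _ h0]) auto
qed

text \<open>The change of variables theorem of the library requires the index type of the coordinates
  to be well-ordered; \<open>'a idx\<close> is a well-ordered copy of the finite type \<open>'a\<close>.\<close>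

typedef ('a::finite) idx = "{..<CARD('a)}" morphisms nat_of_idx idx_of_nat
  by (rule exI[of _ 0]) simp

instantiation idx :: (finite) wellorder
begin

definition less_eq_idx :: "'a idx \<Rightarrow> 'a idx \<Rightarrow> bool" where
  "less_eq_idx x y \<longleftrightarrow> nat_of_idx x \<le> nat_of_idx y"

definition less_idx :: "'a idx \<Rightarrow> 'a idx \<Rightarrow> bool" where
  "less_idx x y \<longleftrightarrow> nat_of_idx x < nat_of_idx y"

instance
proof
  fix P and a :: "'a idx"
  assume *: "\<And>x::'a idx. (\<And>y. y < x \<Longrightarrow> P y) \<Longrightarrow> P x"
  show "P a"
    by (induction a rule: measure_induct_rule[of nat_of_idx]) (rule *, simp add: less_idx_def)
qed (auto simp: less_eq_idx_def less_idx_def nat_of_idx_inject)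

end

instance idx :: (finite) finite
proof
  have "(UNIV :: 'a idx set) = idx_of_nat ` {..<CARD('a)}"
    using type_definition.Abs_image[OF type_definition_idx] by auto
  then show "finite (UNIV :: 'a idx set)" by (metis finite_imageI finite_lessThan)
qed

lemma exists_bij_idx: "\<exists>g :: 'n::finite \<Rightarrow> 'n idx. bij g"
proof -
  have "card (UNIV :: 'n idx set) = CARD('n)"
    using type_definition.card[OF type_definition_idx] by simp
  then show ?thesis by (metis finite_same_card_bij finite)
qed

section \<open>Relabelling coordinates preserves Lebesgue measure\<close>

lemma prod_Basis_cart: "(\<Prod>b\<in>(Basis :: (real^'n::finite) set). f b) = (\<Prod>i\<in>UNIV. f (axis i 1))"
proof -
  have 1: "(Basis :: (real^'n) set) = range (\<lambda>i. axis i 1)" by (auto simp: Basis_vec_def)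
  have 2: "inj (\<lambda>i::'n. axis i (1::real))" by (auto simp: inj_def axis_eq_axis)
  show ?thesis unfolding 1 by (subst prod.reindex[OF 2]) simp
qed

lemma distr_lborel_permute_coords:
  fixes g :: "'n::finite \<Rightarrow> 'm::finite"
  assumes "bij g"
  shows "distr lborel borel (\<lambda>y::real^'m. \<chi> i. y $ g i) = (lborel :: (real^'n) measure)"
proof (rule lborel_eqI[symmetric])
  let ?s = "\<lambda>y::real^'m. (\<chi> i. y $ g i) :: real^'n"
  let ?t = "\<lambda>x::real^'n. (\<chi> j. x $ inv g j) :: real^'m"
  have [measurable]: "?s \<in> borel_measurable borel"
    by (intro borel_measurable_continuous_onI continuous_intros)
  fix l u :: "real^'n" assume le: "\<And>b. b \<in> Basis \<Longrightarrow> l \<bullet> b \<le> u \<bullet> b"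
  have le': "l $ i \<le> u $ i" for i using le[of "axis i 1"] by (simp add: inner_axis)
  have surj: "g (inv g j) = j" for j using assms by (simp add: bij_is_surj surj_f_inv_f)
  have "?s -` box l u = box (?t l) (?t u)"
  proof (intro set_eqI iffI)
    fix y assume "y \<in> ?s -` box l u"
    then have "l $ i < y $ g i \<and> y $ g i < u $ i" for i by (simp add: mem_box_cart)
    then have "l $ inv g j < y $ j \<and> y $ j < u $ inv g j" for j by (metis surj)
    then show "y \<in> box (?t l) (?t u)" by (simp add: mem_box_cart)
  next
    fix y assume "y \<in> box (?t l) (?t u)"
    then have *: "l $ inv g j < y $ j \<and> y $ j < u $ inv g j" for j by (simp add: mem_box_cart)
    have "l $ i < y $ g i \<and> y $ g i < u $ i" for i
      using *[of "g i"] assms by (simp add: bij_is_inj inv_f_f)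
    then show "y \<in> ?s -` box l u" by (simp add: mem_box_cart)
  qed
  then have "emeasure (distr lborel borel ?s) (box l u) = emeasure lborel (box (?t l) (?t u))"
    by (simp add: emeasure_distr)
  also have "\<dots> = (\<Prod>j\<in>UNIV. u $ inv g j - l $ inv g j)"
  proof (subst emeasure_lborel_box)
    show "?t l \<bullet> b \<le> ?t u \<bullet> b" if "b \<in> Basis" for b
      using le' that by (auto simp: Basis_vec_def inner_axis)
  qed (simp add: prod_Basis_cart inner_axis)
  also have "(\<Prod>j\<in>UNIV. u $ inv g j - l $ inv g j) = (\<Prod>i\<in>UNIV. u $ i - l $ i)"
    by (rule prod.reindex_bij_betw[of "inv g" UNIV UNIV "\<lambda>i. u $ i - l $ i"])
       (use assms in \<open>simp add: bij_imp_bij_inv\<close>)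
  also have "\<dots> = (\<Prod>b\<in>Basis. (u - l) \<bullet> b)" by (simp add: prod_Basis_cart inner_axis)
  finally show "emeasure (distr lborel borel ?s) (box l u) = (\<Prod>b\<in>Basis. (u - l) \<bullet> b)" .
qed simp

text \<open>Conjugation with the relabelling \<open>\<sigma>\<close>, which preserves norms,
  Lebesgue measure and the trace of the derivative, reduces the claim to a well-ordered index
  type.\<close>

lemma flow_volume_expansion:
  fixes \<psi> :: "real^'n::finite \<Rightarrow> real^'n"
  assumes der: "\<And>x. (\<psi> has_derivative \<psi>' x) (at x)"
    and cont: "\<And>i j. continuous_on UNIV (\<lambda>x. \<psi>' x (axis j 1) $ i)"
    and bnd: "\<And>i j x. \<bar>\<psi>' x (axis j 1) $ i\<bar> \<le> B"
    and lip: "\<And>x y. norm (\<psi> x - \<psi> y) \<le> K * norm (x - y)"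
    and \<Omega>: "open \<Omega>" "bounded \<Omega>"
  shows "\<exists>C h0. 0 \<le> C \<and> 0 < h0 \<and> (\<forall>h. 0 < h \<longrightarrow> h < h0 \<longrightarrow>
     open ((\<lambda>x. x + h *\<^sub>R \<psi> x) ` \<Omega>) \<and>
     \<bar>measure lborel ((\<lambda>x. x + h *\<^sub>R \<psi> x) ` \<Omega>) - measure lborel \<Omega>
       - h * (LINT x:\<Omega>|lborel. (\<Sum>i\<in>UNIV. \<psi>' x (axis i 1) $ i))\<bar> \<le> C * h\<^sup>2)"
proof -
  obtain g :: "'n \<Rightarrow> 'n idx" where g: "bij g" using exists_bij_idx by blast
  define \<sigma> :: "real^'n idx \<Rightarrow> real^'n" where "\<sigma> y = (\<chi> i. y $ g i)" for y
  define \<tau> :: "real^'n \<Rightarrow> real^'n idx" where "\<tau> x = (\<chi> j. x $ inv g j)" for x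
  have surj: "g (inv g j) = j" for j using g by (simp add: bij_is_surj surj_f_inv_f)
  have injg: "inv g (g i) = i" for i using g by (simp add: bij_is_inj inv_f_f)
  have st: "\<sigma> (\<tau> x) = x" for x by (simp add: \<sigma>_def \<tau>_def injg)
  have ts: "\<tau> (\<sigma> y) = y" for y by (simp add: \<sigma>_def \<tau>_def surj)
  have lin: "linear \<sigma>" "linear \<tau>" by (auto intro!: linearI simp: \<sigma>_def \<tau>_def vec_eq_iff)
  then have bl: "bounded_linear \<sigma>" "bounded_linear \<tau>" by (auto simp: linear_conv_bounded_linear)
  have cs: "continuous_on UNIV \<sigma>" "continuous_on UNIV \<tau>"
    using bl by (auto intro: linear_continuous_on)
  have nt: "norm (\<tau> x) = norm x" for x
    unfolding norm_vec_def L2_set_def \<tau>_def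
    using sum.reindex_bij_betw[of "inv g" UNIV UNIV "\<lambda>i. (norm (x $ i))\<^sup>2"] g
    by (simp add: bij_imp_bij_inv)
  have ns: "norm (\<sigma> y) = norm y" for y using nt[of "\<sigma> y"] ts by simp
  have saxis: "\<sigma> (axis j 1) = axis (inv g j) 1" for j
    by (auto simp: \<sigma>_def axis_def vec_eq_iff surj injg)
  have dist1: "distr lborel borel \<sigma> = lborel" unfolding \<sigma>_def[abs_def] by (rule distr_lborel_permute_coords[OF g])
  have [measurable]: "\<sigma> \<in> borel_measurable borel" "\<tau> \<in> borel_measurable borel"
    using cs by (auto intro: borel_measurable_continuous_onI)
  define \<psi>2 where "\<psi>2 y = \<tau> (\<psi> (\<sigma> y))" for y
  define \<psi>2' where "\<psi>2' y v = \<tau> (\<psi>' (\<sigma> y) (\<sigma> v))" for y v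
  have entry: "\<psi>2' y (axis j 1) $ i = \<psi>' (\<sigma> y) (axis (inv g j) 1) $ inv g i" for y i j
    by (simp add: \<psi>2'_def saxis) (simp add: \<tau>_def)
  let ?\<Omega>2 = "\<sigma> -` \<Omega>"
  have "\<exists>C h0. 0 \<le> C \<and> 0 < h0 \<and> (\<forall>h. 0 < h \<longrightarrow> h < h0 \<longrightarrow>
     open ((\<lambda>x. x + h *\<^sub>R \<psi>2 x) ` ?\<Omega>2) \<and>
     \<bar>measure lborel ((\<lambda>x. x + h *\<^sub>R \<psi>2 x) ` ?\<Omega>2) - measure lborel ?\<Omega>2
       - h * (LINT x:?\<Omega>2|lborel. (\<Sum>i\<in>UNIV. \<psi>2' x (axis i 1) $ i))\<bar> \<le> C * h\<^sup>2)"
  proof (rule flow_volume_expansion_wellorder)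
    show "(\<psi>2 has_derivative \<psi>2' x) (at x)" for x
      unfolding \<psi>2_def[abs_def] \<psi>2'_def[abs_def]
      by (intro bounded_linear.has_derivative[OF bl(2)] has_derivative_compose[OF _ der]
          bounded_linear_imp_has_derivative bl(1))
    show "continuous_on UNIV (\<lambda>x. \<psi>2' x (axis j 1) $ i)" for i j
      unfolding entry by (rule continuous_on_compose2[OF cont cs(1)]) simp
    show "\<bar>\<psi>2' x (axis j 1) $ i\<bar> \<le> B" for i j x
      unfolding entry by (rule bnd)
    show "norm (\<psi>2 x - \<psi>2 y) \<le> K * norm (x - y)" for x y
      unfolding \<psi>2_def using lip[of "\<sigma> x" "\<sigma> y"] lin by (simp add: nt ns flip: linear_diff)
    show "open ?\<Omega>2" using \<Omega>(1) cs(1) by (simp add: open_vimage)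
    show "bounded ?\<Omega>2" using \<Omega>(2) unfolding bounded_iff by (metis ns vimageE)
  qed
  then obtain C h0 where C: "0 \<le> C" "0 < h0" and exp: "\<And>h. 0 < h \<Longrightarrow> h < h0 \<Longrightarrow>
     open ((\<lambda>x. x + h *\<^sub>R \<psi>2 x) ` ?\<Omega>2) \<and>
     \<bar>measure lborel ((\<lambda>x. x + h *\<^sub>R \<psi>2 x) ` ?\<Omega>2) - measure lborel ?\<Omega>2
       - h * (LINT x:?\<Omega>2|lborel. (\<Sum>i\<in>UNIV. \<psi>2' x (axis i 1) $ i))\<bar> \<le> C * h\<^sup>2"
    by blast
  have meas: "measure lborel (\<sigma> -` S) = measure lborel S" if "S \<in> sets borel" for S
    using measure_distr[of \<sigma> lborel borel S] that by (simp add: dist1)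
  have img: "(\<lambda>x. x + h *\<^sub>R \<psi>2 x) ` ?\<Omega>2 = \<sigma> -` ((\<lambda>x. x + h *\<^sub>R \<psi> x) ` \<Omega>)" for h
  proof (rule set_eqI, rule iffI)
    fix y assume "y \<in> (\<lambda>x. x + h *\<^sub>R \<psi>2 x) ` ?\<Omega>2"
    then obtain x where x: "\<sigma> x \<in> \<Omega>" "y = x + h *\<^sub>R \<psi>2 x" by auto
    then have "\<sigma> y = \<sigma> x + h *\<^sub>R \<psi> (\<sigma> x)"
      using lin by (simp add: linear_add linear_cmul \<psi>2_def st)
    then show "y \<in> \<sigma> -` ((\<lambda>x. x + h *\<^sub>R \<psi> x) ` \<Omega>)" using x by auto
  next
    fix y assume "y \<in> \<sigma> -` ((\<lambda>x. x + h *\<^sub>R \<psi> x) ` \<Omega>)"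
    then obtain x where x: "x \<in> \<Omega>" "\<sigma> y = x + h *\<^sub>R \<psi> x" by auto
    then have "y = \<tau> x + h *\<^sub>R \<psi>2 (\<tau> x)"
      using lin ts[of y] by (simp add: linear_add linear_cmul \<psi>2_def st)
    moreover have "\<tau> x \<in> ?\<Omega>2" using x st by simp
    ultimately show "y \<in> (\<lambda>x. x + h *\<^sub>R \<psi>2 x) ` ?\<Omega>2" by blast
  qed
  have div: "(LINT x:?\<Omega>2|lborel. (\<Sum>i\<in>UNIV. \<psi>2' x (axis i 1) $ i))
       = (LINT x:\<Omega>|lborel. (\<Sum>i\<in>UNIV. \<psi>' x (axis i 1) $ i))"
  proof -
    have [measurable]: "(\<lambda>x. \<Sum>i\<in>UNIV. \<psi>' x (axis i 1) $ i) \<in> borel_measurable borel"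
      by (intro borel_measurable_continuous_onI continuous_on_sum cont)
    have [measurable]: "\<Omega> \<in> sets borel" using \<Omega> by simp
    have tr: "(\<Sum>i\<in>UNIV. \<psi>2' x (axis i 1) $ i) = (\<Sum>i\<in>UNIV. \<psi>' (\<sigma> x) (axis i 1) $ i)" for x
      unfolding entry using sum.reindex_bij_betw[of "inv g" UNIV UNIV "\<lambda>i. \<psi>' (\<sigma> x) (axis i 1) $ i"] g
      by (simp add: bij_imp_bij_inv)
    have "(LINT x:\<Omega>|lborel. (\<Sum>i\<in>UNIV. \<psi>' x (axis i 1) $ i))
       = (LINT x:\<Omega>|distr lborel borel \<sigma>. (\<Sum>i\<in>UNIV. \<psi>' x (axis i 1) $ i))"
      by (simp add: dist1)
    also have "\<dots> = (LINT x:?\<Omega>2|lborel. (\<Sum>i\<in>UNIV. \<psi>' (\<sigma> x) (axis i 1) $ i))"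
      unfolding set_lebesgue_integral_def by (subst integral_distr) (auto simp: indicator_def)
    finally show ?thesis by (simp add: tr)
  qed
  have "open ((\<lambda>x. x + h *\<^sub>R \<psi> x) ` \<Omega>) \<and>
     \<bar>measure lborel ((\<lambda>x. x + h *\<^sub>R \<psi> x) ` \<Omega>) - measure lborel \<Omega>
       - h * (LINT x:\<Omega>|lborel. (\<Sum>i\<in>UNIV. \<psi>' x (axis i 1) $ i))\<bar> \<le> C * h\<^sup>2"
    if h: "0 < h" "h < h0" for h
  proof -
    let ?A = "(\<lambda>x. x + h *\<^sub>R \<psi> x) ` \<Omega>"
    have "open (\<sigma> -` ?A)" using exp[OF h] img by simp
    then have "open (\<tau> -` (\<sigma> -` ?A))" using cs(2) by (simp add: open_vimage)
    moreover have "\<tau> -` (\<sigma> -` ?A) = ?A" by (auto simp: st)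
    ultimately have o: "open ?A" by simp
    then show ?thesis using exp[OF h] \<Omega> unfolding img div by (simp add: meas)
  qed
  then show ?thesis using C by blast
qed

section \<open>Flows along test fields\<close>

lemma test_function_partial_deriv:
  fixes f :: "real^'n::finite \<Rightarrow> real"
  assumes "test_function f"
  shows "f differentiable (at x)" "continuous_on UNIV (partial_deriv j f)"
    "\<exists>B. \<forall>x. \<bar>partial_deriv j f x\<bar> \<le> B"
proof -
  have d: "\<And>js x. foldr partial_deriv js f differentiable (at x)"
    and K: "compact (closure {x. f x \<noteq> 0})"
    using assms by (auto simp: test_function_def)
  show "f differentiable (at x)" using d[of "[]"] by simp
  have "partial_deriv j f differentiable (at x)" for x using d[of "[j]"] by simp
  then show c: "continuous_on UNIV (partial_deriv j f)"
    by (simp add: continuous_on_eq_continuous_at differentiable_imp_continuous_within)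
  let ?K = "closure {x. f x \<noteq> 0}"
  have "bounded (partial_deriv j f ` ?K)"
    using K c by (intro compact_imp_bounded compact_continuous_image) (auto intro: continuous_on_subset)
  then obtain B where B: "\<And>x. x \<in> ?K \<Longrightarrow> \<bar>partial_deriv j f x\<bar> \<le> B"
    by (auto simp: bounded_iff)
  have "\<bar>partial_deriv j f x\<bar> \<le> max B 0" for x
  proof (cases "x \<in> ?K")
    case False
    \<comment> \<open>Off the closed support the function is locally 0, hence so is its
      derivative.\<close>
    have "((\<lambda>_. 0) has_derivative (\<lambda>_. 0)) (at x)" by simp
    then have "(f has_derivative (\<lambda>_. 0)) (at x)"
      by (rule has_derivative_transform_within_open[of _ _ _ _ "- ?K"])
         (use False closure_subset[of "{x. f x \<noteq> 0}"] in auto)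
    then show ?thesis by (simp add: partial_deriv_eq)
  qed (use B in force)
  then show "\<exists>B. \<forall>x. \<bar>partial_deriv j f x\<bar> \<le> B" by blast
qed

text \<open>The minus sign turns an outward field into an inward motion. The bound on the derivative
  also yields the Lipschitz constant \<open>K\<close>, which feeds the fixed point argument
  below.\<close>

lemma test_field_flow_volume:
  fixes \<phi> :: "real^'n::finite \<Rightarrow> real^'n"
  assumes \<phi>: "\<And>i. test_function (\<lambda>x. \<phi> x $ i)" and \<Omega>: "open \<Omega>" "bounded \<Omega>"
  obtains K C h0 where "0 \<le> C" "0 < h0" "\<And>x y. norm (\<phi> x - \<phi> y) \<le> K * norm (x - y)"
    "\<And>h. 0 < h \<Longrightarrow> h < h0 \<Longrightarrow> open ((\<lambda>x. x - h *\<^sub>R \<phi> x) ` \<Omega>)"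
    "\<And>h. 0 < h \<Longrightarrow> h < h0 \<Longrightarrow> \<bar>measure lborel ((\<lambda>x. x - h *\<^sub>R \<phi> x) ` \<Omega>) - measure lborel \<Omega>
       + h * (LINT x:\<Omega>|lborel. (\<Sum>i\<in>UNIV. partial_deriv i (\<lambda>x. \<phi> x $ i) x))\<bar> \<le> C * h\<^sup>2"
proof -
  define D where "D x v = (\<chi> i. frechet_derivative (\<lambda>x. \<phi> x $ i) (at x) v)" for x v
  have D: "(\<phi> has_derivative D x) (at x)" for x
  proof (subst has_derivative_componentwise_within, intro ballI)
    fix b :: "real^'n" assume "b \<in> Basis"
    then obtain i where b: "b = axis i 1" by (auto simp: Basis_vec_def)
    have "((\<lambda>x. \<phi> x $ i) has_derivative frechet_derivative (\<lambda>x. \<phi> x $ i) (at x)) (at x)"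
      using test_function_partial_deriv(1)[OF \<phi>] frechet_derivative_works by blast
    then show "((\<lambda>x. \<phi> x \<bullet> b) has_derivative (\<lambda>v. D x v \<bullet> b)) (at x)"
      by (simp add: b inner_axis D_def)
  qed
  have entry: "D x (axis j 1) $ i = partial_deriv j (\<lambda>x. \<phi> x $ i) x" for x i j
    by (simp add: D_def partial_deriv_def)
  have "\<exists>B. \<forall>x. \<bar>partial_deriv j (\<lambda>x. \<phi> x $ i) x\<bar> \<le> B" for i j
    using test_function_partial_deriv(3)[OF \<phi>] .
  then have ex: "\<exists>B. \<forall>x. \<bar>partial_deriv j (\<lambda>x. \<phi> x $ i) x\<bar> \<le> B" for i j .
  define Bf where "Bf i j = (SOME B. \<forall>x. \<bar>partial_deriv j (\<lambda>x. \<phi> x $ i) x\<bar> \<le> B)" for i j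
  have Bf: "\<bar>partial_deriv j (\<lambda>x. \<phi> x $ i) x\<bar> \<le> Bf i j" for i j x
    unfolding Bf_def using someI_ex[OF ex[of j i]] by blast
  define B where "B = (\<Sum>i\<in>UNIV. \<Sum>j\<in>UNIV. Bf i j)"
  have Bpos: "0 \<le> Bf i j" for i j using Bf[of j i undefined] by linarith
  have B: "\<bar>partial_deriv j (\<lambda>x. \<phi> x $ i) x\<bar> \<le> B" for i j x
  proof -
    have "Bf i j \<le> (\<Sum>j\<in>UNIV. Bf i j)" using Bpos by (intro member_le_sum) auto
    also have "\<dots> \<le> B" unfolding B_def using Bpos
      by (intro member_le_sum[of i UNIV "\<lambda>i. \<Sum>j\<in>UNIV. Bf i j"]) (auto intro: sum_nonneg)
    finally show ?thesis using Bf[of j i x] by linarith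
  qed
  define K where "K = real CARD('n) * real CARD('n) * B"
  have lip: "norm (\<phi> x - \<phi> y) \<le> K * norm (x - y)" for x y
  proof (rule differentiable_bound[of UNIV \<phi> D])
    fix x
    have "D x = (*v) (matrix (D x))"
      using has_derivative_linear[OF D] by (simp add: matrix_works fun_eq_iff)
    moreover have "onorm ((*v) (matrix (D x))) \<le> K"
      unfolding K_def by (rule onorm_le_matrix_component) (simp add: matrix_def entry B)
    ultimately show "onorm (D x) \<le> K" by simp
  qed (use D in auto)
  have "\<exists>C h0. 0 \<le> C \<and> 0 < h0 \<and> (\<forall>h. 0 < h \<longrightarrow> h < h0 \<longrightarrow>
     open ((\<lambda>x. x + h *\<^sub>R (- \<phi> x)) ` \<Omega>) \<and>
     \<bar>measure lborel ((\<lambda>x. x + h *\<^sub>R (- \<phi> x)) ` \<Omega>) - measure lborel \<Omega>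
       - h * (LINT x:\<Omega>|lborel. (\<Sum>i\<in>UNIV. (- D x (axis i 1)) $ i))\<bar> \<le> C * h\<^sup>2)"
  proof (rule flow_volume_expansion[of "\<lambda>x. - \<phi> x" "\<lambda>x v. - D x v" B K])
    show "((\<lambda>x. - \<phi> x) has_derivative (\<lambda>v. - D x v)) (at x)" for x
      using D by (rule has_derivative_minus)
    show "continuous_on UNIV (\<lambda>x. (- D x (axis j 1)) $ i)" for i j
      using test_function_partial_deriv(2)[OF \<phi>, of j i] by (simp add: entry continuous_on_minus)
    show "norm (- \<phi> x - - \<phi> y) \<le> K * norm (x - y)" for x y
      using lip[of y x] by (simp add: norm_minus_commute)
  qed (use \<Omega> B in \<open>auto simp: entry\<close>)
  then show ?thesis using that[OF _ _ lip]
    by (auto simp: entry sum_negf set_lebesgue_integral_def)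
qed

section \<open>The inner tube and the perimeter\<close>

definition inner_tube :: "'b::euclidean_space set \<Rightarrow> real \<Rightarrow> 'b set" where
  "inner_tube \<Omega> s = {x \<in> \<Omega>. infdist x (- \<Omega>) \<le> s}"

definition tube_volume :: "'b::euclidean_space set \<Rightarrow> real \<Rightarrow> real" where
  "tube_volume \<Omega> s = measure lborel (inner_tube \<Omega> s)"

lemma inner_tube_borel [measurable]:
  fixes \<Omega> :: "'b::euclidean_space set"
  assumes "open \<Omega>"
  shows "inner_tube \<Omega> s \<in> sets borel"
proof -
  have "inner_tube \<Omega> s = \<Omega> \<inter> {x. infdist x (- \<Omega>) \<le> s}" by (auto simp: inner_tube_def)
  moreover have "closed {x. infdist x (- \<Omega>) \<le> s}"
    by (intro closed_Collect_le continuous_intros)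
  ultimately show ?thesis using assms by simp
qed

lemma tube_volume_nonneg: "0 \<le> tube_volume \<Omega> s"
  by (simp add: tube_volume_def)

lemma bounded_Compl_nonempty:
  fixes \<Omega> :: "'b::euclidean_space set"
  assumes "bounded \<Omega>"
  shows "- \<Omega> \<noteq> {}"
proof
  assume "- \<Omega> = {}"
  then have "\<Omega> = UNIV" by blast
  then show False using assms not_bounded_UNIV by blast
qed

lemma open_infdist_pos:
  fixes \<Omega> :: "'b::euclidean_space set"
  assumes "open \<Omega>" "bounded \<Omega>" "x \<in> \<Omega>"
  shows "0 < infdist x (- \<Omega>)"
proof -
  have "- \<Omega> \<noteq> {}" by (rule bounded_Compl_nonempty[OF assms(2)])
  then show ?thesis using assms
    by (metis ComplD closed_Compl in_closed_iff_infdist_zero infdist_nonneg less_eq_real_def)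
qed

lemma tube_volume_nonpos:
  fixes \<Omega> :: "'b::euclidean_space set"
  assumes "open \<Omega>" "bounded \<Omega>" "s \<le> 0"
  shows "tube_volume \<Omega> s = 0"
proof -
  have "inner_tube \<Omega> s = {}" using open_infdist_pos[OF assms(1,2)] assms(3)
    by (force simp: inner_tube_def)
  then show ?thesis by (simp add: tube_volume_def)
qed

lemma tube_volume_complement:
  fixes \<Omega> :: "'b::euclidean_space set"
  assumes "open \<Omega>" "bounded \<Omega>"
  shows "measure lborel {x \<in> \<Omega>. s < infdist x (- \<Omega>)} = measure lborel \<Omega> - tube_volume \<Omega> s"
proof -
  have "{x \<in> \<Omega>. s < infdist x (- \<Omega>)} = \<Omega> - inner_tube \<Omega> s"
    by (auto simp: inner_tube_def)
  moreover have "inner_tube \<Omega> s \<subseteq> \<Omega>" by (auto simp: inner_tube_def)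
  moreover have "emeasure lborel \<Omega> \<noteq> \<infinity>" using emeasure_bounded_finite[OF assms(2)] by simp
  ultimately show ?thesis unfolding tube_volume_def
    using measure_Diff[of lborel \<Omega> "inner_tube \<Omega> s"] assms(1) by simp
qed

lemma tube_volume_le:
  fixes \<Omega> :: "'b::euclidean_space set"
  assumes "open \<Omega>" "bounded \<Omega>"
  shows "tube_volume \<Omega> s \<le> measure lborel \<Omega>"
  using tube_volume_complement[OF assms, of s] by (metis diff_ge_0_iff_ge measure_nonneg)

text \<open>A point \<open>y\<close> deeper than \<open>h\<close> is hit because
  \<open>x = y + h *\<^sub>R \<phi> x\<close> is a contraction equation for small \<open>h\<close>.
  Its solution lies within \<open>h\<close> of \<open>y\<close>, hence still in the domain.\<close>

lemma tube_volume_ge_divergence: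
  fixes \<phi> :: "real^'n::finite \<Rightarrow> real^'n"
  assumes \<phi>: "\<And>i. test_function (\<lambda>x. \<phi> x $ i)" and \<phi>1: "\<And>x. norm (\<phi> x) \<le> 1"
    and \<Omega>: "open \<Omega>" "bounded \<Omega>"
  obtains C h0 where "0 \<le> C" "0 < h0"
    "\<And>h. 0 < h \<Longrightarrow> h < h0 \<Longrightarrow>
       h * (LINT x:\<Omega>|lborel. (\<Sum>i\<in>UNIV. partial_deriv i (\<lambda>x. \<phi> x $ i) x)) - C * h\<^sup>2 \<le> tube_volume \<Omega> h"
proof -
  let ?I = "LINT x:\<Omega>|lborel. (\<Sum>i\<in>UNIV. partial_deriv i (\<lambda>x. \<phi> x $ i) x)"
  obtain K C h0 where C: "0 \<le> C" "0 < h0" and lip: "\<And>x y. norm (\<phi> x - \<phi> y) \<le> K * norm (x - y)"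
    and opn: "\<And>h. 0 < h \<Longrightarrow> h < h0 \<Longrightarrow> open ((\<lambda>x. x - h *\<^sub>R \<phi> x) ` \<Omega>)"
    and vol: "\<And>h. 0 < h \<Longrightarrow> h < h0 \<Longrightarrow> \<bar>measure lborel ((\<lambda>x. x - h *\<^sub>R \<phi> x) ` \<Omega>) - measure lborel \<Omega>
       + h * ?I\<bar> \<le> C * h\<^sup>2"
    by (rule test_field_flow_volume[OF \<phi> \<Omega>]) (rule that)
  define h1 where "h1 = min h0 (1 / (1 + \<bar>K\<bar>))"
  have h1: "0 < h1" using C by (simp add: h1_def)
  show ?thesis
  proof (rule that[OF C(1) h1])
    fix h assume h: "0 < h" "h < h1"
    let ?A = "(\<lambda>x. x - h *\<^sub>R \<phi> x) ` \<Omega>"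
    have hK: "h * \<bar>K\<bar> < 1" using h by (simp add: h1_def field_simps)
    have sub: "{x \<in> \<Omega>. h < infdist x (- \<Omega>)} \<subseteq> ?A"
    proof safe
      fix y assume y: "y \<in> \<Omega>" "h < infdist y (- \<Omega>)"
      have "\<exists>!x. y + h *\<^sub>R \<phi> x = x"
      proof (rule banach_fix_type[of "h * \<bar>K\<bar>"])
        have "h * norm (\<phi> a - \<phi> b) \<le> h * \<bar>K\<bar> * norm (a - b)" for a b
        proof -
          have "norm (\<phi> a - \<phi> b) \<le> \<bar>K\<bar> * norm (a - b)"
            by (rule order_trans[OF lip mult_right_mono[OF abs_ge_self norm_ge_zero]])
          then show ?thesis using h by (simp add: mult.assoc)
        qed
        then show "\<forall>a b. dist (y + h *\<^sub>R \<phi> a) (y + h *\<^sub>R \<phi> b) \<le> h * \<bar>K\<bar> * dist a b"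
          using h by (simp add: dist_norm flip: scaleR_diff_right)
      qed (use h hK in auto)
      then obtain x where x: "y + h *\<^sub>R \<phi> x = x" by blast
      then have yx: "y = x - h *\<^sub>R \<phi> x" by (metis add_diff_cancel_right')
      have "dist y x \<le> h"
      proof -
        have "x - y = h *\<^sub>R \<phi> x" using yx by simp
        then have "norm (x - y) = h * norm (\<phi> x)" using h by simp
        also have "\<dots> \<le> h * 1" using \<phi>1 h by (intro mult_left_mono) auto
        finally show ?thesis by (simp add: dist_norm norm_minus_commute)
      qed
      then have "x \<in> \<Omega>" using y(2) infdist_le[of x "- \<Omega>" y] by fastforce
      then show "y \<in> ?A" using yx by blast
    qed
    have "bounded ?A"
    proof -
      obtain b where b: "\<And>x. x \<in> \<Omega> \<Longrightarrow> norm x \<le> b" using \<Omega>(2) by (auto simp: bounded_iff)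
      have "norm (x - h *\<^sub>R \<phi> x) \<le> b + h" if "x \<in> \<Omega>" for x
      proof -
        have "norm (x - h *\<^sub>R \<phi> x) \<le> norm x + h * norm (\<phi> x)"
          using norm_triangle_ineq4[of x "h *\<^sub>R \<phi> x"] h by simp
        also have "h * norm (\<phi> x) \<le> h * 1" using \<phi>1 h by (intro mult_left_mono) auto
        finally show ?thesis using b[OF that] by simp
      qed
      then show ?thesis unfolding bounded_iff by blast
    qed
    then have fin: "emeasure lborel ?A < \<infinity>" by (rule emeasure_bounded_finite)
    have hh0: "h < h0" using h by (simp add: h1_def)
    have "measure lborel {x \<in> \<Omega>. h < infdist x (- \<Omega>)} \<le> measure lborel ?A"
    proof (rule measure_mono_fmeasurable[OF sub])
      have "{x \<in> \<Omega>. h < infdist x (- \<Omega>)} = \<Omega> - inner_tube \<Omega> h" by (auto simp: inner_tube_def)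
      then show "{x \<in> \<Omega>. h < infdist x (- \<Omega>)} \<in> sets lborel"
        using inner_tube_borel[OF \<Omega>(1)] \<Omega>(1) by simp
      show "?A \<in> fmeasurable lborel" using fin opn[OF h(1) hh0] by (intro fmeasurableI) auto
    qed
    then have "measure lborel \<Omega> - tube_volume \<Omega> h \<le> measure lborel ?A"
      by (simp add: tube_volume_complement[OF \<Omega>])
    then show "h * ?I - C * h\<^sup>2 \<le> tube_volume \<Omega> h" using vol[OF h(1) hh0] by linarith
  qed
qed

lemma segment_meets_frontier:
  fixes \<Omega> :: "'b::euclidean_space set"
  assumes "x \<in> \<Omega>" "y \<notin> \<Omega>"
  obtains z where "z \<in> frontier \<Omega>" "z \<in> closed_segment x y"
proof -
  have "closed_segment x y \<inter> frontier \<Omega> \<noteq> {}"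
    by (rule connected_Int_frontier) (use assms in \<open>auto simp: connected_segment\<close>)
  then show ?thesis using that by blast
qed

lemma two_sided_ball_inside:
  fixes \<nu> :: "'b::euclidean_space \<Rightarrow> 'b"
  assumes "two_sided_ball R \<Omega> \<nu>" "z \<in> frontier \<Omega>" "y \<notin> \<Omega>"
  shows "- (norm (y - z))\<^sup>2 \<le> 2 * R * (\<nu> z \<bullet> (y - z))"
proof -
  have R: "0 < R" and n: "norm (- \<nu> z) = 1" and b: "ball (z - R *\<^sub>R \<nu> z) R \<subseteq> \<Omega>"
    using assms by (auto simp: two_sided_ball_def)
  have "y \<notin> ball (z + R *\<^sub>R (- \<nu> z)) R" using b assms(3) by auto
  then show ?thesis using mem_tangent_ball_iff[OF n R, of y z] by simp
qed

lemma two_sided_ball_outside: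
  fixes \<nu> :: "'b::euclidean_space \<Rightarrow> 'b"
  assumes "two_sided_ball R \<Omega> \<nu>" "z \<in> frontier \<Omega>" "y \<in> \<Omega>"
  shows "2 * R * (\<nu> z \<bullet> (y - z)) \<le> (norm (y - z))\<^sup>2"
proof -
  have R: "0 < R" and n: "norm (\<nu> z) = 1" and b: "ball (z + R *\<^sub>R \<nu> z) R \<inter> \<Omega> = {}"
    using assms by (auto simp: two_sided_ball_def)
  have "y \<notin> ball (z + R *\<^sub>R \<nu> z) R" using b assms(3) by auto
  then show ?thesis using mem_tangent_ball_iff[OF n R, of y z] by simp
qed

text \<open>For \<open>x\<close> inside and \<open>y\<close> outside, the segment between them meets
  the frontier at some \<open>z\<close>. The ball condition at \<open>z\<close> bounds the normal
  component of \<open>y - x\<close> from below up to a curvature term, and the motion along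
  \<open>- \<phi>\<close> adds almost \<open>h\<close> to it, so moved points keep away from the
  complement.\<close>

lemma tube_volume_le_divergence:
  fixes \<Omega> :: "(real^'n::finite) set"
  assumes tb: "two_sided_ball R \<Omega> \<nu>" and \<Omega>: "open \<Omega>" "bounded \<Omega>" and \<delta>: "0 < \<delta>" "\<delta> < 1/3"
  obtains \<phi> C h0 where "\<And>i. test_function (\<lambda>x. \<phi> x $ i)" "\<And>x. norm (\<phi> x) \<le> 1" "0 \<le> C" "0 < h0"
    "\<And>h. 0 < h \<Longrightarrow> h < h0 \<Longrightarrow> tube_volume \<Omega> (h * (1 - 3 * \<delta>))
       \<le> h * (LINT x:\<Omega>|lborel. (\<Sum>i\<in>UNIV. partial_deriv i (\<lambda>x. \<phi> x $ i) x)) + C * h\<^sup>2"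
proof -
  have R: "0 < R" using tb by (simp add: two_sided_ball_def)
  obtain \<phi> \<rho> where \<phi>: "\<And>i. test_function (\<lambda>x. \<phi> x $ i)" "\<And>x. norm (\<phi> x) \<le> 1" and \<rho>: "0 < \<rho>"
    and normal: "\<And>z x. z \<in> frontier \<Omega> \<Longrightarrow> norm (x - z) \<le> \<rho> \<Longrightarrow> 1 - \<delta> \<le> \<phi> x \<bullet> \<nu> z"
    using exists_normal_test_field[OF tb \<Omega>(2), of \<delta>] \<delta> by auto
  let ?I = "LINT x:\<Omega>|lborel. (\<Sum>i\<in>UNIV. partial_deriv i (\<lambda>x. \<phi> x $ i) x)"
  obtain K C h0 where C: "0 \<le> C" "0 < h0" and lip: "\<And>x y. norm (\<phi> x - \<phi> y) \<le> K * norm (x - y)"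
    and opn: "\<And>h. 0 < h \<Longrightarrow> h < h0 \<Longrightarrow> open ((\<lambda>x. x - h *\<^sub>R \<phi> x) ` \<Omega>)"
    and vol: "\<And>h. 0 < h \<Longrightarrow> h < h0 \<Longrightarrow> \<bar>measure lborel ((\<lambda>x. x - h *\<^sub>R \<phi> x) ` \<Omega>) - measure lborel \<Omega>
       + h * ?I\<bar> \<le> C * h\<^sup>2"
    by (rule test_field_flow_volume[OF \<phi>(1) \<Omega>]) (rule that)
  \<comment> \<open>\<open>\<rho> / 2\<close> allows the field at \<open>x\<close> to be compared
    with the normal at distance \<open>2 * h\<close>; \<open>\<delta> * R / 4\<close> makes the
    curvature term \<open>8 * h\<^sup>2\<close> at most
    \<open>2 * R * (h * \<delta>)\<close>.\<close>
  define h1 where "h1 = Min {h0, \<rho> / 2, \<delta> * R / 4}"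
  have h1: "0 < h1" using C \<rho> \<delta> R by (simp add: h1_def)
  show ?thesis
  proof (rule that[OF \<phi> C(1) h1])
    fix h assume h: "0 < h" "h < h1"
    then have hb: "h < h0" "2 * h \<le> \<rho>" "4 * h \<le> \<delta> * R" by (auto simp: h1_def)
    let ?A = "(\<lambda>x. x - h *\<^sub>R \<phi> x) ` \<Omega>"
    \<comment> \<open>One \<open>\<delta>\<close> is lost to the deviation of the field from the
      normal and one to curvature; the third, spent in \<open>sub\<close>, makes the inequality
      strict.\<close>
    have far: "h * (1 - 2 * \<delta>) \<le> dist (x - h *\<^sub>R \<phi> x) y" if x: "x \<in> \<Omega>" and y: "y \<notin> \<Omega>" for x y
    proof (rule ccontr)
      assume neg: "\<not> ?thesis"
      have "dist x (x - h *\<^sub>R \<phi> x) \<le> h"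
        using h \<phi>(2)[of x] by (simp add: dist_norm mult_left_le)
      moreover have "h * (1 - 2 * \<delta>) \<le> h" using h \<delta> by (simp add: mult_left_le)
      ultimately have xy: "dist x y \<le> 2 * h"
        using neg dist_triangle[of x y "x - h *\<^sub>R \<phi> x"] by linarith
      obtain z where z: "z \<in> frontier \<Omega>" "z \<in> closed_segment x y"
        using segment_meets_frontier[OF x y] .
      have zx: "norm (x - z) \<le> 2 * h" and zy: "norm (y - z) \<le> 2 * h"
        using segment_bound[OF z(2)] xy by (auto simp: dist_norm norm_minus_commute)
      have "(norm (y - z))\<^sup>2 \<le> (2 * h)\<^sup>2" "(norm (x - z))\<^sup>2 \<le> (2 * h)\<^sup>2"
        using power_mono[OF zy, of 2] power_mono[OF zx, of 2] by simp_all
      then have "- (4 * h\<^sup>2) \<le> 2 * R * (\<nu> z \<bullet> (y - z))" "2 * R * (\<nu> z \<bullet> (x - z)) \<le> 4 * h\<^sup>2"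
        using two_sided_ball_inside[OF tb z(1) y] two_sided_ball_outside[OF tb z(1) x]
        by (auto simp: power_mult_distrib)
      then have "- (8 * h\<^sup>2) \<le> 2 * R * (\<nu> z \<bullet> (y - z) - \<nu> z \<bullet> (x - z))"
        by (simp add: right_diff_distrib)
      then have "- (8 * h\<^sup>2) \<le> 2 * R * (\<nu> z \<bullet> (y - x))" by (simp add: inner_diff_right)
      moreover have "2 * h * (4 * h) \<le> 2 * h * (\<delta> * R)" using hb(3) h by (intro mult_left_mono) auto
      then have "8 * h\<^sup>2 \<le> 2 * R * (h * \<delta>)" by (simp add: power2_eq_square mult_ac)
      ultimately have "2 * R * (- (h * \<delta>)) \<le> 2 * R * (\<nu> z \<bullet> (y - x))" by simp
      then have a: "- (h * \<delta>) \<le> \<nu> z \<bullet> (y - x)" by (rule mult_left_le_imp_le) (use R in simp)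
      have "1 - \<delta> \<le> \<phi> x \<bullet> \<nu> z" using normal[OF z(1), of x] zx hb(2) by simp
      then have "h * (1 - \<delta>) \<le> h * (\<phi> x \<bullet> \<nu> z)" using h by (intro mult_left_mono) auto
      then have "h * (1 - 2 * \<delta>) \<le> \<nu> z \<bullet> (y - (x - h *\<^sub>R \<phi> x))"
        using a by (simp add: inner_diff_right inner_add_right inner_commute algebra_simps)
      also have "\<dots> \<le> norm (\<nu> z) * norm (y - (x - h *\<^sub>R \<phi> x))" by (rule norm_cauchy_schwarz)
      also have "\<dots> = dist (x - h *\<^sub>R \<phi> x) y"
        using tb z(1) by (simp add: two_sided_ball_def dist_norm norm_minus_commute)
      finally show False using neg by simp
    qed
    have ne: "- \<Omega> \<noteq> {}" by (rule bounded_Compl_nonempty[OF \<Omega>(2)])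
    have pos: "0 < h * (1 - 2 * \<delta>)" using h \<delta> by simp
    have sub: "?A \<subseteq> {x \<in> \<Omega>. h * (1 - 3 * \<delta>) < infdist x (- \<Omega>)}"
    proof safe
      fix x assume x: "x \<in> \<Omega>"
      have inf: "h * (1 - 2 * \<delta>) \<le> infdist (x - h *\<^sub>R \<phi> x) (- \<Omega>)"
        using ne far[OF x] by (auto simp: infdist_def intro!: cINF_greatest)
      then show "x - h *\<^sub>R \<phi> x \<in> \<Omega>" using pos infdist_zero[of "x - h *\<^sub>R \<phi> x" "- \<Omega>"] by (cases "x - h *\<^sub>R \<phi> x \<in> \<Omega>") auto
      have "h * (1 - 3 * \<delta>) < h * (1 - 2 * \<delta>)" using h \<delta> by simp
      then show "h * (1 - 3 * \<delta>) < infdist (x - h *\<^sub>R \<phi> x) (- \<Omega>)" using inf by linarith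
    qed
    have "measure lborel ?A \<le> measure lborel {x \<in> \<Omega>. h * (1 - 3 * \<delta>) < infdist x (- \<Omega>)}"
    proof (rule measure_mono_fmeasurable[OF sub])
      show "?A \<in> sets lborel" using opn[OF h(1) hb(1)] by simp
      have "{x \<in> \<Omega>. h * (1 - 3 * \<delta>) < infdist x (- \<Omega>)} = \<Omega> - inner_tube \<Omega> (h * (1 - 3 * \<delta>))"
        by (auto simp: inner_tube_def)
      moreover have "emeasure lborel {x \<in> \<Omega>. h * (1 - 3 * \<delta>) < infdist x (- \<Omega>)} < \<infinity>"
        by (rule emeasure_bounded_finite) (rule bounded_subset[OF \<Omega>(2)], blast)
      ultimately show "{x \<in> \<Omega>. h * (1 - 3 * \<delta>) < infdist x (- \<Omega>)} \<in> fmeasurable lborel"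
        using inner_tube_borel[OF \<Omega>(1)] \<Omega>(1) by (intro fmeasurableI) auto
    qed
    then have "measure lborel ?A \<le> measure lborel \<Omega> - tube_volume \<Omega> (h * (1 - 3 * \<delta>))"
      by (simp add: tube_volume_complement[OF \<Omega>])
    then show "tube_volume \<Omega> (h * (1 - 3 * \<delta>)) \<le> h * ?I + C * h\<^sup>2"
      using vol[OF h(1) hb(1)] by linarith
  qed
qed

section \<open>First-order asymptotics of the tube volume\<close>

definition admissible_field :: "(real^'n::finite \<Rightarrow> real^'n) \<Rightarrow> bool" where
  "admissible_field \<phi> \<longleftrightarrow> (\<forall>i. test_function (\<lambda>x. \<phi> x $ i)) \<and> (\<forall>x. norm (\<phi> x) \<le> 1)"

definition flux :: "(real^'n::finite) set \<Rightarrow> (real^'n \<Rightarrow> real^'n) \<Rightarrow> real" where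
  "flux \<Omega> \<phi> = (LINT x:\<Omega>|lborel. (\<Sum>i\<in>UNIV. partial_deriv i (\<lambda>x. \<phi> x $ i) x))"

lemma perimeter_eq_SUP_flux: "perimeter \<Omega> = (SUP \<phi>\<in>Collect admissible_field. ereal (flux \<Omega> \<phi>))"
proof -
  have eq: "{\<phi> :: 'a \<Rightarrow> real^'a \<Rightarrow> real. (\<forall>i. test_function (\<phi> i)) \<and> (\<forall>x. (\<Sum>i\<in>UNIV. (\<phi> i x)\<^sup>2) \<le> 1)}
      = (\<lambda>\<phi> i x. \<phi> x $ i) ` Collect admissible_field"
  proof safe
    fix \<phi> :: "'a \<Rightarrow> real^'a \<Rightarrow> real"
    assume "\<forall>i. test_function (\<phi> i)" "\<forall>x. (\<Sum>i\<in>UNIV. (\<phi> i x)\<^sup>2) \<le> 1"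
    then have "admissible_field (\<lambda>x. \<chi> i. \<phi> i x)"
      by (auto simp: admissible_field_def norm_vec_def L2_set_def)
    then show "\<phi> \<in> (\<lambda>\<phi> i x. \<phi> x $ i) ` Collect admissible_field"
      by (intro image_eqI[of _ _ "\<lambda>x. \<chi> i. \<phi> i x"]) auto
  next
    fix \<phi> :: "real^'a \<Rightarrow> real^'a" and i assume a: "admissible_field \<phi>"
    then show "test_function (\<lambda>x. \<phi> x $ i)" by (simp add: admissible_field_def)
    fix x
    have "norm (\<phi> x) \<le> 1" using a by (simp add: admissible_field_def)
    then show "(\<Sum>i\<in>UNIV. (\<phi> x $ i)\<^sup>2) \<le> 1" by (simp add: norm_vec_def L2_set_def)
  qed
  show ?thesis unfolding perimeter_def eq by (simp add: image_image flux_def)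
qed

text \<open>Lower bounds come from arbitrary admissible fields, the upper bound from a nearly normal
  field whose own flux is at most \<open>P\<close>. The linear bound on the tube volume is obtained
  first: it bounds every flux and so makes the perimeter finite.\<close>

lemma tube_volume_perimeter:
  fixes \<Omega> :: "(real^'n::finite) set"
  assumes tb: "two_sided_ball R \<Omega> \<nu>" and \<Omega>: "open \<Omega>" "bounded \<Omega>"
  obtains P C where "perimeter \<Omega> = ereal P" "0 \<le> P" "0 \<le> C"
    "\<And>s. tube_volume \<Omega> s \<le> C * max s 0"
    "\<And>\<epsilon>. 0 < \<epsilon> \<Longrightarrow> \<exists>s0>0. \<forall>s. 0 < s \<longrightarrow> s < s0 \<longrightarrow> \<bar>tube_volume \<Omega> s - P * s\<bar> \<le> \<epsilon> * s"
proof -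
  let ?M = "tube_volume \<Omega>"
  obtain C where C: "0 \<le> C" "\<And>s. ?M s \<le> C * max s 0"
  proof -
    \<comment> \<open>With \<open>\<delta> = 1 / 6\<close> the factor
      \<open>1 - 3 * \<delta>\<close> is \<open>1 / 2\<close>, so a tube of width \<open>s\<close>
      corresponds to \<open>h = 2 * s\<close>.\<close>
    obtain \<phi> c h0 where "0 \<le> c" "0 < h0" and ub: "\<And>h. 0 < h \<Longrightarrow> h < h0 \<Longrightarrow> ?M (h * (1 - 3 * (1/6)))
       \<le> h * (LINT x:\<Omega>|lborel. (\<Sum>i\<in>UNIV. partial_deriv i (\<lambda>x. \<phi> x $ i) x)) + c * h\<^sup>2"
      by (rule tube_volume_le_divergence[OF tb \<Omega>, of "1/6"]) (simp, simp, rule that)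
    define C where "C = 2 * (\<bar>flux \<Omega> \<phi>\<bar> + c * h0) + 2 * measure lborel \<Omega> / h0"
    have nn: "0 \<le> 2 * (\<bar>flux \<Omega> \<phi>\<bar> + c * h0)" "0 \<le> 2 * measure lborel \<Omega> / h0"
      using \<open>0 \<le> c\<close> \<open>0 < h0\<close> by auto
    have "?M s \<le> C * max s 0" for s
    proof -
      consider "s \<le> 0" | "0 < s" "2 * s < h0" | "h0 \<le> 2 * s" "0 < s" using \<open>0 < h0\<close> by linarith
      then show ?thesis
      proof cases
        case 1 then show ?thesis using tube_volume_nonpos[OF \<Omega>] by simp
      next
        case 2
        have "?M s \<le> 2 * s * flux \<Omega> \<phi> + c * (2 * s)\<^sup>2"
          using ub[of "2 * s"] 2 by (simp add: flux_def)
        also have "\<dots> \<le> 2 * s * \<bar>flux \<Omega> \<phi>\<bar> + 2 * s * (c * h0)"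
        proof (rule add_mono)
          show "2 * s * flux \<Omega> \<phi> \<le> 2 * s * \<bar>flux \<Omega> \<phi>\<bar>" using 2 by (intro mult_left_mono) auto
          have "c * (2 * s) \<le> c * h0" using 2 \<open>0 \<le> c\<close> by (intro mult_left_mono) auto
          then have "2 * s * (c * (2 * s)) \<le> 2 * s * (c * h0)" by (rule mult_left_mono) (use 2 in simp)
          then show "c * (2 * s)\<^sup>2 \<le> 2 * s * (c * h0)" by (simp add: power2_eq_square mult_ac)
        qed
        also have "\<dots> = 2 * (\<bar>flux \<Omega> \<phi>\<bar> + c * h0) * s" by (simp add: algebra_simps)
        also have "\<dots> \<le> C * s" using 2 nn unfolding C_def by (intro mult_right_mono) auto
        finally show ?thesis using 2 by simp
      next
        case 3
        have "?M s \<le> measure lborel \<Omega>" by (rule tube_volume_le[OF \<Omega>])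
        also have "\<dots> \<le> 2 * measure lborel \<Omega> / h0 * s"
          using 3 \<open>0 < h0\<close> mult_left_mono[of h0 "2 * s" "measure lborel \<Omega>"] by (simp add: field_simps)
        also have "\<dots> \<le> C * s" using 3 nn unfolding C_def by (intro mult_right_mono) auto
        finally show ?thesis using 3 by simp
      qed
    qed
    moreover have "0 \<le> C" using nn by (simp add: C_def)
    ultimately show ?thesis using that by blast
  qed
  have lower: "\<exists>c h0. 0 \<le> c \<and> 0 < h0 \<and> (\<forall>h. 0 < h \<longrightarrow> h < h0 \<longrightarrow> h * flux \<Omega> \<phi> - c * h\<^sup>2 \<le> ?M h)"
    if \<phi>: "admissible_field \<phi>" for \<phi>
  proof -
    have "\<And>i. test_function (\<lambda>x. \<phi> x $ i)" "\<And>x. norm (\<phi> x) \<le> 1"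
      using \<phi> by (auto simp: admissible_field_def)
    then show ?thesis
    proof (rule tube_volume_ge_divergence[OF _ _ \<Omega>])
      fix C h0 assume "0 \<le> C" "0 < h0" and "\<And>h. 0 < h \<Longrightarrow> h < h0 \<Longrightarrow>
         h * (LINT x:\<Omega>|lborel. (\<Sum>i\<in>UNIV. partial_deriv i (\<lambda>x. \<phi> x $ i) x)) - C * h\<^sup>2 \<le> ?M h"
      then show ?thesis unfolding flux_def by blast
    qed
  qed
  \<comment> \<open>The lower bound is divided by \<open>h\<close>; the choice of \<open>h\<close>
    below makes the remainder \<open>c * h\<close> at most \<open>e\<close>.\<close>
  have fluxC: "flux \<Omega> \<phi> \<le> C" if \<phi>: "admissible_field \<phi>" for \<phi>
  proof (rule field_le_epsilon)
    fix e :: real assume e: "0 < e"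
    obtain c h0 where c: "0 \<le> c" "0 < h0" "\<And>h. 0 < h \<Longrightarrow> h < h0 \<Longrightarrow> h * flux \<Omega> \<phi> - c * h\<^sup>2 \<le> ?M h"
      using lower[OF \<phi>] by blast
    define h where "h = min (h0 / 2) (e / (1 + c))"
    have h: "0 < h" "h < h0" using c e by (auto simp: h_def)
    have "c * h \<le> e"
    proof -
      have "c * h \<le> (1 + c) * h" using h by simp
      also have "\<dots> \<le> (1 + c) * (e / (1 + c))" using c by (intro mult_left_mono) (auto simp: h_def)
      finally show ?thesis using c by simp
    qed
    have "h * flux \<Omega> \<phi> - c * h\<^sup>2 \<le> C * h" using c(3)[OF h] C(2)[of h] h by simp
    then have "h * flux \<Omega> \<phi> \<le> h * (C + c * h)" by (simp add: power2_eq_square algebra_simps)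
    then have "flux \<Omega> \<phi> \<le> C + c * h" using h by simp
    then show "flux \<Omega> \<phi> \<le> C + e" using \<open>c * h \<le> e\<close> by simp
  qed
  have adm0: "admissible_field (\<lambda>x. 0 :: real^'n)"
    unfolding admissible_field_def by (auto intro!: test_function_smooth_fun smooth_fun.const)
  have flux0: "flux \<Omega> (\<lambda>x. 0) = 0"
    unfolding flux_def by (simp add: partial_deriv_eq[of _ "\<lambda>_. 0"] set_lebesgue_integral_def)
  have le: "perimeter \<Omega> \<le> ereal C"
    unfolding perimeter_eq_SUP_flux by (rule SUP_least) (use fluxC in auto)
  have ge: "ereal (flux \<Omega> \<phi>) \<le> perimeter \<Omega>" if "admissible_field \<phi>" for \<phi>
    unfolding perimeter_eq_SUP_flux by (rule SUP_upper) (use that in auto)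
  have "0 \<le> perimeter \<Omega>" using ge[OF adm0] flux0 by (simp add: zero_ereal_def)
  then obtain P where P: "perimeter \<Omega> = ereal P" "0 \<le> P"
    using le by (cases "perimeter \<Omega>") auto
  have fluxP: "flux \<Omega> \<phi> \<le> P" if "admissible_field \<phi>" for \<phi> using ge[OF that] P by simp
  have "\<exists>s0>0. \<forall>s. 0 < s \<longrightarrow> s < s0 \<longrightarrow> \<bar>?M s - P * s\<bar> \<le> \<epsilon> * s" if \<epsilon>: "0 < \<epsilon>" for \<epsilon>
  proof -
    have "\<exists>\<phi>\<in>Collect admissible_field. ereal (P - \<epsilon> / 2) < ereal (flux \<Omega> \<phi>)"
      using less_SUP_iff[of "ereal (P - \<epsilon> / 2)" "\<lambda>\<phi>. ereal (flux \<Omega> \<phi>)" "Collect admissible_field"]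
        P(1) \<epsilon> unfolding perimeter_eq_SUP_flux by simp
    then obtain \<phi> where \<phi>: "admissible_field \<phi>" "P - \<epsilon> / 2 < flux \<Omega> \<phi>" by auto
    obtain c h0 where c: "0 \<le> c" "0 < h0" "\<And>h. 0 < h \<Longrightarrow> h < h0 \<Longrightarrow> h * flux \<Omega> \<phi> - c * h\<^sup>2 \<le> ?M h"
      using lower[OF \<phi>(1)] by blast
    \<comment> \<open>Chosen so that \<open>q < 1\<close> and
      \<open>P / q \<le> P + \<epsilon> / 2\<close>, also when \<open>P = 0\<close>. With
      \<open>\<delta> = (1 - q) / 3\<close> the factor of the width is exactly
      \<open>q\<close>.\<close>
    define q where "q = (P + 1) / (P + 1 + \<epsilon> / 2)"
    have q: "0 < q" "q < 1" using P(2) \<epsilon> by (auto simp: q_def)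
    have Pq: "P / q \<le> P + \<epsilon> / 2"
    proof -
      have "P * (P + 1 + \<epsilon> / 2) \<le> (P + \<epsilon> / 2) * (P + 1)" using P(2) \<epsilon> by (simp add: algebra_simps)
      then have "P * (P + 1 + \<epsilon> / 2) / (P + 1) \<le> P + \<epsilon> / 2" using P(2) by (simp add: pos_divide_le_eq)
      then show ?thesis by (simp add: q_def)
    qed
    have \<delta>: "0 < (1 - q) / 3" "(1 - q) / 3 < 1/3" using q by auto
    obtain \<phi>2 c2 h2 where \<phi>2: "\<And>i. test_function (\<lambda>x. \<phi>2 x $ i)" "\<And>x. norm (\<phi>2 x) \<le> 1"
      and c2: "0 \<le> c2" "0 < h2" and ub: "\<And>h. 0 < h \<Longrightarrow> h < h2 \<Longrightarrow> ?M (h * (1 - 3 * ((1 - q) / 3)))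
       \<le> h * (LINT x:\<Omega>|lborel. (\<Sum>i\<in>UNIV. partial_deriv i (\<lambda>x. \<phi>2 x $ i) x)) + c2 * h\<^sup>2"
      by (rule tube_volume_le_divergence[OF tb \<Omega> \<delta>]) (rule that)
    have "admissible_field \<phi>2" using \<phi>2 by (simp add: admissible_field_def)
    then have f2: "flux \<Omega> \<phi>2 \<le> P" by (rule fluxP)
    \<comment> \<open>The entries keep \<open>s\<close> and \<open>s / q\<close> in the ranges of
      the two bounds and make each quadratic remainder at most
      \<open>\<epsilon> / 2 * s\<close>.\<close>
    define s0 where "s0 = Min {h0, \<epsilon> / (2 * (1 + c)), h2 * q, \<epsilon> * q\<^sup>2 / (2 * (1 + c2))}"
    have s0: "0 < s0" using c c2 q \<epsilon> by (auto simp: s0_def)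
    have "\<bar>?M s - P * s\<bar> \<le> \<epsilon> * s" if s: "0 < s" "s < s0" for s
    proof -
      have sb: "s < h0" "s < \<epsilon> / (2 * (1 + c))" "s < h2 * q" "s < \<epsilon> * q\<^sup>2 / (2 * (1 + c2))"
        using s by (auto simp: s0_def)
      have "s * (2 * (1 + c)) < \<epsilon>" using sb(2) c by (simp add: pos_less_divide_eq)
      then have "c * s \<le> \<epsilon> / 2" using s by (simp add: algebra_simps)
      then have "s * (P - \<epsilon> / 2) - s * (\<epsilon> / 2) \<le> s * flux \<Omega> \<phi> - s * (c * s)"
        using s \<phi>(2) by (intro diff_mono mult_left_mono) auto
      also have "\<dots> \<le> ?M s" using c(3)[OF s(1) sb(1)] by (simp add: power2_eq_square mult_ac)
      finally have lo: "P * s - \<epsilon> * s \<le> ?M s" by (simp add: algebra_simps)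
      have "s * (2 * (1 + c2)) < \<epsilon> * q\<^sup>2" using sb(4) c2 by (simp add: pos_less_divide_eq)
      then have "c2 * s \<le> \<epsilon> / 2 * q\<^sup>2" using s by (simp add: algebra_simps)
      then have c2s: "c2 * s / q\<^sup>2 \<le> \<epsilon> / 2" using q by (simp add: pos_divide_le_eq)
      have sq: "s / q * (1 - 3 * ((1 - q) / 3)) = s" using q by (simp add: field_simps)
      have "0 < s / q" "s / q < h2" using s sb(3) q by (auto simp: pos_divide_less_eq)
      from ub[OF this, unfolded sq] have "?M s \<le> (s / q) * flux \<Omega> \<phi>2 + c2 * (s / q)\<^sup>2"
        by (simp add: flux_def)
      also have "\<dots> \<le> (s / q) * P + c2 * (s / q)\<^sup>2"
        using s q f2 by (intro add_right_mono mult_left_mono) auto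
      also have "\<dots> = s * (P / q) + s * (c2 * s / q\<^sup>2)" by (simp add: power2_eq_square)
      also have "\<dots> \<le> s * (P + \<epsilon> / 2) + s * (\<epsilon> / 2)"
        using s Pq c2s by (intro add_mono mult_left_mono) auto
      finally show ?thesis using lo by (simp add: algebra_simps abs_le_iff)
    qed
    then show ?thesis using s0 by blast
  qed
  then show ?thesis using that[OF P C] by blast
qed

section \<open>Suprema of right-continuous paths\<close>

text \<open>The one-sided limits bound the path near each time, and finitely many such
  neighbourhoods cover the compact interval.\<close>

lemma cadlag_bounded:
  fixes f :: "real \<Rightarrow> 'b::real_normed_vector"
  assumes "cadlag f"
  shows "\<exists>B. \<forall>s\<in>{0..t}. norm (f s) \<le> B"
proof -
  have "\<exists>e B. 0 < e \<and> (\<forall>r\<in>ball s e \<inter> {0..}. norm (f r) \<le> B)" if "s \<in> {0..t}" for s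
  proof -
    have "(f \<longlongrightarrow> f s) (at_right s)" using assms that by (simp add: cadlag_def)
    then have "\<forall>\<^sub>F r in at_right s. dist (f r) (f s) < 1" by (rule tendstoD) simp
    then obtain b where b: "b > s" "\<And>r. s < r \<Longrightarrow> r < b \<Longrightarrow> dist (f r) (f s) < 1"
      unfolding eventually_at_right_field by blast
    have "\<exists>a l. a < s \<and> (\<forall>r. 0 \<le> r \<longrightarrow> a < r \<longrightarrow> r < s \<longrightarrow> dist (f r) l < 1)"
    proof (cases "s = 0")
      \<comment> \<open>Times before 0 are excluded, so any negative \<open>a\<close> works
        here.\<close>
      case True then show ?thesis by (intro exI[of _ "-1"]) auto
    next
      case False
      then have "0 < s" using that by simp
      then obtain l where "(f \<longlongrightarrow> l) (at_left s)" using assms unfolding cadlag_def by blast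
      then have "\<forall>\<^sub>F r in at_left s. dist (f r) l < 1" by (rule tendstoD) simp
      then show ?thesis unfolding eventually_at_left_field by blast
    qed
    then obtain a l where a: "a < s" "\<And>r. 0 \<le> r \<Longrightarrow> a < r \<Longrightarrow> r < s \<Longrightarrow> dist (f r) l < 1" by blast
    define e where "e = min (b - s) (s - a)"
    have "norm (f r) \<le> norm (f s) + norm l + 1" if r: "r \<in> ball s e \<inter> {0..}" for r
    proof -
      have "a < r" "r < b" "0 \<le> r" using r by (auto simp: e_def dist_real_def)
      consider "r < s" | "r = s" | "s < r" by linarith
      then show ?thesis
      proof cases
        case 1
        then have "norm (f r - l) < 1" using a(2) \<open>a < r\<close> \<open>0 \<le> r\<close> by (simp add: dist_norm)
        then have "norm (f r) \<le> norm l + 1" using norm_triangle_sub[of "f r" l] by linarith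
        then show ?thesis using norm_ge_zero[of "f s"] by linarith
      next
        case 2 then show ?thesis by simp
      next
        case 3
        then have "norm (f r - f s) < 1" using b(2) \<open>r < b\<close> by (simp add: dist_norm)
        then have "norm (f r) \<le> norm (f s) + 1" using norm_triangle_sub[of "f r" "f s"] by linarith
        then show ?thesis using norm_ge_zero[of l] by linarith
      qed
    qed
    moreover have "0 < e" using a b by (simp add: e_def)
    ultimately show ?thesis by blast
  qed
  then have "\<forall>s\<in>{0..t}. \<exists>e. 0 < e \<and> (\<exists>B. \<forall>r\<in>ball s e \<inter> {0..}. norm (f r) \<le> B)" by blast
  then obtain e where e: "\<forall>s\<in>{0..t}. 0 < e s \<and> (\<exists>B. \<forall>r\<in>ball s (e s) \<inter> {0..}. norm (f r) \<le> B)"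
    by (rule bchoice[THEN exE])
  then have "\<forall>s\<in>{0..t}. \<exists>B. \<forall>r\<in>ball s (e s) \<inter> {0..}. norm (f r) \<le> B" by blast
  then obtain B where B: "\<forall>s\<in>{0..t}. \<forall>r\<in>ball s (e s) \<inter> {0..}. norm (f r) \<le> B s"
    by (rule bchoice[THEN exE])
  have cpt: "compact {0..t}" by simp
  have cov: "{0..t} \<subseteq> (\<Union>s\<in>{0..t}. ball s (e s))" using e by force
  obtain D where D: "D \<subseteq> {0..t}" "finite D" "{0..t} \<subseteq> (\<Union>s\<in>D. ball s (e s))"
    by (rule compactE_image[OF cpt _ cov]) (rule open_ball, rule that)
  have "norm (f s) \<le> (\<Sum>d\<in>D. \<bar>B d\<bar>)" if s: "s \<in> {0..t}" for s
  proof -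
    obtain d where d: "d \<in> D" "s \<in> ball d (e d)" using D(3) s by auto
    then have "norm (f s) \<le> B d" using B D(1) s by auto
    also have "\<dots> \<le> \<bar>B d\<bar>" by simp
    also have "\<dots> \<le> (\<Sum>d\<in>D. \<bar>B d\<bar>)" using D(2) d by (intro member_le_sum) auto
    finally show ?thesis .
  qed
  then show ?thesis by blast
qed

text \<open>Since \<open>u\<close> is nondecreasing and right-continuous, \<open>u r\<close>
  approaches \<open>u s\<close> within \<open>{u s..}\<close>, the side on which \<open>f\<close> is
  continuous.\<close>

lemma cadlag_compose_mono:
  fixes f :: "real \<Rightarrow> 'b::topological_space" and u :: "real \<Rightarrow> real"
  assumes f: "cadlag f" and u: "cadlag u" "mono_on {0..} u" "0 \<le> u 0" and s: "0 \<le> s"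
  shows "((\<lambda>r. f (u r)) \<longlongrightarrow> f (u s)) (at_right s)"
proof -
  have us: "0 \<le> u s" using u(2,3) s by (meson atLeast_iff mono_onD order.refl order_trans)
  have 1: "(u \<longlongrightarrow> u s) (at_right s)" using u(1) s by (simp add: cadlag_def)
  have 2: "continuous (at (u s) within {u s..}) f"
    using f us by (simp add: cadlag_def continuous_within at_within_Ici_at_right)
  have 3: "\<forall>\<^sub>F r in at_right s. u r \<in> {u s..}"
    using eventually_at_right_less[of s]
    by eventually_elim (use u(2) s in \<open>auto intro!: mono_onD[of "{0..}" u]\<close>)
  show ?thesis by (rule continuous_within_tendsto_compose[OF 2 3 1])
qed

text \<open>By right continuity a value close to the supremum is almost kept just after the time
  where it is taken, and a fine grid has a point there.\<close>

lemma dyadic_max_tendsto_SUP: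
  fixes f :: "real \<Rightarrow> real"
  assumes t: "0 < t" and rc: "\<And>s. 0 \<le> s \<Longrightarrow> (f \<longlongrightarrow> f s) (at_right s)"
    and bdd: "bdd_above (f ` {0..t})"
  shows "(\<lambda>k. Max ((\<lambda>i. f (t * real i / 2 ^ k)) ` {..2 ^ k})) \<longlonglongrightarrow> (SUP s\<in>{0..t}. f s)"
proof (rule order_tendstoI)
  let ?m = "\<lambda>k. Max ((\<lambda>i. f (t * real i / 2 ^ k)) ` {..2 ^ k})"
  let ?S = "SUP s\<in>{0..t}. f s"
  have le: "?m k \<le> ?S" for k
  proof (rule Max.boundedI)
    fix y assume "y \<in> (\<lambda>i. f (t * real i / 2 ^ k)) ` {..2 ^ k}"
    then obtain i :: nat where i: "i \<le> 2 ^ k" "y = f (t * real i / 2 ^ k)" by auto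
    have "real i \<le> 2 ^ k" using i(1) by (metis of_nat_le_iff of_nat_numeral of_nat_power)
    then have "t * real i / 2 ^ k \<in> {0..t}" using t by (simp add: field_simps)
    then show "y \<le> ?S" using i(2) bdd by (auto intro: cSUP_upper)
  qed auto
  show "\<forall>\<^sub>F k in sequentially. ?m k < a" if "?S < a" for a
    using le_less_trans[OF le that] by (intro always_eventually allI)
  show "\<forall>\<^sub>F k in sequentially. a < ?m k" if a: "a < ?S" for a
  proof -
    obtain s where s: "s \<in> {0..t}" "a < f s"
      using a less_cSUP_iff[of "{0..t}" f a] bdd t by auto
    obtain b where b: "s < b" "\<And>r. s < r \<Longrightarrow> r < b \<Longrightarrow> a < f r"
      using order_tendstoD(1)[OF rc s(2)] s(1) unfolding eventually_at_right_field by auto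
    have "(\<lambda>k. t / 2 ^ k) \<longlonglongrightarrow> 0"
      using tendsto_mult_right_zero[OF LIMSEQ_inverse_realpow_zero[of 2], of t] by (simp add: field_simps)
    then have "\<forall>\<^sub>F k in sequentially. t / 2 ^ k < b - s" using b(1) by (intro order_tendstoD(2)) auto
    then show ?thesis
    proof eventually_elim
      case (elim k)
      \<comment> \<open>The first grid index at or after \<open>s\<close>; it is at most
        \<open>2 ^ k\<close> because the endpoint \<open>t\<close> is itself a grid point.\<close>
      define i where "i = nat \<lceil>s * 2 ^ k / t\<rceil>"
      have i0: "0 \<le> s * 2 ^ k / t" using s t by simp
      then have ri: "real i = of_int \<lceil>s * 2 ^ k / t\<rceil>" by (simp add: i_def)
      have ge: "s * 2 ^ k / t \<le> real i" and lt: "real i < s * 2 ^ k / t + 1"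
        unfolding ri by linarith+
      have "s * 2 ^ k / t \<le> 2 ^ k" using s t by (simp add: field_simps)
      then have "\<lceil>s * 2 ^ k / t\<rceil> \<le> 2 ^ k" by (simp add: ceiling_le_iff)
      then have im: "i \<le> 2 ^ k" unfolding i_def by (simp add: nat_le_iff)
      have "s \<le> t * real i / 2 ^ k" using ge t by (simp add: field_simps)
      moreover have "t * real i / 2 ^ k < s + t / 2 ^ k" using lt t by (simp add: field_simps)
      ultimately have "a < f (t * real i / 2 ^ k)"
        using b(2)[of "t * real i / 2 ^ k"] s(2) elim by (cases "s = t * real i / 2 ^ k") auto
      also have "\<dots> \<le> ?m k" using im by (intro Max_ge) auto
      finally show ?case .
    qed
  qed
qed

lemma tendsto_Max_atMost:
  fixes f :: "'a \<Rightarrow> nat \<Rightarrow> real"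
  assumes "\<And>i. i \<le> n \<Longrightarrow> ((\<lambda>x. f x i) \<longlongrightarrow> g i) F"
  shows "((\<lambda>x. Max (f x ` {..n})) \<longlongrightarrow> Max (g ` {..n})) F"
  using assms
proof (induction n)
  case (Suc n)
  have eq: "Max (h ` {..Suc n}) = max (h (Suc n)) (Max (h ` {..n}))" for h :: "nat \<Rightarrow> real"
    by (simp add: atMost_Suc)
  show ?case unfolding eq using Suc by (intro tendsto_max) auto
qed simp

text \<open>Characteristic functions converge by dominated convergence, and they determine the
  law.\<close>

lemma (in prob_space) distr_eq_of_AE_tendsto:
  fixes V W :: "nat \<Rightarrow> 'a \<Rightarrow> real"
  assumes [measurable]: "\<And>n. V n \<in> borel_measurable M" "\<And>n. W n \<in> borel_measurable M"
      "v \<in> borel_measurable M" "w \<in> borel_measurable M"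
    and V: "AE x in M. (\<lambda>n. V n x) \<longlonglongrightarrow> v x" and W: "AE x in M. (\<lambda>n. W n x) \<longlonglongrightarrow> w x"
    and eq: "\<And>n. distr M borel (V n) = distr M borel (W n)"
  shows "distr M borel v = distr M borel w"
proof (rule Levy_uniqueness)
  show "real_distribution (distr M borel v)" "real_distribution (distr M borel w)" by auto
  have ch: "char (distr M borel X) u = (LINT x|M. iexp (u * X x))" if "X \<in> borel_measurable M" for X u
    using that unfolding char_def by (subst integral_distr) auto
  have lim: "(\<lambda>n. char (distr M borel (Z n)) u) \<longlonglongrightarrow> char (distr M borel z) u"
    if [measurable]: "\<And>n. Z n \<in> borel_measurable M" "z \<in> borel_measurable M"
      and ae: "AE x in M. (\<lambda>n. Z n x) \<longlonglongrightarrow> z x" for Z :: "nat \<Rightarrow> 'a \<Rightarrow> real" and z u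
  proof -
    have "(\<lambda>n. LINT x|M. iexp (u * Z n x)) \<longlonglongrightarrow> (LINT x|M. iexp (u * z x))"
    proof (rule integral_dominated_convergence[where w = "\<lambda>_. 1"])
      show "AE x in M. (\<lambda>n. iexp (u * Z n x)) \<longlonglongrightarrow> iexp (u * z x)"
        using ae by eventually_elim (intro tendsto_intros)
    qed auto
    then show ?thesis by (simp add: ch)
  qed
  show "char (distr M borel v) = char (distr M borel w)"
    using LIMSEQ_unique[OF lim[OF assms(1,3) V] lim[OF assms(2,4) W, folded eq]] by (simp add: fun_eq_iff)
qed

section \<open>Law of the subordinated process\<close>

text \<open>\<open>Suc\<close> places the grid point strictly above \<open>a * x\<close>, at
  distance at most \<open>a / 2 ^ l\<close>, so that the approach is from the side on which the
  paths are continuous.\<close>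

lemma grid_tendsto_at_right:
  fixes x a :: real
  assumes "0 \<le> x" "0 < a"
  shows "filterlim (\<lambda>l. real (Suc (nat \<lfloor>2 ^ l * x\<rfloor>)) * (a / 2 ^ l)) (at_right (a * x)) sequentially"
  unfolding filterlim_at
proof
  let ?g = "\<lambda>l::nat. real (Suc (nat \<lfloor>2 ^ l * x\<rfloor>)) * (a / 2 ^ l)"
  have r: "real (Suc (nat \<lfloor>2 ^ l * x\<rfloor>)) = of_int \<lfloor>2 ^ l * x\<rfloor> + 1" for l :: nat
    using assms by (simp add: add.commute)
  have gt: "a * x < ?g l" for l
  proof -
    have "a / 2 ^ l * (2 ^ l * x) < a / 2 ^ l * real (Suc (nat \<lfloor>2 ^ l * x\<rfloor>))"
      unfolding r using assms by (intro mult_strict_left_mono) (linarith, simp)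
    then show ?thesis by (simp add: mult.commute)
  qed
  have le: "?g l \<le> a * x + a / 2 ^ l" for l
  proof -
    have "a / 2 ^ l * real (Suc (nat \<lfloor>2 ^ l * x\<rfloor>)) \<le> a / 2 ^ l * (2 ^ l * x + 1)"
      unfolding r using assms by (intro mult_left_mono) (linarith, simp)
    then show ?thesis by (simp add: algebra_simps)
  qed
  show "\<forall>\<^sub>F l in sequentially. ?g l \<in> {a * x<..} \<and> ?g l \<noteq> a * x"
    using gt by (intro always_eventually) (auto simp: less_imp_neq[symmetric] intro: less_imp_neq)
  have "(\<lambda>l. a / 2 ^ l) \<longlonglongrightarrow> 0"
    using tendsto_mult_right_zero[OF LIMSEQ_inverse_realpow_zero[of 2], of a] by (simp add: field_simps)
  then have "(\<lambda>l. a * x + a / 2 ^ l) \<longlonglongrightarrow> a * x + 0" by (intro tendsto_add tendsto_const)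
  then show "?g \<longlonglongrightarrow> a * x"
    by (intro tendsto_sandwich[of "\<lambda>_. a * x" ?g sequentially "\<lambda>l. a * x + a / 2 ^ l"])
       (use gt le in \<open>auto intro: less_imp_le always_eventually\<close>)
qed

locale stable_subordination = prob_space M for M :: "'w measure" +
  fixes Y :: "real \<Rightarrow> 'w \<Rightarrow> real^'n::finite" and U :: "real \<Rightarrow> 'w \<Rightarrow> real" and \<alpha> \<beta> :: real
  assumes alpha: "1 < \<alpha>" "\<alpha> \<le> 2" and beta: "0 < \<beta>"
    and stable: "isotropic_stable M \<alpha> Y"
    and U_process: "stochastic_process M U"
    and U_0: "AE \<omega> in M. U 0 \<omega> = 0"
    and U_mono: "AE \<omega> in M. mono_on {0..} (\<lambda>t. U t \<omega>)"
    and U_cadlag: "AE \<omega> in M. cadlag (\<lambda>t. U t \<omega>)"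
    and U_self_similar: "self_similar M \<beta> U"
    and indep: "independent_processes M U Y"
begin

section \<open>Scaled steps and walks of the stable process\<close>

lemma levy: "levy_process M Y"
  using stable by (simp add: isotropic_stable_def)

lemma Y_meas [measurable]: "0 \<le> t \<Longrightarrow> Y t \<in> borel_measurable M"
  using levy by (simp add: levy_process_def stochastic_process_def)

lemma U_meas [measurable]: "0 \<le> t \<Longrightarrow> U t \<in> borel_measurable M"
  using U_process by (simp add: stochastic_process_def)

lemma Y_char: "0 \<le> t \<Longrightarrow> (LINT \<omega>|M. iexp (\<xi> \<bullet> Y t \<omega>)) = complex_of_real (exp (- t * norm \<xi> powr \<alpha>))"
  using stable by (simp add: isotropic_stable_def)

text \<open>\<open>h\<close> is the time step and \<open>s\<close> a factor in space. For unit
  \<open>\<nu>\<close> and positive \<open>s\<close> the law depends on these only through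
  \<open>h * s powr \<alpha>\<close>, which allows different scales and directions to be
  matched.\<close>

definition stable_step :: "real^'n \<Rightarrow> real \<Rightarrow> real \<Rightarrow> nat \<Rightarrow> 'w \<Rightarrow> real" where
  "stable_step \<nu> h s q \<omega> = s * (\<nu> \<bullet> (Y (real (Suc q) * h) \<omega> - Y (real q * h) \<omega>))"

definition stable_walk :: "real^'n \<Rightarrow> real \<Rightarrow> real \<Rightarrow> nat \<Rightarrow> 'w \<Rightarrow> real" where
  "stable_walk \<nu> h s k \<omega> = s * (\<nu> \<bullet> Y (real k * h) \<omega>)"

lemma stable_step_meas [measurable]: "0 \<le> h \<Longrightarrow> stable_step \<nu> h s q \<in> borel_measurable M"
  unfolding stable_step_def[abs_def] by measurable

lemma stable_walk_meas [measurable]: "0 \<le> h \<Longrightarrow> stable_walk \<nu> h s q \<in> borel_measurable M"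
  unfolding stable_walk_def[abs_def] by measurable

text \<open>\<open>c\<close> may have either sign: positive values serve for scaling, and
  \<open>c = - 1\<close> for the symmetry of increments.\<close>

lemma char_increment:
  assumes "norm \<nu> = 1" "0 \<le> h" "0 \<le> r"
  shows "char (distr M borel (\<lambda>\<omega>. c * (\<nu> \<bullet> (Y (r + h) \<omega> - Y r \<omega>)))) \<theta>
    = complex_of_real (exp (- (h * \<bar>c\<bar> powr \<alpha>) * \<bar>\<theta>\<bar> powr \<alpha>))"
proof -
  let ?\<xi> = "(\<theta> * c) *\<^sub>R \<nu>" and ?D = "\<lambda>\<omega>. Y (r + h) \<omega> - Y r \<omega>"
  have eq: "distr M borel ?D = distr M borel (Y h)"
    using levy assms by (simp add: levy_process_def)
  have [measurable]: "Y (r + h) \<in> borel_measurable M" "Y r \<in> borel_measurable M"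
    using assms by (auto intro: Y_meas)
  have m [measurable]: "?D \<in> borel_measurable M" by measurable
  have "char (distr M borel (\<lambda>\<omega>. c * (\<nu> \<bullet> ?D \<omega>))) \<theta> = (LINT \<omega>|M. iexp (\<theta> * (c * (\<nu> \<bullet> ?D \<omega>))))"
    unfolding char_def by (subst integral_distr) auto
  also have "\<dots> = (LINT \<omega>|M. iexp (?\<xi> \<bullet> ?D \<omega>))" by (simp add: mult_ac)
  also have "\<dots> = (LINT x|distr M borel ?D. iexp (?\<xi> \<bullet> x))" by (subst integral_distr[OF m]) auto
  also have "\<dots> = (LINT \<omega>|M. iexp (?\<xi> \<bullet> Y h \<omega>))"
    unfolding eq using assms by (subst integral_distr) auto
  also have "\<dots> = complex_of_real (exp (- h * norm ?\<xi> powr \<alpha>))" using assms by (intro Y_char)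
  also have "norm ?\<xi> powr \<alpha> = \<bar>\<theta>\<bar> powr \<alpha> * \<bar>c\<bar> powr \<alpha>"
    using assms by (simp add: abs_mult powr_mult)
  finally show ?thesis by (simp add: mult_ac)
qed

lemma char_stable_step:
  assumes "norm \<nu> = 1" "0 \<le> h" "0 < s"
  shows "char (distr M borel (stable_step \<nu> h s q)) \<theta>
    = complex_of_real (exp (- (h * s powr \<alpha>) * \<bar>\<theta>\<bar> powr \<alpha>))"
proof -
  have "stable_step \<nu> h s q = (\<lambda>\<omega>. s * (\<nu> \<bullet> (Y (real q * h + h) \<omega> - Y (real q * h) \<omega>)))"
    by (simp add: stable_step_def[abs_def] algebra_simps)
  then show ?thesis using char_increment[of \<nu> h "real q * h" s \<theta>] assms by simp
qed

lemma distr_stable_step_eq: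
  assumes "norm \<nu> = 1" "0 \<le> h" "0 < s" "norm \<nu>' = 1" "0 \<le> h'" "0 < s'"
    and "h * s powr \<alpha> = h' * s' powr \<alpha>"
  shows "distr M borel (stable_step \<nu> h s q) = distr M borel (stable_step \<nu>' h' s' q')"
proof (rule Levy_uniqueness)
  show "char (distr M borel (stable_step \<nu> h s q)) = char (distr M borel (stable_step \<nu>' h' s' q'))"
    using assms by (simp add: char_stable_step fun_eq_iff)
qed (use assms in auto)

lemma indep_stable_step:
  assumes "0 \<le> h"
  shows "indep_vars (\<lambda>_. borel) (stable_step \<nu> h s) {..<N}"
proof -
  have "(0 \<le> real 0 * h \<and> (\<forall>i<N. real i * h \<le> real (Suc i) * h)) \<longrightarrow>
     indep_vars (\<lambda>_. borel) (\<lambda>i \<omega>. Y (real (Suc i) * h) \<omega> - Y (real i * h) \<omega>) {..<N}"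
    using levy unfolding levy_process_def by (elim conjE) (drule spec[of _ N], drule spec[of _ "\<lambda>i. real i * h"])
  moreover have "real i * h \<le> real (Suc i) * h" for i using assms by (simp add: mult_right_mono)
  ultimately have "indep_vars (\<lambda>_. borel) (\<lambda>i \<omega>. Y (real (Suc i) * h) \<omega> - Y (real i * h) \<omega>) {..<N}"
    by simp
  then show ?thesis unfolding stable_step_def[abs_def]
    by (rule indep_vars_compose2) simp
qed

lemma stable_walk_eq_sum:
  "AE \<omega> in M. \<forall>k. stable_walk \<nu> h s k \<omega> = (\<Sum>q<k. stable_step \<nu> h s q \<omega>)"
proof -
  have "AE \<omega> in M. Y 0 \<omega> = 0" using levy by (simp add: levy_process_def)
  then show ?thesis
  proof eventually_elim
    case (elim \<omega>)
    have "(\<Sum>q<k. stable_step \<nu> h s q \<omega>) = stable_walk \<nu> h s k \<omega>" for k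
      by (induction k) (use elim in \<open>simp_all add: stable_walk_def stable_step_def algebra_simps\<close>)
    then show ?case by simp
  qed
qed

definition walk_max :: "real^'n \<Rightarrow> real \<Rightarrow> real \<Rightarrow> nat list \<Rightarrow> 'w \<Rightarrow> real" where
  "walk_max \<nu> h s js \<omega> = Max ((\<lambda>k. stable_walk \<nu> h s k \<omega>) ` set js)"

lemma walk_max_meas [measurable]: "0 \<le> h \<Longrightarrow> walk_max \<nu> h s js \<in> borel_measurable M"
  unfolding walk_max_def[abs_def] by (intro borel_measurable_Max) auto

text \<open>Almost surely the maximum is one fixed measurable function of the steps, and these are
  independent with a law that depends on \<open>h * s powr \<alpha>\<close> only.\<close>

lemma distr_walk_max_eq:
  assumes 1: "norm \<nu> = 1" "0 \<le> h" "0 < s" and 2: "norm \<nu>' = 1" "0 \<le> h'" "0 < s'"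
    and eq: "h * s powr \<alpha> = h' * s' powr \<alpha>" and js: "js \<noteq> []"
  shows "distr M borel (walk_max \<nu> h s js) = distr M borel (walk_max \<nu>' h' s' js)"
proof -
  define N where "N = Suc (Max (set js))"
  let ?P = "PiM {..<N} (\<lambda>_. borel :: real measure)"
  define \<Psi> :: "(nat \<Rightarrow> real) \<Rightarrow> real" where "\<Psi> x = Max ((\<lambda>k. \<Sum>q<k. x q) ` set js)" for x
  have lt: "k < N" if "k \<in> set js" for k using that by (simp add: N_def le_imp_less_Suc)
  have \<Psi>m [measurable]: "\<Psi> \<in> borel_measurable ?P"
    unfolding \<Psi>_def[abs_def]
  proof (intro borel_measurable_Max borel_measurable_sum)
    fix k q assume "k \<in> set js" "q \<in> {..<k}"
    then have "q \<in> {..<N}" using lt[of k] by simp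
    then show "(\<lambda>x. x q) \<in> borel_measurable ?P" by (rule measurable_component_singleton)
  qed simp
  have law: "distr M borel (walk_max \<nu> h s js) = distr (PiM {..<N} (\<lambda>q. distr M borel (stable_step \<nu> h s q))) borel \<Psi>"
    if "norm \<nu> = 1" "0 \<le> h" "0 < s" for \<nu> h s
  proof -
    let ?R = "\<lambda>\<omega>. \<lambda>q\<in>{..<N}. stable_step \<nu> h s q \<omega>"
    have [measurable]: "?R \<in> measurable M ?P" using that by (intro measurable_restrict) auto
    have iv: "indep_vars (\<lambda>_. borel) (stable_step \<nu> h s) {..<N}"
      by (rule indep_stable_step) (rule that(2))
    have "distr M ?P ?R = PiM {..<N} (\<lambda>q. distr M borel (stable_step \<nu> h s q))"
      by (rule indep_vars_iff_distr_eq_PiM'[THEN iffD1, OF _ _ iv]) (use that in \<open>auto simp: N_def\<close>)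
    then have "distr (PiM {..<N} (\<lambda>q. distr M borel (stable_step \<nu> h s q))) borel \<Psi> = distr (distr M ?P ?R) borel \<Psi>"
      by simp
    also have "\<dots> = distr M borel (\<Psi> \<circ> ?R)" by (rule distr_distr) measurable
    also have "\<dots> = distr M borel (walk_max \<nu> h s js)"
    proof (rule distr_cong_AE)
      show "AE \<omega> in M. (\<Psi> \<circ> ?R) \<omega> = walk_max \<nu> h s js \<omega>"
        using stable_walk_eq_sum[of \<nu> h s]
      proof eventually_elim
        case (elim \<omega>)
        have "(\<Sum>q<k. ?R \<omega> q) = stable_walk \<nu> h s k \<omega>" if "k \<in> set js" for k
          using elim lt[OF that] by (auto intro!: sum.cong)
        then show ?case unfolding \<Psi>_def walk_max_def o_def by (metis (mono_tags, lifting) image_cong)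
      qed
    qed (use that in auto)
    finally show ?thesis ..
  qed
  have "PiM {..<N} (\<lambda>q. distr M borel (stable_step \<nu> h s q)) = PiM {..<N} (\<lambda>q. distr M borel (stable_step \<nu>' h' s' q))"
    using distr_stable_step_eq[OF 1 2 eq] by (intro PiM_cong) auto
  then show ?thesis using law[OF 1] law[OF 2] by simp
qed

section \<open>Discretised time change and its independence of the stable process\<close>

definition path_sigma :: "(real \<Rightarrow> 'w \<Rightarrow> 'c::topological_space) \<Rightarrow> 'w measure" where
  "path_sigma Z = sigma (space M) {Z t -` A \<inter> space M | t A. 0 \<le> t \<and> A \<in> sets borel}"

lemma space_path_sigma [simp]: "space (path_sigma Z) = space M"
  unfolding path_sigma_def by (rule space_measure_of) auto

lemma sets_path_sigma: "sets (path_sigma Z) = process_events M Z"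
  unfolding path_sigma_def process_events_def by (rule sets_measure_of) auto

lemma path_sigma_measurable [measurable]:
  fixes Z :: "real \<Rightarrow> 'w \<Rightarrow> 'c::topological_space"
  assumes "0 \<le> t" shows "Z t \<in> borel_measurable (path_sigma Z)"
proof (rule measurableI)
  fix A :: "'c set" assume "A \<in> sets borel"
  then show "Z t -` A \<inter> space (path_sigma Z) \<in> sets (path_sigma Z)"
    unfolding sets_path_sigma space_path_sigma process_events_def using assms by (intro sigma_sets.Basic) auto
qed simp

lemma indep_events:
  assumes "A \<in> sets (path_sigma U)" "B \<in> sets (path_sigma Y)"
  shows "emeasure M (A \<inter> B) = emeasure M A * emeasure M B"
proof -
  have "indep_set (process_events M U) (process_events M Y)"
    using indep by (simp add: independent_processes_def)
  then have "prob (A \<inter> B) = prob A * prob B"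
    using assms by (intro indep_setD) (auto simp: sets_path_sigma)
  then show ?thesis by (simp add: emeasure_eq_measure ennreal_mult')
qed

text \<open>The time change at the dyadic times of level \<open>k\<close>, normalised by
  \<open>t powr - \<beta>\<close> and moved strictly up to a grid of mesh \<open>1 / 2 ^ l\<close>.
  Such lists are countable in number, so independence from \<open>Y\<close> can be used by summing
  over them.\<close>

definition index_list :: "real \<Rightarrow> nat \<Rightarrow> nat \<Rightarrow> 'w \<Rightarrow> nat list" where
  "index_list t l k \<omega> =
     map (\<lambda>i. Suc (nat \<lfloor>2 ^ l * (t powr - \<beta> * U (t * (real i / 2 ^ k)) \<omega>)\<rfloor>)) [0..<Suc (2 ^ k)]"

lemma index_list_event:
  assumes "0 < t"
  shows "{\<omega> \<in> space M. index_list t l k \<omega> = js} \<in> sets (path_sigma U)"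
proof -
  have [measurable]: "U (t * (real i / 2 ^ k)) \<in> borel_measurable (path_sigma U)" for i
    using assms by (intro path_sigma_measurable) simp
  have "{\<omega> \<in> space M. index_list t l k \<omega> = js} = {\<omega> \<in> space (path_sigma U). length js = Suc (2 ^ k) \<and>
      (\<forall>i<Suc (2 ^ k). Suc (nat \<lfloor>2 ^ l * (t powr - \<beta> * U (t * (real i / 2 ^ k)) \<omega>)\<rfloor>) = js ! i)}"
    unfolding index_list_def list_eq_iff_nth_eq by (auto simp del: upt_Suc)
  also have "\<dots> \<in> sets (path_sigma U)" by measurable
  finally show ?thesis .
qed

lemma process_events_subset_U: "sets (path_sigma U) \<subseteq> sets M"
  unfolding sets_path_sigma process_events_def
  by (rule sets.sigma_sets_subset) (auto intro: measurable_sets U_meas)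

lemma index_list_meas [measurable]:
  assumes "0 < t"
  shows "index_list t l k \<in> measurable M (count_space UNIV)"
proof (subst measurable_count_space_eq2_countable, intro conjI ballI)
  fix js :: "nat list"
  have "index_list t l k -` {js} \<inter> space M = {\<omega> \<in> space M. index_list t l k \<omega> = js}" by auto
  then show "index_list t l k -` {js} \<inter> space M \<in> sets M"
    using index_list_event[OF assms] process_events_subset_U by auto
qed auto

text \<open>The event is determined by the joint law of \<open>U\<close> at the dyadic times.
  Self-similarity with ratio \<open>t\<close> carries this law to the unit interval, and the factor
  \<open>t powr - \<beta>\<close> undoes the scaling of the values.\<close>

lemma index_list_law:
  assumes t: "0 < t"
  shows "emeasure M {\<omega> \<in> space M. index_list t l k \<omega> = js} = emeasure M {\<omega> \<in> space M. index_list 1 l k \<omega> = js}"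
proof -
  let ?P = "PiM {0..} (\<lambda>_. borel) :: (real \<Rightarrow> real) measure"
  define A where "A = {u \<in> space ?P. length js = Suc (2 ^ k) \<and>
      (\<forall>i<Suc (2 ^ k). Suc (nat \<lfloor>2 ^ l * (t powr - \<beta> * u (real i / 2 ^ k))\<rfloor>) = js ! i)}"
  have [measurable]: "(\<lambda>u. u (real i / 2 ^ k)) \<in> borel_measurable ?P" for i
    by (rule measurable_component_singleton) simp
  have A: "A \<in> sets ?P" unfolding A_def by measurable
  have pl: "emeasure (process_law M Z) A = emeasure M {\<omega> \<in> space M. length js = Suc (2 ^ k) \<and>
      (\<forall>i<Suc (2 ^ k). Suc (nat \<lfloor>2 ^ l * (t powr - \<beta> * Z (real i / 2 ^ k) \<omega>)\<rfloor>) = js ! i)}"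
    if "\<And>s. 0 \<le> s \<Longrightarrow> Z s \<in> borel_measurable M" for Z
  proof -
    have m: "(\<lambda>\<omega>. restrict (\<lambda>t. Z t \<omega>) {0..}) \<in> measurable M ?P"
      using that by (intro measurable_restrict) auto
    show ?thesis unfolding process_law_def
      by (subst emeasure_distr[OF m A])
         (auto simp: A_def space_PiM intro!: arg_cong[where f = "emeasure M"])
  qed
  have canc: "t powr - \<beta> * (t powr \<beta> * y) = y" for y using t by (simp add: powr_minus)
  have "process_law M (\<lambda>s. U (t * s)) = process_law M (\<lambda>s \<omega>. t powr \<beta> * U s \<omega>)"
    using U_self_similar t by (simp add: self_similar_def)
  moreover have "emeasure (process_law M (\<lambda>s. U (t * s))) A = emeasure M {\<omega> \<in> space M. index_list t l k \<omega> = js}"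
    using t by (subst pl) (auto simp: index_list_def list_eq_iff_nth_eq simp del: upt_Suc
        intro!: arg_cong[where f = "emeasure M"])
  moreover have "emeasure (process_law M (\<lambda>s \<omega>. t powr \<beta> * U s \<omega>)) A
      = emeasure M {\<omega> \<in> space M. index_list 1 l k \<omega> = js}"
    using t by (subst pl) (auto simp: index_list_def list_eq_iff_nth_eq canc simp del: upt_Suc
        intro!: arg_cong[where f = "emeasure M"])
  ultimately show ?thesis by simp
qed

text \<open>The mesh \<open>t powr \<beta> / 2 ^ l\<close> undoes the normalisation of the indices.
  Together with the space factor \<open>t powr (- \<beta> / \<alpha>)\<close> it gives
  \<open>h * s powr \<alpha> = 1 / 2 ^ l\<close> for every positive \<open>t\<close>.\<close>

definition random_walk_max :: "real \<Rightarrow> real^'n \<Rightarrow> nat \<Rightarrow> nat \<Rightarrow> 'w \<Rightarrow> real" where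
  "random_walk_max t \<nu> l k \<omega> =
     walk_max \<nu> (t powr \<beta> / 2 ^ l) (t powr (- \<beta> / \<alpha>)) (index_list t l k \<omega>) \<omega>"

lemma random_walk_max_meas [measurable]:
  "0 < t \<Longrightarrow> random_walk_max t \<nu> l k \<in> borel_measurable M"
  unfolding random_walk_max_def[abs_def]
  by (rule measurable_compose_countable[where f = "\<lambda>js \<omega>. walk_max \<nu> _ _ js \<omega>" and g = "index_list t l k"]) auto

lemma emeasure_random_walk_max:
  assumes t: "0 < t" and B: "B \<in> sets borel"
  shows "emeasure M {\<omega> \<in> space M. random_walk_max t \<nu> l k \<omega> \<in> B} =
    (\<integral>\<^sup>+ js. emeasure M {\<omega> \<in> space M. index_list t l k \<omega> = js} *
        emeasure M {\<omega> \<in> space M. walk_max \<nu> (t powr \<beta> / 2 ^ l) (t powr (- \<beta> / \<alpha>)) js \<omega> \<in> B}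
      \<partial>count_space UNIV)"
proof -
  let ?w = "\<lambda>js. walk_max \<nu> (t powr \<beta> / 2 ^ l) (t powr (- \<beta> / \<alpha>)) js"
  let ?I = "\<lambda>js. {\<omega> \<in> space M. index_list t l k \<omega> = js}"
  let ?W = "\<lambda>js. {\<omega> \<in> space M. ?w js \<omega> \<in> B}"
  have wY: "?w js \<in> borel_measurable (path_sigma Y)" for js
    unfolding walk_max_def[abs_def] stable_walk_def
    by (intro borel_measurable_Max borel_measurable_times borel_measurable_inner
        borel_measurable_const path_sigma_measurable) auto
  have W: "?W js \<in> sets (path_sigma Y)" for js
    using measurable_sets[OF wY B, of js] by (simp add: vimage_def Int_def conj_commute)
  have sI: "?I js \<in> sets M" for js using index_list_event[OF t] process_events_subset_U by auto
  have sW: "?W js \<in> sets M" for js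
    using measurable_sets[OF walk_max_meas B] by (simp add: vimage_def Int_def conj_commute)
  have "{\<omega> \<in> space M. random_walk_max t \<nu> l k \<omega> \<in> B} = (\<Union>js\<in>UNIV. ?I js \<inter> ?W js)"
    by (auto simp: random_walk_max_def)
  then have "emeasure M {\<omega> \<in> space M. random_walk_max t \<nu> l k \<omega> \<in> B} =
     (\<integral>\<^sup>+ js. emeasure M (?I js \<inter> ?W js) \<partial>count_space UNIV)"
    using sI sW by (simp only:, intro emeasure_UN_countable) (auto simp: disjoint_family_on_def)
  then show ?thesis using indep_events[OF index_list_event[OF t] W] by simp
qed

text \<open>The two sums agree term by term: the weights by self-similarity of \<open>U\<close>, the
  walk probabilities by scaling and isotropy of \<open>Y\<close>.\<close>

lemma distr_random_walk_max_eq: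
  assumes t: "0 < t" and \<nu>: "norm \<nu> = 1" and e: "norm e = 1"
  shows "distr M borel (random_walk_max t \<nu> l k) = distr M borel (random_walk_max 1 e l k)"
proof (rule measure_eqI)
  fix B assume "B \<in> sets (distr M borel (random_walk_max t \<nu> l k))"
  then have B: "B \<in> sets borel" by simp
  have em: "emeasure (distr M borel (random_walk_max t \<nu> l k)) B
      = emeasure M {\<omega> \<in> space M. random_walk_max t \<nu> l k \<omega> \<in> B}" if "0 < t" for t \<nu>
    using that B by (subst emeasure_distr) (auto intro!: arg_cong[where f = "emeasure M"])
  have hs: "t powr \<beta> / 2 ^ l * (t powr (- \<beta> / \<alpha>)) powr \<alpha> = 1 powr \<beta> / 2 ^ l * (1 powr (- \<beta> / \<alpha>)) powr \<alpha>"
  proof -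
    have "(t powr (- \<beta> / \<alpha>)) powr \<alpha> = t powr - \<beta>" using alpha by (simp add: powr_powr)
    then show ?thesis using t by (simp add: powr_minus)
  qed
  have "emeasure M {\<omega> \<in> space M. index_list t l k \<omega> = js} *
        emeasure M {\<omega> \<in> space M. walk_max \<nu> (t powr \<beta> / 2 ^ l) (t powr (- \<beta> / \<alpha>)) js \<omega> \<in> B}
     = emeasure M {\<omega> \<in> space M. index_list 1 l k \<omega> = js} *
        emeasure M {\<omega> \<in> space M. walk_max e (1 powr \<beta> / 2 ^ l) (1 powr (- \<beta> / \<alpha>)) js \<omega> \<in> B}" for js
  proof (cases "js = []")
    \<comment> \<open>An index list is never empty, so the weight of this term, where
      \<open>Max\<close> would be taken over the empty set, is 0.\<close>
    case True
    then have "{\<omega> \<in> space M. index_list t l k \<omega> = js} = {}" for t by (auto simp: index_list_def)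
    then show ?thesis by (simp only: emeasure_empty mult_zero_left)
  next
    case False
    have em2: "emeasure (distr M borel (walk_max \<nu> h s js)) B = emeasure M {\<omega> \<in> space M. walk_max \<nu> h s js \<omega> \<in> B}"
      if "0 \<le> h" for \<nu> h s
      using that B by (subst emeasure_distr) (auto intro!: arg_cong[where f = "emeasure M"])
    have deq: "distr M borel (walk_max \<nu> (t powr \<beta> / 2 ^ l) (t powr (- \<beta> / \<alpha>)) js)
        = distr M borel (walk_max e (1 powr \<beta> / 2 ^ l) (1 powr (- \<beta> / \<alpha>)) js)"
      using t by (intro distr_walk_max_eq[OF \<nu> _ _ e _ _ hs False]) auto
    have "0 \<le> t powr \<beta> / 2 ^ l" "0 \<le> 1 powr \<beta> / 2 ^ l" by auto
    then show ?thesis by (simp only: index_list_law[OF t] deq flip: em2)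
  qed
  then show "emeasure (distr M borel (random_walk_max t \<nu> l k)) B = emeasure (distr M borel (random_walk_max 1 e l k)) B"
    using t by (simp only: em zero_less_one emeasure_random_walk_max[OF _ B])
qed simp


text \<open>The paths are regular only almost surely and the space need not be complete, so \<open>Y (U s)\<close> need not
  be measurable; \<open>X\<close> is a measurable modification all of whose paths are regular.\<close>

definition regular :: "'w \<Rightarrow> bool" where
  "regular \<omega> \<longleftrightarrow> U 0 \<omega> = 0 \<and> Y 0 \<omega> = 0 \<and> mono_on {0..} (\<lambda>t. U t \<omega>) \<and> cadlag (\<lambda>t. U t \<omega>) \<and> cadlag (\<lambda>t. Y t \<omega>)"

lemma AE_regular: "AE \<omega> in M. regular \<omega>"
proof -
  have "AE \<omega> in M. Y 0 \<omega> = 0" "AE \<omega> in M. cadlag (\<lambda>t. Y t \<omega>)"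
    using levy by (auto simp: levy_process_def)
  then show ?thesis using U_0 U_mono U_cadlag by eventually_elim (simp add: regular_def)
qed

definition good :: "'w set" where
  "good = (SOME G. G \<in> sets M \<and> (AE \<omega> in M. \<omega> \<in> G) \<and> (\<forall>\<omega>\<in>G. regular \<omega>))"

lemma good: "good \<in> sets M" "AE \<omega> in M. \<omega> \<in> good" "\<And>\<omega>. \<omega> \<in> good \<Longrightarrow> regular \<omega>"
proof -
  obtain N where N: "{\<omega> \<in> space M. \<not> regular \<omega>} \<subseteq> N" "N \<in> null_sets M"
    using AE_regular by (auto elim!: AE_E simp: null_sets_def)
  have "AE \<omega> in M. \<omega> \<in> space M - N"
    using AE_not_in[OF N(2)] AE_space by eventually_elim simp
  moreover have "space M - N \<in> sets M" using N(2) by auto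
  moreover have "\<forall>\<omega>\<in>space M - N. regular \<omega>" using N(1) by auto
  ultimately have "\<exists>G. G \<in> sets M \<and> (AE \<omega> in M. \<omega> \<in> G) \<and> (\<forall>\<omega>\<in>G. regular \<omega>)" by blast
  from someI_ex[OF this] show "good \<in> sets M" "AE \<omega> in M. \<omega> \<in> good" "\<And>\<omega>. \<omega> \<in> good \<Longrightarrow> regular \<omega>"
    unfolding good_def by blast+
qed

declare good(1) [measurable]

definition X :: "real \<Rightarrow> 'w \<Rightarrow> real^'n" where
  "X s \<omega> = (if \<omega> \<in> good then Y (U s \<omega>) \<omega> else 0)"

lemma X_eq_time_change: "AE \<omega> in M. \<forall>s. X s \<omega> = time_change Y U s \<omega>"
  using good(2) by eventually_elim (simp add: X_def time_change_def)

lemma regular_U_nonneg: "regular \<omega> \<Longrightarrow> 0 \<le> s \<Longrightarrow> 0 \<le> U s \<omega>"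
  by (metis regular_def atLeast_iff mono_onD order.refl)

lemma X_0 [simp]: "X 0 \<omega> = 0"
  using good(3) by (simp add: X_def regular_def)

lemma X_right_continuous:
  assumes "0 \<le> s" shows "((\<lambda>r. X r \<omega>) \<longlongrightarrow> X s \<omega>) (at_right s)"
proof (cases "\<omega> \<in> good")
  case True
  then have "regular \<omega>" by (rule good(3))
  then have "((\<lambda>r. Y (U r \<omega>) \<omega>) \<longlongrightarrow> Y (U s \<omega>) \<omega>) (at_right s)"
    unfolding regular_def using assms by (intro cadlag_compose_mono[of "\<lambda>u. Y u \<omega>" "\<lambda>r. U r \<omega>"]) auto
  then show ?thesis using True by (simp add: X_def)
qed (simp add: X_def)

lemma X_bounded: "\<exists>B. \<forall>s\<in>{0..t}. norm (X s \<omega>) \<le> B"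
proof (cases "\<omega> \<in> good")
  case True
  then have r: "regular \<omega>" by (rule good(3))
  then obtain B where B: "\<forall>u\<in>{0..U t \<omega>}. norm (Y u \<omega>) \<le> B"
    using cadlag_bounded[of "\<lambda>u. Y u \<omega>" "U t \<omega>"] by (auto simp: regular_def)
  have "norm (X s \<omega>) \<le> B" if "s \<in> {0..t}" for s
  proof -
    have "U s \<omega> \<le> U t \<omega>" using r that unfolding regular_def by (auto intro: mono_onD[of "{0..}"])
    then have "U s \<omega> \<in> {0..U t \<omega>}" using regular_U_nonneg[OF r] that by simp
    then show ?thesis using B True by (simp add: X_def)
  qed
  then show ?thesis by blast
qed (auto simp: X_def)

text \<open>The time \<open>U s\<close> is approximated from the right by times with countably many
  values. For these the composition with \<open>Y\<close> is measurable, and right continuity passes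
  to the limit.\<close>

lemma X_meas [measurable]:
  assumes s: "0 \<le> s" shows "X s \<in> borel_measurable M"
proof (rule borel_measurable_LIMSEQ_metric)
  let ?f = "\<lambda>l \<omega>. if \<omega> \<in> good then Y (real (Suc (nat \<lfloor>2 ^ l * U s \<omega>\<rfloor>)) * (1 / 2 ^ l)) \<omega> else 0"
  fix l
  have [measurable]: "(\<lambda>\<omega>. nat \<lfloor>2 ^ l * U s \<omega>\<rfloor>) \<in> measurable M (count_space UNIV)"
    using U_meas[OF s] by measurable
  have "(\<lambda>\<omega>. Y (real (Suc (nat \<lfloor>2 ^ l * U s \<omega>\<rfloor>)) * (1 / 2 ^ l)) \<omega>) \<in> borel_measurable M"
    by (rule measurable_compose_countable[where f = "\<lambda>i \<omega>. Y (real (Suc i) * (1 / 2 ^ l)) \<omega>"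
        and g = "\<lambda>\<omega>. nat \<lfloor>2 ^ l * U s \<omega>\<rfloor>"]) auto
  then show "?f l \<in> borel_measurable M" using good(1) by (intro measurable_If_set) auto
next
  fix \<omega>
  let ?f = "\<lambda>l. if \<omega> \<in> good then Y (real (Suc (nat \<lfloor>2 ^ l * U s \<omega>\<rfloor>)) * (1 / 2 ^ l)) \<omega> else 0"
  show "?f \<longlonglongrightarrow> X s \<omega>"
  proof (cases "\<omega> \<in> good")
    case True
    then have r: "regular \<omega>" by (rule good(3))
    have u: "0 \<le> U s \<omega>" by (rule regular_U_nonneg[OF r s])
    have "((\<lambda>u. Y u \<omega>) \<longlongrightarrow> Y (U s \<omega>) \<omega>) (at_right (U s \<omega>))"
      using r u by (simp add: regular_def cadlag_def)
    from filterlim_compose[OF this grid_tendsto_at_right[OF u zero_less_one, simplified mult_1_left]]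
    show ?thesis using True by (simp add: X_def)
  qed (simp add: X_def)
qed

section \<open>Laws of the suprema of normal components\<close>

definition scaled_sup :: "real \<Rightarrow> real^'n \<Rightarrow> 'w \<Rightarrow> real" where
  "scaled_sup t \<nu> \<omega> = (SUP s\<in>{0..t}. t powr (- \<beta> / \<alpha>) * (\<nu> \<bullet> X s \<omega>))"

lemma bdd_above_X: "bdd_above ((\<lambda>s. c * (\<nu> \<bullet> X s \<omega>)) ` {0..t})"
proof -
  obtain B where B: "\<forall>s\<in>{0..t}. norm (X s \<omega>) \<le> B" using X_bounded by blast
  have "c * (\<nu> \<bullet> X s \<omega>) \<le> \<bar>c\<bar> * (norm \<nu> * B)" if "s \<in> {0..t}" for s
  proof -
    have "\<bar>\<nu> \<bullet> X s \<omega>\<bar> \<le> norm \<nu> * norm (X s \<omega>)" by (rule Cauchy_Schwarz_ineq2)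
    also have "\<dots> \<le> norm \<nu> * B" using B that by (intro mult_left_mono) auto
    finally have "\<bar>c * (\<nu> \<bullet> X s \<omega>)\<bar> \<le> \<bar>c\<bar> * (norm \<nu> * B)" unfolding abs_mult by (intro mult_left_mono) auto
    then show ?thesis by linarith
  qed
  then show ?thesis by (rule bdd_aboveI2)
qed

definition dyadic_max :: "real \<Rightarrow> real^'n \<Rightarrow> nat \<Rightarrow> 'w \<Rightarrow> real" where
  "dyadic_max t \<nu> k \<omega> = Max ((\<lambda>i. t powr (- \<beta> / \<alpha>) * (\<nu> \<bullet> X (t * real i / 2 ^ k) \<omega>)) ` {..2 ^ k})"

lemma dyadic_max_meas [measurable]: "0 < t \<Longrightarrow> dyadic_max t \<nu> k \<in> borel_measurable M"
  unfolding dyadic_max_def[abs_def]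
  by (intro borel_measurable_Max borel_measurable_times borel_measurable_inner borel_measurable_const X_meas) auto

lemma dyadic_max_tendsto_scaled_sup:
  assumes "0 < t" shows "(\<lambda>k. dyadic_max t \<nu> k \<omega>) \<longlonglongrightarrow> scaled_sup t \<nu> \<omega>"
  unfolding dyadic_max_def scaled_sup_def
proof (rule dyadic_max_tendsto_SUP[OF assms, of "\<lambda>s. t powr (- \<beta> / \<alpha>) * (\<nu> \<bullet> X s \<omega>)"])
  show "((\<lambda>s. t powr (- \<beta> / \<alpha>) * (\<nu> \<bullet> X s \<omega>)) \<longlongrightarrow> t powr (- \<beta> / \<alpha>) * (\<nu> \<bullet> X s \<omega>)) (at_right s)"
    if "0 \<le> s" for s
    by (intro tendsto_mult tendsto_inner tendsto_const X_right_continuous that)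
qed (rule bdd_above_X)

lemma scaled_sup_meas [measurable]: "0 < t \<Longrightarrow> scaled_sup t \<nu> \<in> borel_measurable M"
  by (rule borel_measurable_LIMSEQ_real[OF dyadic_max_tendsto_scaled_sup]) auto

text \<open>With the dyadic times fixed, only the grid for the values of \<open>U\<close> is
  refined; each grid time tends to the value of \<open>U\<close> from the right, and
  \<open>Y\<close> is right-continuous.\<close>

lemma random_walk_max_tendsto:
  assumes t: "0 < t"
  shows "AE \<omega> in M. (\<lambda>l. random_walk_max t \<nu> l k \<omega>) \<longlonglongrightarrow> dyadic_max t \<nu> k \<omega>"
  using good(2)
proof eventually_elim
  case (elim \<omega>)
  then have r: "regular \<omega>" by (rule good(3))
  let ?g = "\<lambda>l i. stable_walk \<nu> (t powr \<beta> / 2 ^ l) (t powr (- \<beta> / \<alpha>))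
     (Suc (nat \<lfloor>2 ^ l * (t powr - \<beta> * U (t * (real i / 2 ^ k)) \<omega>)\<rfloor>)) \<omega>"
  have "(\<lambda>l. ?g l i) \<longlonglongrightarrow> t powr (- \<beta> / \<alpha>) * (\<nu> \<bullet> X (t * real i / 2 ^ k) \<omega>)" for i
  proof -
    let ?s = "t * (real i / 2 ^ k)"
    have s: "0 \<le> ?s" using t by simp
    have u: "0 \<le> U ?s \<omega>" by (rule regular_U_nonneg[OF r s])
    have cancel: "t powr \<beta> * (t powr - \<beta> * U ?s \<omega>) = U ?s \<omega>"
      using t by (simp add: powr_minus)
    have "((\<lambda>u. Y u \<omega>) \<longlongrightarrow> Y (U ?s \<omega>) \<omega>) (at_right (U ?s \<omega>))"
      using r u by (simp add: regular_def cadlag_def)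
    moreover have "filterlim (\<lambda>l. real (Suc (nat \<lfloor>2 ^ l * (t powr - \<beta> * U ?s \<omega>)\<rfloor>)) * (t powr \<beta> / 2 ^ l))
        (at_right (U ?s \<omega>)) sequentially"
      using grid_tendsto_at_right[of "t powr - \<beta> * U ?s \<omega>" "t powr \<beta>"] u t unfolding cancel by simp
    ultimately have "(\<lambda>l. Y (real (Suc (nat \<lfloor>2 ^ l * (t powr - \<beta> * U ?s \<omega>)\<rfloor>)) * (t powr \<beta> / 2 ^ l)) \<omega>)
        \<longlonglongrightarrow> Y (U ?s \<omega>) \<omega>"
      by (rule filterlim_compose)
    then have "(\<lambda>l. ?g l i) \<longlonglongrightarrow> t powr (- \<beta> / \<alpha>) * (\<nu> \<bullet> Y (U ?s \<omega>) \<omega>)"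
      unfolding stable_walk_def by (intro tendsto_mult tendsto_inner tendsto_const)
    then show ?thesis using elim by (simp add: X_def)
  qed
  then have "(\<lambda>l. Max (?g l ` {..2 ^ k})) \<longlonglongrightarrow> dyadic_max t \<nu> k \<omega>"
    unfolding dyadic_max_def by (rule tendsto_Max_atMost)
  moreover have "random_walk_max t \<nu> l k \<omega> = Max (?g l ` {..2 ^ k})" for l
  proof -
    have "set (index_list t l k \<omega>) =
        (\<lambda>i. Suc (nat \<lfloor>2 ^ l * (t powr - \<beta> * U (t * (real i / 2 ^ k)) \<omega>)\<rfloor>)) ` {..2 ^ k}"
      unfolding index_list_def by (simp add: atLeastLessThanSuc_atLeastAtMost atLeast0AtMost del: upt_Suc)
    then show ?thesis unfolding random_walk_max_def walk_max_def by (simp add: image_image)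
  qed
  ultimately show ?case by simp
qed

text \<open>Two limits are taken in this order: the grid for the values of \<open>U\<close> is
  refined at fixed dyadic times, and then the times themselves. Equality of laws survives
  both.\<close>

lemma distr_scaled_sup:
  assumes t: "0 < t" and \<nu>: "norm \<nu> = 1" and e: "norm e = 1"
  shows "distr M borel (scaled_sup t \<nu>) = distr M borel (scaled_sup 1 e)"
proof (rule distr_eq_of_AE_tendsto[where V = "dyadic_max t \<nu>" and W = "dyadic_max 1 e"])
  show "distr M borel (dyadic_max t \<nu> k) = distr M borel (dyadic_max 1 e k)" for k
  proof (rule distr_eq_of_AE_tendsto[where V = "\<lambda>l. random_walk_max t \<nu> l k" and W = "\<lambda>l. random_walk_max 1 e l k"])
    show "distr M borel (random_walk_max t \<nu> l k) = distr M borel (random_walk_max 1 e l k)" for l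
      by (rule distr_random_walk_max_eq[OF t \<nu> e])
  qed (use t random_walk_max_tendsto[OF t] random_walk_max_tendsto[OF zero_less_one] in auto)
qed (use t dyadic_max_tendsto_scaled_sup[OF t] dyadic_max_tendsto_scaled_sup[OF zero_less_one] in auto)

lemma prob_scaled_sup_ge:
  assumes "0 < t" "norm \<nu> = 1" "norm e = 1"
  shows "prob {\<omega> \<in> space M. a \<le> scaled_sup t \<nu> \<omega>} = prob {\<omega> \<in> space M. a \<le> scaled_sup 1 e \<omega>}"
proof -
  have "prob {\<omega> \<in> space M. a \<le> scaled_sup t \<nu> \<omega>} = measure (distr M borel (scaled_sup t \<nu>)) {a..}"
    if "0 < t" for t \<nu>
    using that by (subst measure_distr) (auto intro!: arg_cong[where f = prob])
  then show ?thesis using distr_scaled_sup[OF assms] assms by simp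
qed

lemma scaled_sup_ge:
  "s \<in> {0..t} \<Longrightarrow> t powr (- \<beta> / \<alpha>) * (\<nu> \<bullet> X s \<omega>) \<le> scaled_sup t \<nu> \<omega>"
  unfolding scaled_sup_def by (intro cSUP_upper bdd_above_X)

lemma scaled_sup_nonneg: "0 \<le> t \<Longrightarrow> 0 \<le> scaled_sup t \<nu> \<omega>"
  using scaled_sup_ge[of 0 t \<nu> \<omega>] by simp

lemma less_scaled_supE:
  assumes "0 < t" "a < scaled_sup t \<nu> \<omega>"
  obtains s where "s \<in> {0..t}" "a < t powr (- \<beta> / \<alpha>) * (\<nu> \<bullet> X s \<omega>)"
proof -
  have "\<exists>s\<in>{0..t}. a < t powr (- \<beta> / \<alpha>) * (\<nu> \<bullet> X s \<omega>)"
    using assms unfolding scaled_sup_def by (subst (asm) less_cSUP_iff[OF _ bdd_above_X]) auto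
  then show ?thesis using that by blast
qed

end

section \<open>Integrability of the supremum\<close>

text \<open>\<open>ennreal\<close> sends negative reals to 0, so only the positive part counts and
  the level is restricted to \<open>0 < l\<close>.\<close>

lemma (in prob_space) nn_integral_layer_cake:
  fixes X :: "'a \<Rightarrow> real"
  assumes [measurable]: "X \<in> borel_measurable M"
  shows "(\<integral>\<^sup>+ x. ennreal (X x) \<partial>M)
    = (\<integral>\<^sup>+ l. (if 0 < l then emeasure M {x \<in> space M. l < X x} else 0) \<partial>lborel)"
proof -
  interpret pair_sigma_finite M lborel ..
  have 1: "ennreal (X x) = (\<integral>\<^sup>+ l. (if 0 < l \<and> l < X x then 1 else 0) \<partial>lborel)" for x
  proof -
    have "(\<integral>\<^sup>+ l. (if 0 < l \<and> l < X x then 1 else 0) \<partial>lborel) = (\<integral>\<^sup>+ l. indicator {0<..<X x} l \<partial>lborel)"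
      by (intro nn_integral_cong) (auto simp: indicator_def)
    also have "\<dots> = ennreal (X x)" by (cases "0 \<le> X x") (auto simp: ennreal_neg)
    finally show ?thesis ..
  qed
  have 2: "(\<integral>\<^sup>+ x. (if 0 < l \<and> l < X x then 1 else 0) \<partial>M) = (if 0 < l then emeasure M {x \<in> space M. l < X x} else 0)"
    for l :: real
  proof (cases "0 < l")
    case True
    have "(\<integral>\<^sup>+ x. (if 0 < l \<and> l < X x then 1 else 0) \<partial>M) = (\<integral>\<^sup>+ x. indicator {x \<in> space M. l < X x} x \<partial>M)"
      using True by (intro nn_integral_cong) (auto simp: indicator_def)
    then show ?thesis using True by simp
  qed simp
  have "(\<integral>\<^sup>+ x. ennreal (X x) \<partial>M) = (\<integral>\<^sup>+ x. (\<integral>\<^sup>+ l. (if 0 < l \<and> l < X x then 1 else 0) \<partial>lborel) \<partial>M)"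
    by (simp only: 1)
  also have "\<dots> = (\<integral>\<^sup>+ l. (\<integral>\<^sup>+ x. (if 0 < l \<and> l < X x then 1 else 0) \<partial>M) \<partial>lborel)"
    by (rule Fubini'[symmetric]) simp
  finally show ?thesis by (simp only: 2)
qed

text \<open>Splitting according to the first index at which the partial sums exceed \<open>l\<close>.\<close>

lemma (in prob_space) levy_maximal_inequality:
  fixes \<xi> :: "nat \<Rightarrow> 'a \<Rightarrow> real"
  assumes ind: "indep_vars (\<lambda>_. borel) \<xi> {..<N}"
    and half: "\<And>k. k \<le> N \<Longrightarrow> 1 / 2 \<le> prob {x \<in> space M. 0 \<le> (\<Sum>q\<in>{k..<N}. \<xi> q x)}"
  shows "prob {x \<in> space M. \<exists>k\<le>N. l < (\<Sum>q<k. \<xi> q x)} \<le> 2 * prob {x \<in> space M. l < (\<Sum>q<N. \<xi> q x)}"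
proof -
  have \<xi>: "\<xi> q \<in> borel_measurable M" if "q < N" for q using ind that by (auto simp: indep_vars_def)
  define S where "S k x = (\<Sum>q<k. \<xi> q x)" for k x
  have S [measurable]: "S k \<in> borel_measurable M" if "k \<le> N" for k
    unfolding S_def[abs_def] using \<xi> that by (intro borel_measurable_sum) auto
  define A where "A k = {x \<in> space M. l < S k x \<and> (\<forall>j<k. S j x \<le> l)}" for k
  define D where "D k = {x \<in> space M. 0 \<le> (\<Sum>q\<in>{k..<N}. \<xi> q x)}" for k
  have A [measurable]: "A k \<in> sets M" if k: "k \<le> N" for k
  proof -
    have "A k = {x \<in> space M. l < S k x} \<inter> (\<Inter>j\<in>{..<k}. {x \<in> space M. S j x \<le> l}) \<inter> space M"
      by (auto simp: A_def)
    moreover have "{x \<in> space M. l < S k x} \<in> sets M" using S[OF k] by measurable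
    moreover have "{x \<in> space M. S j x \<le> l} \<in> sets M" if "j < k" for j
      using that k by (intro borel_measurable_le borel_measurable_const S) auto
    then have "(\<Inter>j\<in>{..<k}. {x \<in> space M. S j x \<le> l}) \<inter> space M \<in> sets M"
      by (cases "k = 0") (auto intro!: sets.Int sets.finite_INT)
    ultimately show ?thesis by (simp add: Int_assoc)
  qed
  have D [measurable]: "D k \<in> sets M" for k
  proof -
    have "(\<lambda>x. \<Sum>q\<in>{k..<N}. \<xi> q x) \<in> borel_measurable M" using \<xi> by (intro borel_measurable_sum) auto
    then show ?thesis unfolding D_def by measurable
  qed
  \<comment> \<open>\<open>A k\<close> is read off the first \<open>k\<close> steps and
    \<open>D k\<close> off the remaining ones.\<close>
  have AD: "prob (A k \<inter> D k) = prob (A k) * prob (D k)" if k: "k \<le> N" for k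
  proof -
    let ?P = "PiM {..<k} (\<lambda>_. borel :: real measure)" and ?Q = "PiM {k..<N} (\<lambda>_. borel :: real measure)"
    let ?f = "\<lambda>x. \<lambda>q\<in>{..<k}. \<xi> q x" and ?g = "\<lambda>x. \<lambda>q\<in>{k..<N}. \<xi> q x"
    have iv: "indep_var ?P ?f ?Q ?g"
      by (rule indep_var_restrict[OF ind]) (use k in auto)
    define A' where "A' = {u \<in> space ?P. l < (\<Sum>q<k. u q) \<and> (\<forall>j<k. (\<Sum>q<j. u q) \<le> l)}"
    define D' where "D' = {u \<in> space ?Q. 0 \<le> (\<Sum>q\<in>{k..<N}. u q)}"
    have comp: "(\<lambda>u. u q) \<in> borel_measurable ?P" if "q < k" for q
      using that by (intro measurable_component_singleton) auto
    have sm: "(\<lambda>u. \<Sum>q<j. u q) \<in> borel_measurable ?P" if "j \<le> k" for j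
      using comp that by (intro borel_measurable_sum) auto
    have A': "A' \<in> sets ?P"
    proof -
      have "A' = {u \<in> space ?P. l < (\<Sum>q<k. u q)} \<inter> {u \<in> space ?P. \<forall>j\<in>{..<k}. (\<Sum>q<j. u q) \<le> l}"
        by (auto simp: A'_def)
      moreover have "{u \<in> space ?P. l < (\<Sum>q<k. u q)} \<in> sets ?P" using sm[of k] by measurable
      moreover have "{u \<in> space ?P. \<forall>j\<in>{..<k}. (\<Sum>q<j. u q) \<le> l} \<in> sets ?P"
        using sm by (intro sets.sets_Collect_finite_All borel_measurable_le) auto
      ultimately show ?thesis by simp
    qed
    have D': "D' \<in> sets ?Q"
    proof -
      have "(\<lambda>u. \<Sum>q\<in>{k..<N}. u q) \<in> borel_measurable ?Q"
        by (intro borel_measurable_sum measurable_component_singleton)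
      then show ?thesis unfolding D'_def by measurable
    qed
    have "?f -` A' \<inter> space M = A k"
      by (auto simp: A'_def A_def S_def space_PiM cong: conj_cong)
    moreover have "?g -` D' \<inter> space M = D k"
      by (auto simp: D'_def D_def space_PiM)
    moreover have "(\<lambda>x. (?f x, ?g x)) -` (A' \<times> D') \<inter> space M = (?f -` A' \<inter> space M) \<inter> (?g -` D' \<inter> space M)"
      by auto
    ultimately show ?thesis using indep_varD[OF iv A' D'] by simp
  qed
  let ?E = "{x \<in> space M. l < S N x}"
  have E: "?E \<in> sets M" using S[of N] by measurable
  have disj: "disjoint_family_on A {..N}"
    unfolding disjoint_family_on_def A_def by (auto simp: not_less[symmetric]) (metis linorder_neqE_nat not_less)
  have U: "{x \<in> space M. \<exists>k\<le>N. l < (\<Sum>q<k. \<xi> q x)} = (\<Union>k\<in>{..N}. A k)"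
  proof (intro set_eqI iffI)
    fix x assume "x \<in> {x \<in> space M. \<exists>k\<le>N. l < (\<Sum>q<k. \<xi> q x)}"
    then have x: "x \<in> space M" "\<exists>k. k \<le> N \<and> l < S k x" by (auto simp: S_def)
    define k where "k = (LEAST k. k \<le> N \<and> l < S k x)"
    have k: "k \<le> N \<and> l < S k x" unfolding k_def using x(2) by (rule LeastI_ex)
    have "S j x \<le> l" if "j < k" for j
      using not_less_Least[OF that[unfolded k_def]] that k by auto
    then show "x \<in> (\<Union>k\<in>{..N}. A k)" using k x(1) by (auto simp: A_def)
  qed (auto simp: A_def S_def)
  have "prob (\<Union>k\<in>{..N}. A k) = (\<Sum>k\<le>N. prob (A k))"
    using A disj by (intro finite_measure_finite_Union) auto
  also have "\<dots> \<le> (\<Sum>k\<le>N. 2 * prob (A k \<inter> ?E))"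
  proof (rule sum_mono)
    fix k assume "k \<in> {..N}"
    then have k: "k \<le> N" by simp
    have "prob (A k) * (1 / 2) \<le> prob (A k) * prob (D k)"
      using half[OF k] by (intro mult_left_mono) (auto simp: D_def)
    also have "\<dots> = prob (A k \<inter> D k)" using AD[OF k] by simp
    \<comment> \<open>If the sum exceeds \<open>l\<close> at index \<open>k\<close> and the
      remaining increment is nonnegative, the sum still exceeds \<open>l\<close> at index
      \<open>N\<close>.\<close>
    also have "\<dots> \<le> prob (A k \<inter> ?E)"
    proof (rule finite_measure_mono)
      have "S N x = S k x + (\<Sum>q\<in>{k..<N}. \<xi> q x)" for x
        unfolding S_def using k sum.atLeastLessThan_concat[of 0 k N "\<lambda>q. \<xi> q x"]
        by (simp add: atLeast0LessThan)
      then show "A k \<inter> D k \<subseteq> A k \<inter> ?E" by (auto simp: A_def D_def)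
      show "A k \<inter> ?E \<in> sets M" using A[OF k] E by auto
    qed
    finally show "prob (A k) \<le> 2 * prob (A k \<inter> ?E)" by simp
  qed
  also have "\<dots> = 2 * (\<Sum>k\<le>N. prob (A k \<inter> ?E))" by (simp add: sum_distrib_left)
  also have "(\<Sum>k\<le>N. prob (A k \<inter> ?E)) = prob (\<Union>k\<in>{..N}. A k \<inter> ?E)"
    using A E disj by (intro finite_measure_finite_Union[symmetric]) (auto simp: disjoint_family_on_def)
  also have "\<dots> \<le> prob ?E" using E by (intro finite_measure_mono) auto
  finally show ?thesis unfolding U by (simp add: S_def)
qed

text \<open>Only the window where \<open>u * \<bar>x\<bar>\<close> lies between 1 and 2 is kept.
  There \<open>cos\<close> is at most \<open>cos 1\<close>, since 2 is at most \<open>pi\<close>,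
  and \<open>1 / u\<^sup>2\<close> is at least \<open>x\<^sup>2 / 4\<close>; the window has length
  \<open>1 / \<bar>x\<bar>\<close>. The bound turns control of a characteristic function near 0 into
  a first absolute moment.\<close>

lemma one_minus_cos_integral_lower:
  fixes x :: real
  shows "ennreal ((1 - cos 1) / 4 * \<bar>x\<bar>) \<le> (\<integral>\<^sup>+ u. ennreal ((1 - cos (u * x)) / u\<^sup>2) * indicator {0<..} u \<partial>lborel)"
proof (cases "x = 0")
  case False
  define a where "a = 1 / \<bar>x\<bar>"
  have a: "0 < a" using False by (simp add: a_def)
  have c: "0 \<le> (1 - cos 1 :: real)" by simp
  have "ennreal ((1 - cos 1) / 4 * \<bar>x\<bar>) = ennreal ((1 - cos 1) * (x\<^sup>2 / 4)) * emeasure lborel {a..2 * a}"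
  proof -
    have "emeasure lborel {a..2 * a} = ennreal a" using a by simp
    moreover have "(1 - cos 1) / 4 * \<bar>x\<bar> = (1 - cos 1) * (x\<^sup>2 / 4) * a"
      using False by (simp add: a_def power2_eq_square field_simps abs_if)
    ultimately show ?thesis using a c by (simp add: ennreal_mult[symmetric])
  qed
  also have "\<dots> = (\<integral>\<^sup>+ u. ennreal ((1 - cos 1) * (x\<^sup>2 / 4)) * indicator {a..2 * a} u \<partial>lborel)"
    by (simp add: nn_integral_cmult)
  also have "\<dots> \<le> (\<integral>\<^sup>+ u. ennreal ((1 - cos (u * x)) / u\<^sup>2) * indicator {0<..} u \<partial>lborel)"
  proof (rule nn_integral_mono)
    fix u :: real
    show "ennreal ((1 - cos 1) * (x\<^sup>2 / 4)) * indicator {a..2 * a} u \<le> ennreal ((1 - cos (u * x)) / u\<^sup>2) * indicator {0<..} u"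
    proof (cases "u \<in> {a..2 * a}")
      case True
      have "0 < u" using True a by simp
      then have u: "1 \<le> u * \<bar>x\<bar>" "u * \<bar>x\<bar> \<le> 2" "0 < u"
        using True False by (auto simp: a_def field_simps)
      have "cos (u * \<bar>x\<bar>) \<le> cos 1" using u pi_ge_two by (intro cos_monotone_0_pi_le) auto
      moreover have "cos (u * \<bar>x\<bar>) = cos (u * x)" by (cases "0 \<le> x") auto
      ultimately have cc: "1 - cos 1 \<le> 1 - cos (u * x)" by simp
      have "u * \<bar>x\<bar> * (u * \<bar>x\<bar>) \<le> 2 * 2" using u by (intro mult_mono) auto
      then have "u\<^sup>2 * x\<^sup>2 \<le> 4" by (simp add: power2_eq_square mult_ac abs_if split: if_splits)
      then have "x\<^sup>2 / 4 \<le> 1 / u\<^sup>2" using u by (simp add: field_simps)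
      then have "(1 - cos 1) * (x\<^sup>2 / 4) \<le> (1 - cos (u * x)) * (1 / u\<^sup>2)" using cc c by (intro mult_mono) auto
      then show ?thesis using True u by (simp add: ennreal_leI)
    qed simp
  qed
  finally show ?thesis .
qed simp

section \<open>First moment and maximal tail of the stable process\<close>

context stable_subordination
begin

text \<open>The increment and its negative have the same characteristic function, and the two closed
  half lines together cover everything.\<close>

lemma increment_symmetric:
  assumes "norm \<nu> = 1" "0 \<le> h" "0 \<le> r"
  shows "1 / 2 \<le> prob {\<omega> \<in> space M. 0 \<le> \<nu> \<bullet> (Y (r + h) \<omega> - Y r \<omega>)}"
proof -
  let ?D = "\<lambda>c \<omega>. c * (\<nu> \<bullet> (Y (r + h) \<omega> - Y r \<omega>))"
  have [measurable]: "Y (r + h) \<in> borel_measurable M" "Y r \<in> borel_measurable M"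
    using assms by (auto intro: Y_meas)
  have m [measurable]: "?D c \<in> borel_measurable M" for c by measurable
  have eq: "distr M borel (?D 1) = distr M borel (?D (- 1))"
  proof (rule Levy_uniqueness)
    show "char (distr M borel (?D 1)) = char (distr M borel (?D (- 1)))"
      by (rule ext) (simp only: char_increment[OF assms], simp)
    show "real_distribution (distr M borel (?D 1))" "real_distribution (distr M borel (?D (- 1)))"
      using real_distribution_distr[OF m] by blast+
  qed
  let ?E = "\<lambda>c. ?D c -` {0..} \<inter> space M"
  have E: "?E c \<in> sets M" for c by (rule measurable_sets[OF m]) simp
  have pr: "prob (?E c) = measure (distr M borel (?D c)) {0..}" for c
    by (rule measure_distr[OF m, symmetric]) simp
  have "space M = ?E 1 \<union> ?E (- 1)" by auto
  then have "prob (space M) = prob (?E 1 \<union> ?E (- 1))" by simp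
  also have "\<dots> \<le> prob (?E 1) + prob (?E (- 1))" by (rule measure_Un_le[OF E E])
  finally have "1 \<le> 2 * prob (?E 1)" unfolding pr eq by (simp add: prob_space)
  moreover have "?E 1 = {\<omega> \<in> space M. 0 \<le> \<nu> \<bullet> (Y (r + h) \<omega> - Y r \<omega>)}" by auto
  ultimately show ?thesis by simp
qed

lemma walk_maximal_inequality:
  assumes \<nu>: "norm \<nu> = 1" and h: "0 \<le> h"
  shows "prob {\<omega> \<in> space M. \<exists>k\<le>N. l < \<nu> \<bullet> Y (real k * h) \<omega>} \<le> 2 * prob {\<omega> \<in> space M. l < \<nu> \<bullet> Y (real N * h) \<omega>}"
proof -
  have half: "1 / 2 \<le> prob {\<omega> \<in> space M. 0 \<le> (\<Sum>q\<in>{k..<N}. stable_step \<nu> h 1 q \<omega>)}" if k: "k \<le> N" for k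
  proof -
    have "(\<Sum>q\<in>{k..<N}. stable_step \<nu> h 1 q \<omega>) = \<nu> \<bullet> (Y (real k * h + real (N - k) * h) \<omega> - Y (real k * h) \<omega>)" for \<omega>
    proof -
      have "(\<Sum>q\<in>{k..<N}. stable_step \<nu> h 1 q \<omega>) = (\<Sum>q\<in>{k..<N}. \<nu> \<bullet> Y (real (Suc q) * h) \<omega> - \<nu> \<bullet> Y (real q * h) \<omega>)"
        by (simp add: stable_step_def inner_diff_right)
      also have "\<dots> = \<nu> \<bullet> Y (real N * h) \<omega> - \<nu> \<bullet> Y (real k * h) \<omega>"
        using sum_Suc_diff'[OF k, of "\<lambda>q. \<nu> \<bullet> Y (real q * h) \<omega>"] by simp
      also have "real N * h = real k * h + real (N - k) * h" using k by (simp add: of_nat_diff algebra_simps)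
      finally show ?thesis by (simp add: inner_diff_right)
    qed
    then show ?thesis using increment_symmetric[OF \<nu>, of "real (N - k) * h" "real k * h"] h by simp
  qed
  have ae: "AE \<omega> in M. \<forall>k. \<nu> \<bullet> Y (real k * h) \<omega> = (\<Sum>q<k. stable_step \<nu> h 1 q \<omega>)"
    using stable_walk_eq_sum[of \<nu> h 1] by (simp add: stable_walk_def)
  have m1 [measurable]: "(\<lambda>\<omega>. \<nu> \<bullet> Y (real k * h) \<omega>) \<in> borel_measurable M" for k
    by (intro borel_measurable_inner borel_measurable_const Y_meas) (use h in simp)
  have m2 [measurable]: "(\<lambda>\<omega>. \<Sum>q<k. stable_step \<nu> h 1 q \<omega>) \<in> borel_measurable M" for k
    by (intro borel_measurable_sum stable_step_meas h)
  have "prob {\<omega> \<in> space M. \<exists>k\<le>N. l < \<nu> \<bullet> Y (real k * h) \<omega>}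
      = prob {\<omega> \<in> space M. \<exists>k\<le>N. l < (\<Sum>q<k. stable_step \<nu> h 1 q \<omega>)}"
    using ae by (intro finite_measure_eq_AE) auto
  also have "\<dots> \<le> 2 * prob {\<omega> \<in> space M. l < (\<Sum>q<N. stable_step \<nu> h 1 q \<omega>)}"
    by (rule levy_maximal_inequality[OF indep_stable_step[OF h] half])
  also have "prob {\<omega> \<in> space M. l < (\<Sum>q<N. stable_step \<nu> h 1 q \<omega>)} = prob {\<omega> \<in> space M. l < \<nu> \<bullet> Y (real N * h) \<omega>}"
    using ae by (intro finite_measure_eq_AE) auto
  finally show ?thesis .
qed

text \<open>Only countably many times occur, all of them deterministic, so this is an event of
  \<open>Y\<close> alone and independence from \<open>U\<close> applies to it.\<close>

definition dyadic_exceed :: "real^'n \<Rightarrow> real \<Rightarrow> real \<Rightarrow> 'w set" where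
  "dyadic_exceed \<nu> T l = {\<omega> \<in> space M. \<exists>k j. j \<le> (2::nat) ^ k \<and> l < \<nu> \<bullet> Y (real j * (T / 2 ^ k)) \<omega>}"

lemma dyadic_exceed_event:
  assumes "0 \<le> T" shows "dyadic_exceed \<nu> T l \<in> sets (path_sigma Y)"
proof -
  have "{\<omega> \<in> space (path_sigma Y). l < \<nu> \<bullet> Y (real j * (T / 2 ^ k)) \<omega>} \<in> sets (path_sigma Y)" for j k :: nat
    using assms by (intro borel_measurable_less borel_measurable_inner borel_measurable_const path_sigma_measurable) simp
  then have "(\<Union>k. \<Union>j\<in>{..(2::nat) ^ k}. {\<omega> \<in> space (path_sigma Y). l < \<nu> \<bullet> Y (real j * (T / 2 ^ k)) \<omega>})
      \<in> sets (path_sigma Y)"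
    by (intro sets.countable_UN sets.finite_UN) auto
  moreover have "dyadic_exceed \<nu> T l
      = (\<Union>k. \<Union>j\<in>{..(2::nat) ^ k}. {\<omega> \<in> space (path_sigma Y). l < \<nu> \<bullet> Y (real j * (T / 2 ^ k)) \<omega>})"
    by (auto simp: dyadic_exceed_def)
  ultimately show ?thesis by simp
qed

lemma process_events_subset_Y: "sets (path_sigma Y) \<subseteq> sets M"
  unfolding sets_path_sigma process_events_def
  by (rule sets.sigma_sets_subset) (auto intro: measurable_sets Y_meas)

text \<open>The maximal inequality has the same right-hand side at every dyadic level, and the
  events of the levels increase to the full one.\<close>

lemma emeasure_dyadic_exceed:
  assumes \<nu>: "norm \<nu> = 1" and T: "0 \<le> T"
  shows "emeasure M (dyadic_exceed \<nu> T l) \<le> 2 * emeasure M {\<omega> \<in> space M. l < \<nu> \<bullet> Y T \<omega>}"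
proof -
  define E where "E k = {\<omega> \<in> space M. \<exists>j\<le>(2::nat) ^ k. l < \<nu> \<bullet> Y (real j * (T / 2 ^ k)) \<omega>}" for k
  have E: "E k \<in> sets M" for k
  proof -
    have "{\<omega> \<in> space M. l < \<nu> \<bullet> Y (real j * (T / 2 ^ k)) \<omega>} \<in> sets M" for j :: nat
      using T by (intro borel_measurable_less borel_measurable_inner borel_measurable_const Y_meas) simp
    then have "(\<Union>j\<in>{..(2::nat) ^ k}. {\<omega> \<in> space M. l < \<nu> \<bullet> Y (real j * (T / 2 ^ k)) \<omega>}) \<in> sets M"
      by (intro sets.finite_UN) auto
    moreover have "E k = (\<Union>j\<in>{..(2::nat) ^ k}. {\<omega> \<in> space M. l < \<nu> \<bullet> Y (real j * (T / 2 ^ k)) \<omega>})"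
      by (auto simp: E_def)
    ultimately show ?thesis by simp
  qed
  have inc: "incseq E"
  proof (rule incseq_SucI)
    fix k show "E k \<le> E (Suc k)"
    proof
      fix \<omega> assume "\<omega> \<in> E k"
      then obtain j where j: "\<omega> \<in> space M" "j \<le> 2 ^ k" "l < \<nu> \<bullet> Y (real j * (T / 2 ^ k)) \<omega>" by (auto simp: E_def)
      have "real (2 * j) * (T / 2 ^ Suc k) = real j * (T / 2 ^ k)" by simp
      then have "2 * j \<le> 2 ^ Suc k \<and> l < \<nu> \<bullet> Y (real (2 * j) * (T / 2 ^ Suc k)) \<omega>" using j by simp
      then show "\<omega> \<in> E (Suc k)" using j(1) unfolding E_def by blast
    qed
  qed
  have le: "emeasure M (E k) \<le> 2 * emeasure M {\<omega> \<in> space M. l < \<nu> \<bullet> Y T \<omega>}" for k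
  proof -
    have "prob (E k) \<le> 2 * prob {\<omega> \<in> space M. l < \<nu> \<bullet> Y (real (2 ^ k) * (T / 2 ^ k)) \<omega>}"
      unfolding E_def using T by (intro walk_maximal_inequality[OF \<nu>]) simp
    then have "ennreal (prob (E k)) \<le> ennreal (2 * prob {\<omega> \<in> space M. l < \<nu> \<bullet> Y T \<omega>})"
      by (intro ennreal_leI) simp
    then show ?thesis by (simp add: emeasure_eq_measure ennreal_mult)
  qed
  have "dyadic_exceed \<nu> T l = (\<Union>k. E k)" by (auto simp: dyadic_exceed_def E_def)
  also have "emeasure M (\<Union>k. E k) = (SUP k. emeasure M (E k))"
    using E inc by (intro SUP_emeasure_incseq[symmetric]) auto
  finally show ?thesis using le by (auto intro: SUP_least)
qed

text \<open>By \<open>one_minus_cos_integral_lower\<close> and Tonelli the moment is controlled by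
  the integral of \<open>(1 - exp (- (u powr \<alpha>))) / u\<^sup>2\<close>. The integrand is at
  most \<open>u powr (- 2)\<close> for large \<open>u\<close> and at most
  \<open>u powr (\<alpha> - 2)\<close> near 0, and the latter is integrable because \<alpha> >
  1.\<close>

lemma nn_integral_abs_Y1_finite:
  assumes "norm \<nu> = 1"
  shows "(\<integral>\<^sup>+ \<omega>. ennreal \<bar>\<nu> \<bullet> Y 1 \<omega>\<bar> \<partial>M) < \<infinity>"
proof -
  interpret pair_sigma_finite M lborel ..
  let ?Z = "\<lambda>\<omega>. \<nu> \<bullet> Y 1 \<omega>"
  have [measurable]: "?Z \<in> borel_measurable M"
    by (intro borel_measurable_inner borel_measurable_const Y_meas) simp
  have cos_int: "(LINT \<omega>|M. cos (u * ?Z \<omega>)) = exp (- (\<bar>u\<bar> powr \<alpha>))" for u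
  proof -
    have i: "integrable M (\<lambda>\<omega>. iexp (u * ?Z \<omega>))"
      by (rule integrable_const_bound[where B = 1]) auto
    have "(LINT \<omega>|M. cos (u * ?Z \<omega>)) = Re (LINT \<omega>|M. iexp (u * ?Z \<omega>))"
      using integral_Re[OF i] by (simp add: Re_exp)
    also have "(LINT \<omega>|M. iexp (u * ?Z \<omega>)) = (LINT \<omega>|M. iexp ((u *\<^sub>R \<nu>) \<bullet> Y 1 \<omega>))" by simp
    also have "\<dots> = complex_of_real (exp (- 1 * norm (u *\<^sub>R \<nu>) powr \<alpha>))" by (rule Y_char) simp
    finally show ?thesis using assms by simp
  qed
  have inner: "(\<integral>\<^sup>+ \<omega>. ennreal ((1 - cos (u * ?Z \<omega>)) / u\<^sup>2) * indicator {0<..} u \<partial>M)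
      \<le> ennreal (u powr (\<alpha> - 2)) * indicator {0..1} u + ennreal (u powr (- 2)) * indicator {1..} u" for u :: real
  proof (cases "0 < u")
    case True
    have i: "integrable M (\<lambda>\<omega>. cos (u * ?Z \<omega>))"
      by (rule integrable_const_bound[where B = 1]) auto
    have "(\<integral>\<^sup>+ \<omega>. ennreal ((1 - cos (u * ?Z \<omega>)) / u\<^sup>2) * indicator {0<..} u \<partial>M)
        = (\<integral>\<^sup>+ \<omega>. ennreal ((1 - cos (u * ?Z \<omega>)) / u\<^sup>2) \<partial>M)" using True by simp
    also have "\<dots> = ennreal (LINT \<omega>|M. (1 - cos (u * ?Z \<omega>)) / u\<^sup>2)"
      using i by (intro nn_integral_eq_integral) auto
    also have "(LINT \<omega>|M. (1 - cos (u * ?Z \<omega>)) / u\<^sup>2) = (1 - exp (- (u powr \<alpha>))) / u\<^sup>2"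
      using i True by (simp add: cos_int prob_space)
    finally have eq: "(\<integral>\<^sup>+ \<omega>. ennreal ((1 - cos (u * ?Z \<omega>)) / u\<^sup>2) * indicator {0<..} u \<partial>M)
        = ennreal ((1 - exp (- (u powr \<alpha>))) / u\<^sup>2)" .
    have u2: "u\<^sup>2 = u powr 2" using True by (simp add: powr_numeral)
    show ?thesis
    proof (cases "u \<le> 1")
      case u1: True
      have "1 - exp (- (u powr \<alpha>)) \<le> u powr \<alpha>" using exp_ge_add_one_self[of "- (u powr \<alpha>)"] by simp
      then have "(1 - exp (- (u powr \<alpha>))) / u\<^sup>2 \<le> u powr \<alpha> / u\<^sup>2" by (intro divide_right_mono) auto
      also have "\<dots> = u powr (\<alpha> - 2)" unfolding u2 using True by (simp add: powr_diff)
      finally have "ennreal ((1 - exp (- (u powr \<alpha>))) / u\<^sup>2) \<le> ennreal (u powr (\<alpha> - 2))" by (rule ennreal_leI)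
      then show ?thesis unfolding eq using True u1 by (simp add: add_increasing2)
    next
      case False
      have "(1 - exp (- (u powr \<alpha>))) / u\<^sup>2 \<le> 1 / u\<^sup>2" by (intro divide_right_mono) auto
      also have "\<dots> = u powr (- 2)" unfolding u2 using True by (simp add: powr_minus field_simps)
      finally have "ennreal ((1 - exp (- (u powr \<alpha>))) / u\<^sup>2) \<le> ennreal (u powr (- 2))" by (rule ennreal_leI)
      then show ?thesis unfolding eq using False by simp
    qed
  qed simp
  have i1: "(\<integral>\<^sup>+ u. ennreal (u powr (\<alpha> - 2)) * indicator {0..1} u \<partial>lborel) < \<infinity>"
    using nn_integral_has_integral_lebesgue'[OF _ has_integral_powr_from_0[of "\<alpha> - 2" 1]] alpha by simp
  have i2: "(\<integral>\<^sup>+ u. ennreal (u powr (- 2)) * indicator {1..} u \<partial>lborel) < \<infinity>"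
    using nn_integral_has_integral_lebesgue'[OF _ has_integral_powr_to_inf[of "- 2" 1]] by simp
  have "(\<integral>\<^sup>+ \<omega>. ennreal ((1 - cos 1) / 4) * ennreal \<bar>?Z \<omega>\<bar> \<partial>M)
     \<le> (\<integral>\<^sup>+ \<omega>. (\<integral>\<^sup>+ u. ennreal ((1 - cos (u * ?Z \<omega>)) / u\<^sup>2) * indicator {0<..} u \<partial>lborel) \<partial>M)"
  proof (rule nn_integral_mono)
    fix \<omega>
    have "ennreal ((1 - cos 1) / 4) * ennreal \<bar>?Z \<omega>\<bar> = ennreal ((1 - cos 1) / 4 * \<bar>?Z \<omega>\<bar>)"
      by (rule ennreal_mult[symmetric]) auto
    then show "ennreal ((1 - cos 1) / 4) * ennreal \<bar>?Z \<omega>\<bar>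
        \<le> (\<integral>\<^sup>+ u. ennreal ((1 - cos (u * ?Z \<omega>)) / u\<^sup>2) * indicator {0<..} u \<partial>lborel)"
      using one_minus_cos_integral_lower by simp
  qed
  also have "\<dots> = (\<integral>\<^sup>+ u. (\<integral>\<^sup>+ \<omega>. ennreal ((1 - cos (u * ?Z \<omega>)) / u\<^sup>2) * indicator {0<..} u \<partial>M) \<partial>lborel)"
    by (rule Fubini'[symmetric]) measurable
  also have "\<dots> \<le> (\<integral>\<^sup>+ u. ennreal (u powr (\<alpha> - 2)) * indicator {0..1} u + ennreal (u powr (- 2)) * indicator {1..} u \<partial>lborel)"
    by (rule nn_integral_mono) (rule inner)
  also have "\<dots> = (\<integral>\<^sup>+ u. ennreal (u powr (\<alpha> - 2)) * indicator {0..1} u \<partial>lborel)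
      + (\<integral>\<^sup>+ u. ennreal (u powr (- 2)) * indicator {1..} u \<partial>lborel)"
    by (rule nn_integral_add) auto
  also have "\<dots> < \<infinity>" using i1 i2 by simp
  finally have fin: "ennreal ((1 - cos 1) / 4) * (\<integral>\<^sup>+ \<omega>. ennreal \<bar>?Z \<omega>\<bar> \<partial>M) < \<infinity>"
    by (simp add: nn_integral_cmult)
  have "cos 1 < (1::real)" using cos_monotone_0_pi[of 0 1] pi_gt3 by simp
  then have "ennreal ((1 - cos 1) / 4) \<noteq> 0" by simp
  then show ?thesis using fin by (auto simp: ennreal_mult_less_top)
qed

lemma nn_integral_Y_scaling:
  assumes "norm \<nu> = 1"
  shows "(\<integral>\<^sup>+ \<omega>. ennreal (\<nu> \<bullet> Y (real N) \<omega>) \<partial>M) \<le> ennreal (real N powr (1 / \<alpha>)) * (\<integral>\<^sup>+ \<omega>. ennreal \<bar>\<nu> \<bullet> Y 1 \<omega>\<bar> \<partial>M)"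
proof -
  let ?c = "real N powr (1 / \<alpha>)"
  have m: "(\<lambda>\<omega>. c * (\<nu> \<bullet> Y r \<omega>)) \<in> borel_measurable M" if "0 \<le> r" for c r
    by (intro borel_measurable_times borel_measurable_inner borel_measurable_const Y_meas that)
  have ch: "char (distr M borel (\<lambda>\<omega>. c * (\<nu> \<bullet> Y r \<omega>))) \<theta> = complex_of_real (exp (- (r * \<bar>c\<bar> powr \<alpha>) * \<bar>\<theta>\<bar> powr \<alpha>))"
    if "0 \<le> r" for c r \<theta>
  proof -
    have "distr M borel (\<lambda>\<omega>. c * (\<nu> \<bullet> Y r \<omega>)) = distr M borel (\<lambda>\<omega>. c * (\<nu> \<bullet> (Y (0 + r) \<omega> - Y 0 \<omega>)))"
    proof (rule distr_cong_AE)
      show "AE \<omega> in M. c * (\<nu> \<bullet> Y r \<omega>) = c * (\<nu> \<bullet> (Y (0 + r) \<omega> - Y 0 \<omega>))"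
        using AE_regular by eventually_elim (simp add: regular_def)
    qed (use m[OF that, of c] that in \<open>auto intro!: borel_measurable_times borel_measurable_inner borel_measurable_diff Y_meas\<close>)
    then show ?thesis using char_increment[OF assms that, of 0] by simp
  qed
  have "distr M borel (\<lambda>\<omega>. 1 * (\<nu> \<bullet> Y (real N) \<omega>)) = distr M borel (\<lambda>\<omega>. ?c * (\<nu> \<bullet> Y 1 \<omega>))"
  proof (rule Levy_uniqueness)
    show "char (distr M borel (\<lambda>\<omega>. 1 * (\<nu> \<bullet> Y (real N) \<omega>))) = char (distr M borel (\<lambda>\<omega>. ?c * (\<nu> \<bullet> Y 1 \<omega>)))"
      using alpha by (intro ext) (simp only: ch of_nat_0_le_iff zero_le_one, simp add: powr_powr)
  qed (use m in auto)
  then have "(\<integral>\<^sup>+ x. ennreal x \<partial>distr M borel (\<lambda>\<omega>. 1 * (\<nu> \<bullet> Y (real N) \<omega>))) = (\<integral>\<^sup>+ x. ennreal x \<partial>distr M borel (\<lambda>\<omega>. ?c * (\<nu> \<bullet> Y 1 \<omega>)))"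
    by simp
  then have "(\<integral>\<^sup>+ \<omega>. ennreal (\<nu> \<bullet> Y (real N) \<omega>) \<partial>M) = (\<integral>\<^sup>+ \<omega>. ennreal (?c * (\<nu> \<bullet> Y 1 \<omega>)) \<partial>M)"
    using m by (simp add: nn_integral_distr)
  also have "\<dots> \<le> (\<integral>\<^sup>+ \<omega>. ennreal ?c * ennreal \<bar>\<nu> \<bullet> Y 1 \<omega>\<bar> \<partial>M)"
    by (intro nn_integral_mono) (auto simp: ennreal_mult[symmetric] intro!: ennreal_leI mult_left_mono)
  also have "\<dots> = ennreal ?c * (\<integral>\<^sup>+ \<omega>. ennreal \<bar>\<nu> \<bullet> Y 1 \<omega>\<bar> \<partial>M)"
    using m[of 1 1] by (intro nn_integral_cmult) simp
  finally show ?thesis .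
qed

text \<open>The random horizon \<open>U 1\<close> is replaced by the integer above it, so that
  independence can be used for each value of this integer. It is positive here, since
  \<open>Y\<close> starts at 0 and \<open>0 < l\<close>.\<close>

lemma scaled_sup_exceed_subset:
  assumes \<omega>: "\<omega> \<in> space M" "\<omega> \<in> good" and l: "0 < l" "l < scaled_sup 1 \<nu> \<omega>"
  shows "\<omega> \<in> dyadic_exceed \<nu> (real (nat \<lceil>U 1 \<omega>\<rceil>)) l"
proof -
  let ?N = "real (nat \<lceil>U 1 \<omega>\<rceil>)"
  have r: "regular \<omega>" by (rule good(3)[OF \<omega>(2)])
  obtain s where s: "s \<in> {0..1}" "l < \<nu> \<bullet> X s \<omega>"
    using less_scaled_supE[OF _ l(2)] by auto
  have u: "0 \<le> U s \<omega>" using regular_U_nonneg[OF r] s by simp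
  have "U s \<omega> \<le> U 1 \<omega>" using r s unfolding regular_def by (auto intro: mono_onD[of "{0..}"])
  then have uN: "U s \<omega> \<le> ?N" by linarith
  have lY: "l < \<nu> \<bullet> Y (U s \<omega>) \<omega>" using s(2) \<omega>(2) by (simp add: X_def)
  have "?N \<noteq> 0"
  proof
    assume "?N = 0"
    then have "U s \<omega> = 0" using u uN by linarith
    then show False using lY l(1) r by (simp add: regular_def)
  qed
  then have N: "0 < ?N" by linarith
  have cY: "cadlag (\<lambda>u. Y u \<omega>)" using r by (simp add: regular_def)
  have bdd: "bdd_above ((\<lambda>u. \<nu> \<bullet> Y u \<omega>) ` {0..?N})"
  proof -
    obtain B where B: "\<forall>u\<in>{0..?N}. norm (Y u \<omega>) \<le> B" using cadlag_bounded[OF cY] by blast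
    have "\<nu> \<bullet> Y u \<omega> \<le> norm \<nu> * B" if "u \<in> {0..?N}" for u
      using norm_cauchy_schwarz[of \<nu> "Y u \<omega>"] B that mult_left_mono[of "norm (Y u \<omega>)" B "norm \<nu>"] by fastforce
    then show ?thesis by (rule bdd_aboveI2)
  qed
  have "(\<lambda>k. Max ((\<lambda>i. \<nu> \<bullet> Y (?N * real i / 2 ^ k) \<omega>) ` {..2 ^ k})) \<longlonglongrightarrow> (SUP u\<in>{0..?N}. \<nu> \<bullet> Y u \<omega>)"
    using cY N bdd by (intro dyadic_max_tendsto_SUP[of _ "\<lambda>u. \<nu> \<bullet> Y u \<omega>"])
      (auto simp: cadlag_def intro!: tendsto_inner)
  moreover have "l < (SUP u\<in>{0..?N}. \<nu> \<bullet> Y u \<omega>)"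
  proof -
    have "\<nu> \<bullet> Y (U s \<omega>) \<omega> \<le> (SUP u\<in>{0..?N}. \<nu> \<bullet> Y u \<omega>)"
      by (rule cSUP_upper[OF _ bdd]) (use u uN in simp)
    then show ?thesis using lY by linarith
  qed
  ultimately have "\<forall>\<^sub>F k in sequentially. l < Max ((\<lambda>i. \<nu> \<bullet> Y (?N * real i / 2 ^ k) \<omega>) ` {..2 ^ k})"
    by (rule order_tendstoD(1))
  then obtain k where "l < Max ((\<lambda>i. \<nu> \<bullet> Y (?N * real i / 2 ^ k) \<omega>) ` {..2 ^ k})"
    by (auto simp: eventually_sequentially)
  then obtain i where i: "i \<le> (2::nat) ^ k" "l < \<nu> \<bullet> Y (?N * real i / 2 ^ k) \<omega>"
    by (subst (asm) Max_gr_iff) auto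
  have eq: "?N * real i / 2 ^ k = real i * (?N / 2 ^ k)" by simp
  have "l < \<nu> \<bullet> Y (real i * (?N / 2 ^ k)) \<omega>" using i(2) unfolding eq .
  then show ?thesis using i(1) \<omega>(1) unfolding dyadic_exceed_def by blast
qed

text \<open>When the rounded horizon is \<open>N\<close>, independence and the maximal inequality
  bound the tail by twice that of \<open>\<nu> \<bullet> Y (real N)\<close>, whose positive part has
  mean at most a multiple of \<open>N powr (1 / \<alpha>)\<close>. Summation over \<open>N\<close>
  leaves the mean of the rounded \<open>U 1\<close> raised to \<open>1 / \<alpha>\<close>, which the
  moment hypothesis bounds.\<close>

lemma integrable_scaled_sup:
  assumes \<nu>: "norm \<nu> = 1" and p: "1 < p" and int: "integrable M (\<lambda>\<omega>. U 1 \<omega> powr (p / \<alpha>))"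
  shows "integrable M (scaled_sup 1 \<nu>)"
proof -
  let ?H = "scaled_sup 1 \<nu>" and ?f = "\<lambda>\<omega>. nat \<lceil>U 1 \<omega>\<rceil>"
  let ?C = "\<lambda>N. {\<omega> \<in> space M. ?f \<omega> = N}"
  define Z where "Z = (\<integral>\<^sup>+ \<omega>. ennreal \<bar>\<nu> \<bullet> Y 1 \<omega>\<bar> \<partial>M)"
  have Cev: "?C N \<in> sets (path_sigma U)" for N
  proof -
    have [measurable]: "U 1 \<in> borel_measurable (path_sigma U)" by (rule path_sigma_measurable) simp
    have "{\<omega> \<in> space (path_sigma U). ?f \<omega> = N} \<in> sets (path_sigma U)" by measurable
    then show ?thesis by simp
  qed
  then have C: "?C N \<in> sets M" for N using process_events_subset_U by blast
  have Dev: "dyadic_exceed \<nu> (real N) l \<in> sets (path_sigma Y)" for N l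
    by (rule dyadic_exceed_event) simp
  then have D: "dyadic_exceed \<nu> (real N) l \<in> sets M" for N l using process_events_subset_Y by blast
  have [measurable]: "Y (real N) \<in> borel_measurable M" for N by (rule Y_meas) simp
  let ?T = "\<lambda>N l. emeasure M {\<omega> \<in> space M. l < \<nu> \<bullet> Y (real N) \<omega>}"
  have tail: "emeasure M {\<omega> \<in> space M. l < ?H \<omega>} \<le> (\<Sum>N. emeasure M (?C N) * (2 * ?T N l))" if l: "0 < l" for l
  proof -
    have "emeasure M {\<omega> \<in> space M. l < ?H \<omega>} \<le> emeasure M (\<Union>N. ?C N \<inter> dyadic_exceed \<nu> (real N) l)"
    proof (rule emeasure_mono_AE)
      show "AE \<omega> in M. \<omega> \<in> {\<omega> \<in> space M. l < ?H \<omega>} \<longrightarrow> \<omega> \<in> (\<Union>N. ?C N \<inter> dyadic_exceed \<nu> (real N) l)"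
        using good(2) by eventually_elim (use scaled_sup_exceed_subset l in auto)
    qed (use C D in auto)
    also have "\<dots> \<le> (\<Sum>N. emeasure M (?C N \<inter> dyadic_exceed \<nu> (real N) l))"
      using C D by (intro emeasure_subadditive_countably) auto
    also have "\<dots> \<le> (\<Sum>N. emeasure M (?C N) * (2 * ?T N l))"
    proof (intro suminf_le allI)
      fix N
      have "emeasure M (?C N \<inter> dyadic_exceed \<nu> (real N) l) = emeasure M (?C N) * emeasure M (dyadic_exceed \<nu> (real N) l)"
        by (rule indep_events[OF Cev Dev])
      also have "\<dots> \<le> emeasure M (?C N) * (2 * ?T N l)"
        by (intro mult_left_mono emeasure_dyadic_exceed[OF \<nu>]) auto
      finally show "emeasure M (?C N \<inter> dyadic_exceed \<nu> (real N) l) \<le> emeasure M (?C N) * (2 * ?T N l)" .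
    qed auto
    finally show ?thesis .
  qed
  have Tm: "(\<lambda>l. if 0 < l then ?T N l else 0) \<in> borel_measurable lborel" for N
  proof -
    have "(\<lambda>l. ?T N l) \<in> borel_measurable lborel" by measurable
    then show ?thesis by measurable
  qed
  have "(\<integral>\<^sup>+ \<omega>. ennreal (?H \<omega>) \<partial>M) = (\<integral>\<^sup>+ l. (if 0 < l then emeasure M {\<omega> \<in> space M. l < ?H \<omega>} else 0) \<partial>lborel)"
    by (rule nn_integral_layer_cake) simp
  also have "\<dots> \<le> (\<integral>\<^sup>+ l. (\<Sum>N. emeasure M (?C N) * (2 * (if 0 < l then ?T N l else 0))) \<partial>lborel)"
    using tail by (intro nn_integral_mono) auto
  also have "\<dots> = (\<Sum>N. (\<integral>\<^sup>+ l. emeasure M (?C N) * (2 * (if 0 < l then ?T N l else 0)) \<partial>lborel))"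
    using Tm by (intro nn_integral_suminf) measurable
  also have "\<dots> = (\<Sum>N. emeasure M (?C N) * (2 * (\<integral>\<^sup>+ l. (if 0 < l then ?T N l else 0) \<partial>lborel)))"
    using Tm by (simp add: nn_integral_cmult)
  also have "\<dots> = (\<Sum>N. emeasure M (?C N) * (2 * (\<integral>\<^sup>+ \<omega>. ennreal (\<nu> \<bullet> Y (real N) \<omega>) \<partial>M)))"
    by (subst nn_integral_layer_cake) auto
  also have "\<dots> \<le> (\<Sum>N. emeasure M (?C N) * (2 * (ennreal (real N powr (1 / \<alpha>)) * Z)))"
    unfolding Z_def by (intro suminf_le allI mult_left_mono nn_integral_Y_scaling[OF \<nu>]) auto
  also have "\<dots> = (\<Sum>N. (2 * Z) * (ennreal (real N powr (1 / \<alpha>)) * emeasure M (?C N)))"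
    by (simp add: mult_ac)
  also have "\<dots> = (2 * Z) * (\<Sum>N. ennreal (real N powr (1 / \<alpha>)) * emeasure M (?C N))"
    by (rule ennreal_suminf_cmult)
  also have "(\<Sum>N. ennreal (real N powr (1 / \<alpha>)) * emeasure M (?C N))
      = (\<Sum>N. (\<integral>\<^sup>+ \<omega>. ennreal (real N powr (1 / \<alpha>)) * indicator (?C N) \<omega> \<partial>M))"
    using C by (simp add: nn_integral_cmult_indicator)
  also have "\<dots> = (\<integral>\<^sup>+ \<omega>. (\<Sum>N. ennreal (real N powr (1 / \<alpha>)) * indicator (?C N) \<omega>) \<partial>M)"
    using C by (intro nn_integral_suminf[symmetric]) auto
  also have "\<dots> = (\<integral>\<^sup>+ \<omega>. ennreal (real (?f \<omega>) powr (1 / \<alpha>)) \<partial>M)"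
  proof (rule nn_integral_cong)
    fix \<omega> assume "\<omega> \<in> space M"
    moreover have "disjoint_family ?C" by (auto simp: disjoint_family_on_def)
    ultimately show "(\<Sum>N. ennreal (real N powr (1 / \<alpha>)) * indicator (?C N) \<omega>) = ennreal (real (?f \<omega>) powr (1 / \<alpha>))"
      by (intro suminf_cmult_indicator) auto
  qed
  also have "\<dots> \<le> (\<integral>\<^sup>+ \<omega>. ennreal (2 * (1 + U 1 \<omega> powr (p / \<alpha>))) \<partial>M)"
  proof (rule nn_integral_mono_AE)
    show "AE \<omega> in M. ennreal (real (?f \<omega>) powr (1 / \<alpha>)) \<le> ennreal (2 * (1 + U 1 \<omega> powr (p / \<alpha>)))"
      using AE_regular
    proof eventually_elim
      case (elim \<omega>)
      let ?u = "U 1 \<omega>"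
      have u: "0 \<le> ?u" using regular_U_nonneg[OF elim, of 1] by simp
      \<comment> \<open>Bounding \<open>?u\<close> by a number that is at least 1 absorbs the
        rounding and makes the exponents \<open>1 / \<alpha>\<close> and \<open>p / \<alpha>\<close>
        comparable.\<close>
      define m where "m = max ?u 1"
      have m: "1 \<le> m" "?u \<le> m" by (auto simp: m_def)
      have "real (?f \<omega>) \<le> ?u + 1" using u by linarith
      also have "\<dots> \<le> 2 * m" using m by simp
      finally have "real (?f \<omega>) powr (1 / \<alpha>) \<le> (2 * m) powr (1 / \<alpha>)" using alpha by (intro powr_mono2) auto
      also have "\<dots> = 2 powr (1 / \<alpha>) * m powr (1 / \<alpha>)" using m by (simp add: powr_mult)
      also have "\<dots> \<le> 2 powr 1 * m powr (p / \<alpha>)"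
        using m p alpha by (intro mult_mono powr_mono) (auto simp: field_simps)
      also have "m powr (p / \<alpha>) \<le> 1 + ?u powr (p / \<alpha>)"
        by (cases "?u \<le> 1") (auto simp: m_def max_def)
      finally show ?case by (intro ennreal_leI) simp
    qed
  qed
  also have "(2 * Z) * \<dots> < \<infinity>"
  proof -
    have "integrable M (\<lambda>\<omega>. 2 * (1 + U 1 \<omega> powr (p / \<alpha>)))" using int by auto
    then have "(\<integral>\<^sup>+ \<omega>. ennreal (2 * (1 + U 1 \<omega> powr (p / \<alpha>))) \<partial>M) < \<infinity>"
      by (subst nn_integral_eq_integral) auto
    moreover have "Z < \<infinity>" unfolding Z_def by (rule nn_integral_abs_Y1_finite[OF \<nu>])
    ultimately show ?thesis by (simp add: ennreal_mult_less_top)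
  qed
  finally have "(\<integral>\<^sup>+ \<omega>. ennreal (?H \<omega>) \<partial>M) < \<infinity>"
    by (simp add: mult_left_mono)
  then show ?thesis
    by (intro integrableI_nonneg) (auto simp: scaled_sup_nonneg)
qed

end

section \<open>Comparison with half spaces\<close>

text \<open>Moving from a point of \<open>N\<close> in a suitable coordinate direction one enters the ball that avoids \<open>N\<close>.
  So \<open>N\<close> is covered by finitely many sets that are disjoint from all their small translates in one direction,
  and a bounded set of this kind is null.\<close>

lemma exterior_ball_null_set:
  fixes N :: "'b::euclidean_space set"
  assumes "bounded N" "0 < R" and ext: "\<And>x. x \<in> N \<Longrightarrow> \<exists>v. norm v = 1 \<and> ball (x + R *\<^sub>R v) R \<inter> N = {}"
  shows "\<exists>N'\<in>null_sets lborel. N \<subseteq> N'"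
proof -
  \<comment> \<open>The closure provides compactness, and an open ball that misses \<open>N\<close>
    also misses its closure.\<close>
  define K where "K = closure N"
  have K: "compact K" using assms(1) by (simp add: K_def compact_closure)
  \<comment> \<open>Some signed coordinate vector \<open>u\<close> has \<open>v \<bullet> u\<close>
    at least the inverse of the dimension. By \<open>mem_tangent_ball_iff\<close> the points
    \<open>x + h *\<^sub>R u\<close> then lie in the tangent ball for all
    \<open>0 < h < r\<close>.\<close>
  define r where "r = 2 * R / real DIM('b)"
  have r: "0 < r" using assms(2) by (simp add: r_def)
  define E where "E u = {x \<in> K. \<forall>h\<in>{0<..<r}. x + h *\<^sub>R u \<notin> K}" for u
  have null: "E u \<in> null_sets lborel" if u: "norm u = 1" for u
  proof -
    \<comment> \<open>Compact pieces that exhaust the points to be removed from \<open>K\<close>;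
      they show that \<open>E u\<close> is a Borel set.\<close>
    define F where "F m = (\<lambda>(k, h). k - h *\<^sub>R u) ` (K \<times> {r / real (m + 2) .. r - r / real (m + 2)})" for m :: nat
    have "compact (F m)" for m
      unfolding F_def using K
      by (intro compact_continuous_image compact_Times) (auto intro!: continuous_intros simp: case_prod_unfold)
    then have F: "F m \<in> sets borel" for m by (simp add: borel_compact)
    have "E u = K - (\<Union>m. F m)"
    proof (intro set_eqI iffI)
      fix x assume x: "x \<in> E u"
      have "x \<notin> F m" for m
      proof
        assume "x \<in> F m"
        then obtain k h where kh: "k \<in> K" "r / real (m + 2) \<le> h" "h \<le> r - r / real (m + 2)" "x = k - h *\<^sub>R u"
          by (auto simp: F_def)
        have "0 < r / real (m + 2)" using r by simp
        then have "h \<in> {0<..<r}" using kh by auto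
        moreover have "x + h *\<^sub>R u \<in> K" using kh by simp
        ultimately show False using x unfolding E_def by blast
      qed
      then show "x \<in> K - (\<Union>m. F m)" using x by (auto simp: E_def)
    next
      fix x assume x: "x \<in> K - (\<Union>m. F m)"
      have "x + h *\<^sub>R u \<notin> K" if h: "h \<in> {0<..<r}" for h
      proof
        assume k: "x + h *\<^sub>R u \<in> K"
        define c where "c = min h (r - h)"
        have c: "0 < c" using h by (simp add: c_def)
        obtain m :: nat where m: "r / c < real m" using reals_Archimedean2 by blast
        then have "r / c < real (m + 2)" by simp
        then have "r < real (m + 2) * c" using c by (simp add: pos_divide_less_eq)
        then have "r / real (m + 2) < c" by (subst pos_divide_less_eq) (simp_all add: mult.commute)
        then have "h \<in> {r / real (m + 2) .. r - r / real (m + 2)}" by (auto simp: c_def)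
        then have "x \<in> F m" unfolding F_def using k by (intro image_eqI[of _ _ "(x + h *\<^sub>R u, h)"]) auto
        then show False using x by auto
      qed
      then show "x \<in> E u" using x by (auto simp: E_def)
    qed
    then have Eb: "E u \<in> sets borel" using F K by (auto simp: borel_compact)
    have bdd: "bounded (E u)" using K by (auto simp: E_def intro: bounded_subset[OF compact_imp_bounded])
    obtain b where b: "\<And>x. x \<in> E u \<Longrightarrow> norm x \<le> b" using bdd by (auto simp: bounded_iff)
    \<comment> \<open>Two of the shifts differ by an amount in \<open>{0<..<r}\<close>, so these
      translates are pairwise disjoint. Infinitely many sets of equal measure inside one ball force
      that measure to be 0.\<close>
    define A where "A i = (+) (- ((r / real (i + 2)) *\<^sub>R u)) -` E u" for i :: nat
    have A: "A i \<in> sets lborel" for i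
      unfolding A_def sets_lborel by (rule measurable_sets_borel[OF _ Eb]) measurable
    have mA: "measure lborel (A i) = measure lborel (E u)" for i
      using measure_distr[of "(+) (- ((r / real (i + 2)) *\<^sub>R u))" lborel borel "E u"] Eb
      unfolding lborel_distr_plus A_def by simp
    have Ab: "A i \<subseteq> cball 0 (b + r)" for i
    proof
      fix y assume "y \<in> A i"
      then have "norm (- ((r / real (i + 2)) *\<^sub>R u) + y) \<le> b" using b by (simp add: A_def)
      moreover have "norm ((r / real (i + 2)) *\<^sub>R u) \<le> r" using r u by (simp add: field_simps)
      moreover have "norm y \<le> norm (- ((r / real (i + 2)) *\<^sub>R u) + y) + norm ((r / real (i + 2)) *\<^sub>R u)"
        using norm_triangle_ineq[of "- ((r / real (i + 2)) *\<^sub>R u) + y" "(r / real (i + 2)) *\<^sub>R u"] by simp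
      ultimately show "y \<in> cball 0 (b + r)" by simp
    qed
    have disj: "disjoint_family A"
    proof -
      have no: False if y: "y \<in> A i" "y \<in> A j" and ij: "i < j" for y i j
      proof -
        let ?h = "r / real (i + 2)" and ?h' = "r / real (j + 2)"
        have lt: "?h' < ?h" using ij r by (intro divide_strict_left_mono) auto
        have "r * 1 < r * real (i + 2)" using r by (intro mult_strict_left_mono) auto
        then have "0 < ?h'" "?h < r" using r by (auto simp: pos_divide_less_eq)
        then have "?h - ?h' \<in> {0<..<r}" using lt by auto
        moreover have "y - ?h *\<^sub>R u \<in> E u" "y - ?h' *\<^sub>R u \<in> E u" using y by (auto simp: A_def)
        moreover have "y - ?h *\<^sub>R u + (?h - ?h') *\<^sub>R u = y - ?h' *\<^sub>R u" by (simp add: algebra_simps)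
        ultimately show False unfolding E_def by (metis (mono_tags, lifting) mem_Collect_eq)
      qed
      show ?thesis
        unfolding disjoint_family_on_def
      proof (intro ballI impI, rule ccontr)
        fix i j assume "i \<noteq> j" "A i \<inter> A j \<noteq> {}"
        then obtain y where "y \<in> A i" "y \<in> A j" by blast
        then show False using no[of y i j] no[of y j i] \<open>i \<noteq> j\<close> by (cases "i < j") auto
      qed
    qed
    have finA: "emeasure lborel (A i) \<noteq> \<infinity>" for i
      using emeasure_bounded_finite[OF bounded_subset[OF bounded_cball Ab]] by (simp add: less_top)
    have le: "real n * measure lborel (E u) \<le> measure lborel (cball (0::'b) (b + r))" for n
    proof -
      have "real n * measure lborel (E u) = (\<Sum>i<n. measure lborel (A i))" by (simp add: mA)
      also have "\<dots> = measure lborel (\<Union>i<n. A i)"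
        using A finA disj by (intro measure_finite_Union[symmetric])
          (auto simp: disjoint_family_on_def)
      also have "\<dots> \<le> measure lborel (cball (0::'b) (b + r))"
        using A Ab by (intro measure_mono_fmeasurable)
          (auto intro!: fmeasurableI emeasure_bounded_finite)
      finally show ?thesis .
    qed
    have "measure lborel (E u) = 0"
    proof (rule ccontr)
      assume "measure lborel (E u) \<noteq> 0"
      then have p: "0 < measure lborel (E u)" by (simp add: zero_less_measure_iff)
      obtain n :: nat where "measure lborel (cball (0::'b) (b + r)) / measure lborel (E u) < real n"
        using reals_Archimedean2 by blast
      then show False using le[of n] p by (simp add: pos_divide_less_eq)
    qed
    moreover have "emeasure lborel (E u) < \<infinity>" by (rule emeasure_bounded_finite[OF bdd])
    ultimately show ?thesis using Eb by (simp add: null_sets_def emeasure_eq_ennreal_measure less_top)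
  qed
  let ?D = "Basis \<union> uminus ` Basis :: 'b set"
  have "N \<subseteq> (\<Union>u\<in>?D. E u)"
  proof
    fix x assume x: "x \<in> N"
    obtain v where v: "norm v = 1" "ball (x + R *\<^sub>R v) R \<inter> N = {}" using ext[OF x] by blast
    have "ball (x + R *\<^sub>R v) R \<inter> K = {}"
      using v(2) open_Int_closure_eq_empty[OF open_ball] unfolding K_def by blast
    have "\<exists>b\<in>Basis. 1 / real DIM('b) \<le> \<bar>v \<bullet> b\<bar>"
    proof (rule ccontr)
      assume "\<not> ?thesis"
      then have "(\<Sum>b\<in>Basis. \<bar>v \<bullet> b\<bar>) < (\<Sum>b\<in>(Basis::'b set). 1 / real DIM('b))"
        by (intro sum_strict_mono) (auto simp: not_le)
      then show False using norm_le_l1[of v] v(1) by simp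
    qed
    then obtain b where b: "b \<in> Basis" "1 / real DIM('b) \<le> \<bar>v \<bullet> b\<bar>" by blast
    define u where "u = (if 0 \<le> v \<bullet> b then b else - b)"
    have u: "u \<in> ?D" "norm u = 1" "1 / real DIM('b) \<le> v \<bullet> u"
      using b by (auto simp: u_def)
    have "x + h *\<^sub>R u \<notin> K" if h: "h \<in> {0<..<r}" for h
    proof -
      have "h * h < h * (2 * R * (v \<bullet> u))"
      proof (rule mult_strict_left_mono)
        have "h < 2 * R * (1 / real DIM('b))" using h by (simp add: r_def)
        also have "\<dots> \<le> 2 * R * (v \<bullet> u)" using u(3) assms(2) by (intro mult_left_mono) auto
        finally show "h < 2 * R * (v \<bullet> u)" .
      qed (use h in simp)
      then have "(norm (x + h *\<^sub>R u - x))\<^sup>2 < 2 * R * (v \<bullet> (x + h *\<^sub>R u - x))"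
        using u(2) by (simp add: power2_eq_square mult_ac)
      then have "x + h *\<^sub>R u \<in> ball (x + R *\<^sub>R v) R"
        using mem_tangent_ball_iff[OF v(1) assms(2)] by blast
      then show ?thesis using \<open>ball (x + R *\<^sub>R v) R \<inter> K = {}\<close> by blast
    qed
    moreover have "x \<in> K" using x closure_subset by (auto simp: K_def)
    ultimately show "x \<in> (\<Union>u\<in>?D. E u)" using u(1) unfolding E_def by blast
  qed
  moreover have "(\<Union>u\<in>?D. E u) \<in> null_sets lborel"
    by (rule null_sets_UN') (auto simp: null countable_finite)
  ultimately show ?thesis by blast
qed

text \<open>If all \<open>x + k\<close> lie in the domain but get arbitrarily close to the
  complement, a limit \<open>x + l\<close> is a frontier point. Moving \<open>x\<close> into the
  exterior ball at this point, shifted by \<open>- l\<close>, would push some translate out of the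
  domain, so that ball contains no point of the set and \<open>exterior_ball_null_set\<close>
  applies.\<close>

lemma grazing_translates_null:
  fixes \<Omega> :: "'b::euclidean_space set"
  assumes tb: "two_sided_ball R \<Omega> \<nu>" and \<Omega>: "open \<Omega>" "bounded \<Omega>"
    and K: "bounded K" "K \<noteq> {}"
  shows "\<exists>N'\<in>null_sets lborel.
    {x. (\<forall>k\<in>K. x + k \<in> \<Omega>) \<and> \<not> (\<exists>m::nat. \<forall>k\<in>K. 1 / real (Suc m) \<le> infdist (x + k) (- \<Omega>))} \<subseteq> N'"
proof (rule exterior_ball_null_set)
  let ?N = "{x. (\<forall>k\<in>K. x + k \<in> \<Omega>) \<and> \<not> (\<exists>m::nat. \<forall>k\<in>K. 1 / real (Suc m) \<le> infdist (x + k) (- \<Omega>))}"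
  show "0 < R" using tb by (simp add: two_sided_ball_def)
  obtain k0 where k0: "k0 \<in> K" using K(2) by blast
  obtain B where B: "\<And>k. k \<in> K \<Longrightarrow> norm k \<le> B" using K(1) by (auto simp: bounded_iff)
  obtain b where b: "\<And>x. x \<in> \<Omega> \<Longrightarrow> norm x \<le> b" using \<Omega>(2) by (auto simp: bounded_iff)
  show "bounded ?N"
    unfolding bounded_iff
  proof (intro exI ballI)
    fix x assume "x \<in> ?N"
    then have "norm (x + k0) \<le> b" using k0 b by auto
    then show "norm x \<le> b + B" using B[OF k0] norm_triangle_ineq4[of "x + k0" k0] by simp
  qed
  fix x assume x: "x \<in> ?N"
  then have "\<forall>m::nat. \<exists>k\<in>K. infdist (x + k) (- \<Omega>) < 1 / real (Suc m)" by (auto simp: not_le)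
  then obtain k where k: "\<And>m. k m \<in> K" "\<And>m. infdist (x + k m) (- \<Omega>) < 1 / real (Suc m)" by metis
  have "bounded (range k)" using B k(1) by (auto simp: bounded_iff)
  then obtain l and \<sigma> :: "nat \<Rightarrow> nat" where \<sigma>: "strict_mono \<sigma>" "(k \<circ> \<sigma>) \<longlonglongrightarrow> l"
    using bounded_imp_convergent_subsequence by blast
  define z where "z = x + l"
  have lim: "(\<lambda>m. x + k (\<sigma> m)) \<longlonglongrightarrow> z"
    unfolding z_def using \<sigma>(2) by (intro tendsto_add tendsto_const) (simp add: o_def)
  have in\<Omega>: "x + k m \<in> \<Omega>" for m using x k(1) by auto
  have cl: "z \<in> closure \<Omega>"
    using lim in\<Omega> unfolding closure_sequential by (intro exI[of _ "\<lambda>m. x + k (\<sigma> m)"]) auto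
  have "(\<lambda>m. infdist (x + k (\<sigma> m)) (- \<Omega>)) \<longlonglongrightarrow> infdist z (- \<Omega>)" by (intro tendsto_infdist lim)
  moreover have "(\<lambda>m. infdist (x + k (\<sigma> m)) (- \<Omega>)) \<longlonglongrightarrow> 0"
  proof (rule tendsto_sandwich[of "\<lambda>_. 0" _ _ "\<lambda>m. 1 / real (Suc m)"])
    show "\<forall>\<^sub>F m in sequentially. infdist (x + k (\<sigma> m)) (- \<Omega>) \<le> 1 / real (Suc m)"
    proof (intro always_eventually allI)
      fix m
      have "infdist (x + k (\<sigma> m)) (- \<Omega>) \<le> 1 / real (Suc (\<sigma> m))" using k(2)[of "\<sigma> m"] by simp
      also have "\<dots> \<le> 1 / real (Suc m)" using seq_suble[OF \<sigma>(1), of m] by (intro divide_left_mono) auto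
      finally show "infdist (x + k (\<sigma> m)) (- \<Omega>) \<le> 1 / real (Suc m)" .
    qed
    show "(\<lambda>m. 1 / real (Suc m)) \<longlonglongrightarrow> 0" using LIMSEQ_inverse_real_of_nat by (simp add: inverse_eq_divide)
  qed (simp_all add: infdist_nonneg)
  ultimately have "infdist z (- \<Omega>) = 0" by (rule LIMSEQ_unique)
  then have "z \<notin> \<Omega>" using open_infdist_pos[OF \<Omega>, of z] by auto
  then have fr: "z \<in> frontier \<Omega>" using cl \<Omega>(1) by (simp add: frontier_def interior_open)
  have n: "norm (\<nu> z) = 1" "ball (z + R *\<^sub>R \<nu> z) R \<inter> \<Omega> = {}" using tb fr by (auto simp: two_sided_ball_def)
  have "y \<notin> ?N" if y: "y \<in> ball (x + R *\<^sub>R \<nu> z) R" for y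
  proof
    assume yN: "y \<in> ?N"
    have "y + l \<in> ball (z + R *\<^sub>R \<nu> z) R" using y by (simp add: z_def dist_norm algebra_simps)
    moreover have "(\<lambda>m. y + k (\<sigma> m)) \<longlonglongrightarrow> y + l"
      using \<sigma>(2) by (intro tendsto_add tendsto_const) (simp add: o_def)
    ultimately have "\<forall>\<^sub>F m in sequentially. y + k (\<sigma> m) \<in> ball (z + R *\<^sub>R \<nu> z) R"
      by (intro topological_tendstoD) auto
    then obtain m where "y + k (\<sigma> m) \<in> ball (z + R *\<^sub>R \<nu> z) R" by (auto simp: eventually_sequentially)
    then show False using n(2) yN k(1) by auto
  qed
  then show "\<exists>v. norm v = 1 \<and> ball (x + R *\<^sub>R v) R \<inter> ?N = {}" using n(1) by blast
qed

text \<open>The ball around \<open>x\<close> with radius \<open>infdist x (- \<Omega>)\<close> lies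
  in the domain and so misses the exterior ball at \<open>z\<close>; the centres are at least the
  sum of the radii apart. As \<open>z\<close> has exactly these radii as its distances from the
  centres, it lies on the segment joining them.\<close>

lemma nearest_boundary_point:
  fixes \<Omega> :: "'b::euclidean_space set"
  assumes tb: "two_sided_ball R \<Omega> \<nu>" and \<Omega>: "open \<Omega>" "bounded \<Omega>" and x: "x \<in> \<Omega>"
  obtains z where "z \<in> frontier \<Omega>" "x = z - infdist x (- \<Omega>) *\<^sub>R \<nu> z"
proof -
  let ?d = "infdist x (- \<Omega>)"
  have R: "0 < R" using tb by (simp add: two_sided_ball_def)
  have d: "0 < ?d" by (rule open_infdist_pos[OF \<Omega> x])
  have "closed (- \<Omega>)" using \<Omega>(1) by (simp add: closed_Compl)
  then obtain z where z: "z \<in> - \<Omega>" "?d = dist x z"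
    using infdist_attains_inf[of "- \<Omega>" x] bounded_Compl_nonempty[OF \<Omega>(2)] by blast
  have sub: "ball x ?d \<subseteq> \<Omega>"
  proof
    fix y assume "y \<in> ball x ?d"
    then show "y \<in> \<Omega>" using infdist_le[of y "- \<Omega>" x] by (cases "y \<in> \<Omega>") auto
  qed
  have "z \<in> closure (ball x ?d)" using d z(2) by simp
  then have "z \<in> closure \<Omega>" using closure_mono[OF sub] by blast
  then have fr: "z \<in> frontier \<Omega>" using z(1) \<Omega>(1) by (simp add: frontier_def interior_open)
  have n: "norm (\<nu> z) = 1" "ball (z + R *\<^sub>R \<nu> z) R \<inter> \<Omega> = {}" using tb fr by (auto simp: two_sided_ball_def)
  let ?c = "z + R *\<^sub>R \<nu> z"
  have far: "R + ?d \<le> norm (x - ?c)"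
  proof (rule ccontr)
    assume "\<not> ?thesis"
    then have D: "norm (?c - x) < R + ?d" by (simp add: norm_minus_commute)
    \<comment> \<open>The point dividing the segment between the centres in the ratio of the radii
      would lie in both balls.\<close>
    define p where "p = x + (?d / (R + ?d)) *\<^sub>R (?c - x)"
    have s: "0 < R + ?d" using R d by simp
    have "norm (p - x) = ?d / (R + ?d) * norm (?c - x)" using R d by (simp add: p_def)
    also have "\<dots> < ?d / (R + ?d) * (R + ?d)" using D d s by (intro mult_strict_left_mono) auto
    finally have "p \<in> ball x ?d" using s by (simp add: dist_norm norm_minus_commute)
    moreover have "?c - p = (R / (R + ?d)) *\<^sub>R (?c - x)"
    proof -
      have "R / (R + ?d) = 1 - ?d / (R + ?d)" using s by (simp add: field_simps)
      then show ?thesis by (simp add: p_def scaleR_left_diff_distrib del: scaleR_right_diff_distrib)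
    qed
    then have "norm (?c - p) = R / (R + ?d) * norm (?c - x)" using R d by simp
    then have "norm (?c - p) < R / (R + ?d) * (R + ?d)" using D R s by (simp only:, intro mult_strict_left_mono) auto
    then have "p \<in> ball ?c R" using s by (simp add: dist_norm)
    ultimately show False using sub n(2) by blast
  qed
  let ?w = "x - z"
  have w: "norm ?w = ?d" using z(2) by (simp add: dist_norm)
  have nn: "\<nu> z \<bullet> \<nu> z = 1" using n(1) by (simp add: norm_eq_1)
  have ww: "?w \<bullet> ?w = ?d * ?d" using w by (simp add: dot_square_norm power2_eq_square)
  have "(R + ?d)\<^sup>2 \<le> (norm (x - ?c))\<^sup>2" using far R d by (intro power_mono) auto
  also have "x - ?c = ?w - R *\<^sub>R \<nu> z" by (simp add: algebra_simps)
  also have "(norm (?w - R *\<^sub>R \<nu> z))\<^sup>2 = ?d\<^sup>2 - 2 * R * (\<nu> z \<bullet> ?w) + R\<^sup>2"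
    unfolding w[symmetric] power2_norm_eq_inner using nn
    by (simp add: inner_diff_left inner_diff_right inner_commute power2_eq_square algebra_simps)
  finally have "2 * R * ?d \<le> 2 * R * (- (\<nu> z \<bullet> ?w))" by (simp add: power2_eq_square algebra_simps)
  then have a: "?d \<le> - (\<nu> z \<bullet> ?w)" by (rule mult_left_le_imp_le) (use R in simp)
  have "(norm (?w + ?d *\<^sub>R \<nu> z))\<^sup>2 = ?d\<^sup>2 + 2 * ?d * (\<nu> z \<bullet> ?w) + ?d\<^sup>2"
    unfolding power2_norm_eq_inner inner_add_left inner_add_right
    using nn ww by (simp add: inner_commute power2_eq_square)
  also have "\<dots> \<le> 0"
    using mult_left_mono[OF a, of "2 * ?d"] d by (simp add: power2_eq_square)
  finally have "?w + ?d *\<^sub>R \<nu> z = 0" by simp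
  then have "x = z - ?d *\<^sub>R \<nu> z" by (simp add: algebra_simps)
  then show ?thesis using that fr by blast
qed

text \<open>Near the boundary, leaving \<open>\<Omega>\<close> is compared with leaving the half space tangent at the nearest boundary point.\<close>

lemma exit_halfspace_comparison:
  fixes \<Omega> :: "'b::euclidean_space set"
  assumes tb: "two_sided_ball R \<Omega> \<nu>" and \<Omega>: "open \<Omega>" "bounded \<Omega>" and x: "x \<in> \<Omega>"
  obtains v where "norm v = 1"
    "\<And>w. x + w \<notin> \<Omega> \<Longrightarrow> infdist x (- \<Omega>) \<le> norm w"
    "\<And>w. x + w \<notin> \<Omega> \<Longrightarrow> infdist x (- \<Omega>) - 2 * (norm w)\<^sup>2 / R \<le> v \<bullet> w"
    "\<And>w. x + w \<in> \<Omega> \<Longrightarrow> infdist x (- \<Omega>) \<le> norm w \<Longrightarrow> v \<bullet> w \<le> infdist x (- \<Omega>) + 2 * (norm w)\<^sup>2 / R"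
proof -
  let ?d = "infdist x (- \<Omega>)"
  have R: "0 < R" using tb by (simp add: two_sided_ball_def)
  have d: "0 < ?d" by (rule open_infdist_pos[OF \<Omega> x])
  obtain z where z: "z \<in> frontier \<Omega>" "x = z - ?d *\<^sub>R \<nu> z"
    by (rule nearest_boundary_point[OF tb \<Omega> x]) (rule that)
  have n: "norm (\<nu> z) = 1" using tb z by (auto simp: two_sided_ball_def)
  then have nn: "\<nu> z \<bullet> \<nu> z = 1" by (simp add: norm_eq_1)
  have yz: "x + w - z = w - ?d *\<^sub>R \<nu> z" for w by (subst z(2)) simp
  have iyz: "\<nu> z \<bullet> (x + w - z) = \<nu> z \<bullet> w - ?d" for w unfolding yz using nn by (simp add: inner_diff_right)
  \<comment> \<open>As \<open>x\<close> is at distance \<open>?d \<le> norm w\<close> from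
    \<open>z\<close>, the point \<open>x + w\<close> is within \<open>2 * norm w\<close> of
    \<open>z\<close>.\<close>
  have sq: "(norm (x + w - z))\<^sup>2 \<le> 4 * (norm w)\<^sup>2" if "?d \<le> norm w" for w
  proof -
    have "norm (x + w - z) \<le> norm w + ?d"
      unfolding yz using norm_triangle_ineq4[of w "?d *\<^sub>R \<nu> z"] n d by simp
    then have "(norm (x + w - z))\<^sup>2 \<le> (2 * norm w)\<^sup>2" using that by (intro power_mono) auto
    then show ?thesis by (simp add: power_mult_distrib)
  qed
  have le: "?d \<le> norm w" if "x + w \<notin> \<Omega>" for w
    using infdist_le[of "x + w" "- \<Omega>" x] that by (simp add: dist_norm)
  show ?thesis
  proof (rule that[of "\<nu> z"])
    show "?d \<le> norm w" if "x + w \<notin> \<Omega>" for w by (rule le[OF that])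
    show "?d - 2 * (norm w)\<^sup>2 / R \<le> \<nu> z \<bullet> w" if y: "x + w \<notin> \<Omega>" for w
    proof -
      have "- (4 * (norm w)\<^sup>2) \<le> 2 * R * (\<nu> z \<bullet> w - ?d)"
        using two_sided_ball_inside[OF tb z(1) y] sq[OF le[OF y]] unfolding iyz by linarith
      then have "- (2 * (norm w)\<^sup>2) \<le> R * (\<nu> z \<bullet> w - ?d)" by (simp add: algebra_simps)
      then have "- (2 * (norm w)\<^sup>2) / R \<le> \<nu> z \<bullet> w - ?d" using R
        by (subst pos_divide_le_eq) (simp_all add: mult.commute)
      then show ?thesis by simp
    qed
    show "\<nu> z \<bullet> w \<le> ?d + 2 * (norm w)\<^sup>2 / R" if y: "x + w \<in> \<Omega>" "?d \<le> norm w" for w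
    proof -
      have "2 * R * (\<nu> z \<bullet> w - ?d) \<le> 4 * (norm w)\<^sup>2"
        using two_sided_ball_outside[OF tb z(1) y(1)] sq[OF y(2)] unfolding iyz by linarith
      then have "R * (\<nu> z \<bullet> w - ?d) \<le> 2 * (norm w)\<^sup>2" by (simp add: algebra_simps)
      then have "\<nu> z \<bullet> w - ?d \<le> 2 * (norm w)\<^sup>2 / R" using R by (simp add: pos_le_divide_eq mult.commute)
      then show ?thesis by simp
    qed
  qed (rule n)
qed

section \<open>Exit observed at countably many times\<close>

lemma less_exit_time_iff:
  fixes f :: "real \<Rightarrow> 'b::topological_space"
  assumes "open \<Omega>" "0 \<le> t" and rc: "(f \<longlongrightarrow> f t) (at_right t)"
  shows "ereal t < exit_time \<Omega> f \<longleftrightarrow> (\<forall>s\<in>{0..t}. f s \<in> \<Omega>)"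
proof
  assume *: "ereal t < exit_time \<Omega> f"
  show "\<forall>s\<in>{0..t}. f s \<in> \<Omega>"
  proof (rule ccontr)
    assume "\<not> ?thesis"
    then obtain s where s: "s \<in> {0..t}" "f s \<notin> \<Omega>" by blast
    then have "exit_time \<Omega> f \<le> ereal s" unfolding exit_time_def by (intro Inf_lower) auto
    also have "\<dots> \<le> ereal t" using s by simp
    finally show False using * by simp
  qed
next
  assume *: "\<forall>s\<in>{0..t}. f s \<in> \<Omega>"
  then have "f t \<in> \<Omega>" using assms(2) by simp
  then have "\<forall>\<^sub>F s in at_right t. f s \<in> \<Omega>" using rc assms(1) by (intro topological_tendstoD)
  then obtain b where b: "t < b" "\<And>s. t < s \<Longrightarrow> s < b \<Longrightarrow> f s \<in> \<Omega>" unfolding eventually_at_right_field by blast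
  have "ereal b \<le> exit_time \<Omega> f"
    unfolding exit_time_def
  proof (rule Inf_greatest)
    fix y assume "y \<in> ereal ` {s. 0 \<le> s \<and> f s \<notin> \<Omega>}"
    then obtain s where s: "0 \<le> s" "f s \<notin> \<Omega>" "y = ereal s" by auto
    then have "\<not> s \<le> t" using * by auto
    then show "ereal b \<le> y" using s b(2)[of s] by force
  qed
  then show "ereal t < exit_time \<Omega> f" using b(1) less_le_trans[of "ereal t" "ereal b"] by simp
qed

text \<open>The endpoint \<open>t\<close> is added because every other time is approached from the
  right within the interval.\<close>

definition rational_times :: "real \<Rightarrow> real set" where
  "rational_times t = insert 0 (insert t (\<rat> \<inter> {0..t}))"

lemma rational_times: "countable (rational_times t)" "0 \<le> t \<Longrightarrow> rational_times t \<subseteq> {0..t}"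
    "0 \<in> rational_times t"
  by (auto simp: rational_times_def countable_rat)

lemma rational_times_dense:
  fixes f :: "real \<Rightarrow> 'b::t2_space"
  assumes rc: "(f \<longlongrightarrow> f s) (at_right s)" and s: "s \<in> {0..t}"
    and C: "closed C" "\<And>r. r \<in> rational_times t \<Longrightarrow> f r \<in> C"
  shows "f s \<in> C"
proof (rule ccontr)
  assume no: "f s \<notin> C"
  then have "s \<noteq> t" using C(2) by (auto simp: rational_times_def)
  then have st: "s < t" using s by simp
  have "\<forall>\<^sub>F r in at_right s. f r \<in> - C" using rc no C(1) by (intro topological_tendstoD) (auto simp: open_Compl)
  then obtain b where b: "s < b" "\<And>r. s < r \<Longrightarrow> r < b \<Longrightarrow> f r \<notin> C" unfolding eventually_at_right_field by auto
  obtain q where q: "q \<in> \<rat>" "s < q" "q < min b t" using Rats_dense_in_real[of s "min b t"] b st by auto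
  then have "q \<in> rational_times t" using s by (auto simp: rational_times_def)
  then show False using b(2)[of q] C(2)[of q] q by auto
qed

section \<open>Exit probabilities\<close>

lemma borel_measurable_completion_cong_AE:
  fixes f g :: "'a \<Rightarrow> 'b::topological_space"
  assumes g: "g \<in> borel_measurable (completion M)" and ae: "AE x in M. f x = g x"
  shows "f \<in> borel_measurable (completion M)"
proof (rule measurableI)
  fix B :: "'b set" assume B: "B \<in> sets borel"
  show "f -` B \<inter> space (completion M) \<in> sets (completion M)"
  proof (rule completion.in_sets_AE)
    show "g -` B \<inter> space (completion M) \<in> sets (completion M)" by (rule measurable_sets[OF g B])
    show "AE x in completion M. x \<in> g -` B \<inter> space (completion M) \<longleftrightarrow> x \<in> f -` B \<inter> space (completion M)"
      using AE_completion[OF ae] by eventually_elim auto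
  qed simp
qed simp

lemma pred_countable_Ball:
  assumes "countable T" "\<And>i. i \<in> T \<Longrightarrow> Measurable.pred N (P i)"
  shows "Measurable.pred N (\<lambda>x. \<forall>i\<in>T. P i x)"
proof (cases "T = {}")
  case False
  have "{x \<in> space N. \<forall>i\<in>T. P i x} = (\<Inter>i\<in>T. {x \<in> space N. P i x})" using False by auto
  also have "\<dots> \<in> sets N" using assms False by (intro sets.countable_INT') (auto simp: pred_def)
  finally show ?thesis by (simp add: pred_def)
qed simp

text \<open>Tonelli for the set of pairs with first component in \<open>S\<close> that satisfy
  \<open>Q\<close>. The passage between real and extended values is safe because \<open>S\<close>
  has finite measure.\<close>

lemma (in prob_space) integral_prob_swap:
  fixes S :: "'b::euclidean_space set"
  assumes S: "S \<in> sets borel" "emeasure lborel S < \<infinity>"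
    and Q: "Measurable.pred (lborel \<Otimes>\<^sub>M M) (\<lambda>z. Q (fst z) (snd z))"
  shows "(LINT x:S|lborel. prob {\<omega> \<in> space M. Q x \<omega>}) = (LINT \<omega>|M. measure lborel {x \<in> S. Q x \<omega>})"
    and "(\<lambda>x. prob {\<omega> \<in> space M. Q x \<omega>}) \<in> borel_measurable borel"
    and "(\<lambda>\<omega>. measure lborel {x \<in> S. Q x \<omega>}) \<in> borel_measurable M"
proof -
  interpret P: pair_sigma_finite lborel M ..
  let ?Q = "{z \<in> space (lborel \<Otimes>\<^sub>M M). Q (fst z) (snd z)}"
  let ?W = "{z \<in> space (lborel \<Otimes>\<^sub>M M). fst z \<in> S \<and> Q (fst z) (snd z)}"
  have Qs: "?Q \<in> sets (lborel \<Otimes>\<^sub>M M)" using Q by measurable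
  have Ws: "?W \<in> sets (lborel \<Otimes>\<^sub>M M)"
  proof -
    have "?W = ?Q \<inter> (S \<times> space M)" by (auto simp: space_pair_measure)
    then show ?thesis using Qs S(1) by auto
  qed
  have sQ: "Pair x -` ?Q = {\<omega> \<in> space M. Q x \<omega>}" for x by (auto simp: space_pair_measure)
  have sW: "Pair x -` ?W = (if x \<in> S then {\<omega> \<in> space M. Q x \<omega>} else {})" for x by (auto simp: space_pair_measure)
  have tW: "(\<lambda>x. (x, \<omega>)) -` ?W = (if \<omega> \<in> space M then {x \<in> S. Q x \<omega>} else {})" for \<omega>
    by (auto simp: space_pair_measure)
  have m1: "(\<lambda>x. emeasure M {\<omega> \<in> space M. Q x \<omega>}) \<in> borel_measurable lborel"
    using measurable_emeasure_Pair[OF Qs] unfolding sQ .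
  then have "(\<lambda>x. enn2real (emeasure M {\<omega> \<in> space M. Q x \<omega>})) \<in> borel_measurable borel" by simp
  then show mp: "(\<lambda>x. prob {\<omega> \<in> space M. Q x \<omega>}) \<in> borel_measurable borel" by (simp add: measure_def)
  have "(\<lambda>\<omega>. emeasure lborel ((\<lambda>x. (x, \<omega>)) -` ?W)) \<in> borel_measurable M"
    by (rule P.measurable_emeasure_Pair2[OF Ws])
  then have m2: "(\<lambda>\<omega>. emeasure lborel {x \<in> S. Q x \<omega>}) \<in> borel_measurable M"
    by (rule measurable_cong[THEN iffD1, rotated]) (simp only: tW if_True)
  then have "(\<lambda>\<omega>. enn2real (emeasure lborel {x \<in> S. Q x \<omega>})) \<in> borel_measurable M" by simp
  then show mm: "(\<lambda>\<omega>. measure lborel {x \<in> S. Q x \<omega>}) \<in> borel_measurable M" by (simp add: measure_def)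
  have sl: "{x \<in> S. Q x \<omega>} \<in> sets lborel" if "\<omega> \<in> space M" for \<omega>
    using sets_Pair2[OF Ws, of \<omega>] that unfolding tW by simp
  have fin: "emeasure lborel {x \<in> S. Q x \<omega>} = ennreal (measure lborel {x \<in> S. Q x \<omega>})" for \<omega>
  proof (cases "{x \<in> S. Q x \<omega>} \<in> sets lborel")
    case True
    have "emeasure lborel {x \<in> S. Q x \<omega>} \<le> emeasure lborel S" using S(1) by (intro emeasure_mono) auto
    then have "emeasure lborel {x \<in> S. Q x \<omega>} < \<infinity>" using S(2) by simp
    then show ?thesis by (intro emeasure_eq_ennreal_measure) (simp add: less_top)
  qed (simp add: emeasure_notin_sets measure_notin_sets)
  have "(LINT x:S|lborel. prob {\<omega> \<in> space M. Q x \<omega>}) = enn2real (\<integral>\<^sup>+ x. ennreal (indicator S x * prob {\<omega> \<in> space M. Q x \<omega>}) \<partial>lborel)"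
    unfolding set_lebesgue_integral_def using mp S(1) by (subst integral_eq_nn_integral) auto
  also have "(\<integral>\<^sup>+ x. ennreal (indicator S x * prob {\<omega> \<in> space M. Q x \<omega>}) \<partial>lborel) = (\<integral>\<^sup>+ x. emeasure M (Pair x -` ?W) \<partial>lborel)"
    unfolding sW by (intro nn_integral_cong) (auto simp: emeasure_eq_measure)
  also have "\<dots> = emeasure (lborel \<Otimes>\<^sub>M M) ?W" using emeasure_pair_measure_alt[OF Ws] by simp
  also have "\<dots> = (\<integral>\<^sup>+ \<omega>. emeasure lborel ((\<lambda>x. (x, \<omega>)) -` ?W) \<partial>M)" by (rule P.emeasure_pair_measure_alt2[OF Ws])
  also have "\<dots> = (\<integral>\<^sup>+ \<omega>. ennreal (measure lborel {x \<in> S. Q x \<omega>}) \<partial>M)"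
    unfolding tW by (intro nn_integral_cong) (simp add: fin)
  also have "enn2real \<dots> = (LINT \<omega>|M. measure lborel {x \<in> S. Q x \<omega>})"
    using mm by (subst integral_eq_nn_integral) auto
  finally show "(LINT x:S|lborel. prob {\<omega> \<in> space M. Q x \<omega>}) = (LINT \<omega>|M. measure lborel {x \<in> S. Q x \<omega>})" .
qed

lemma tube_volume_measurable [measurable]:
  fixes \<Omega> :: "'b::euclidean_space set"
  assumes "open \<Omega>" "bounded \<Omega>"
  shows "tube_volume \<Omega> \<in> borel_measurable borel"
proof (rule borel_measurable_mono, rule monoI)
  fix r s :: real assume "r \<le> s"
  then have sub: "inner_tube \<Omega> r \<subseteq> inner_tube \<Omega> s" by (auto simp: inner_tube_def)
  have "bounded (inner_tube \<Omega> s)" by (rule bounded_subset[OF assms(2)]) (auto simp: inner_tube_def)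
  then show "tube_volume \<Omega> r \<le> tube_volume \<Omega> s"
    unfolding tube_volume_def using inner_tube_borel[OF assms(1)] emeasure_bounded_finite[of "inner_tube \<Omega> s"]
    by (intro measure_mono_fmeasurable[OF sub] fmeasurableI) auto
qed

text \<open>At each point \<open>g (S k * z) / S k\<close> tends to \<open>P * max z 0\<close>,
  dominated by \<open>C * \<bar>z\<bar>\<close>. In the second claim the growing cutoff makes the
  integrand vanish eventually at each point, so a first moment of \<open>Z\<close> suffices there
  too.\<close>

lemma (in prob_space) integral_tube_volume_tendsto:
  fixes g :: "real \<Rightarrow> real"
  assumes [measurable]: "g \<in> borel_measurable borel" and g0: "\<And>s. 0 \<le> g s"
    and gC: "\<And>s. g s \<le> C * max s 0" "0 \<le> C"
    and lim: "\<And>\<epsilon>. 0 < \<epsilon> \<Longrightarrow> \<exists>s0>0. \<forall>s. 0 < s \<longrightarrow> s < s0 \<longrightarrow> \<bar>g s - P * s\<bar> \<le> \<epsilon> * s"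
    and Z: "integrable M Z" and S: "\<And>k. 0 < S k" "S \<longlonglongrightarrow> 0"
  shows "(\<lambda>k. (LINT \<omega>|M. g (S k * Z \<omega>)) / S k) \<longlonglongrightarrow> P * (LINT \<omega>|M. max (Z \<omega>) 0)"
    and "filterlim A at_top sequentially \<Longrightarrow>
      (\<lambda>k. (LINT \<omega>|M. (if A k \<le> Z \<omega> then g (S k * Z \<omega>) else 0)) / S k) \<longlonglongrightarrow> 0"
proof -
  have [measurable]: "Z \<in> borel_measurable M" using Z by auto
  have bound: "\<bar>g (S k * z) / S k\<bar> \<le> C * \<bar>z\<bar>" for k z
  proof -
    have "g (S k * z) \<le> C * (S k * max z 0)" using gC(1)[of "S k * z"] S(1)[of k] by (simp add: max_mult_distrib_left)
    also have "\<dots> \<le> C * (S k * \<bar>z\<bar>)" using gC(2) S(1)[of k] by (intro mult_left_mono) auto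
    finally have "g (S k * z) / S k \<le> C * \<bar>z\<bar>" using S(1)[of k] by (simp add: pos_divide_le_eq mult_ac)
    then show ?thesis using g0[of "S k * z"] S(1)[of k] by simp
  qed
  have ptw: "(\<lambda>k. g (S k * z) / S k) \<longlonglongrightarrow> P * max z 0" for z
  proof (cases "0 < z")
    case True
    show ?thesis
    proof (rule LIMSEQ_I)
      fix e :: real assume e: "0 < e"
      obtain s0 where s0: "0 < s0" "\<And>s. 0 < s \<Longrightarrow> s < s0 \<Longrightarrow> \<bar>g s - P * s\<bar> \<le> (e / (2 * z)) * s"
        using lim[of "e / (2 * z)"] e True by auto
      have "\<forall>\<^sub>F k in sequentially. S k < s0 / z" using S(2) s0(1) True by (intro order_tendstoD(2)) auto
      then obtain k0 where k0: "\<And>k. k \<ge> k0 \<Longrightarrow> S k < s0 / z" by (auto simp: eventually_sequentially)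
      have "norm (g (S k * z) / S k - P * max z 0) < e" if "k \<ge> k0" for k
      proof -
        have sk: "0 < S k" by (rule S(1))
        have "\<bar>g (S k * z) - P * (S k * z)\<bar> \<le> (e / (2 * z)) * (S k * z)"
          using s0(2)[of "S k * z"] k0[OF that] True sk by (simp add: pos_less_divide_eq)
        also have "\<dots> = e / 2 * S k" using True by simp
        finally have "\<bar>g (S k * z) - P * (S k * z)\<bar> / S k \<le> e / 2" using sk by (simp add: pos_divide_le_eq)
        moreover have "g (S k * z) / S k - P * z = (g (S k * z) - P * (S k * z)) / S k"
          using sk by (simp add: field_simps)
        ultimately have "\<bar>g (S k * z) / S k - P * z\<bar> \<le> e / 2" using sk by (simp add: abs_divide)
        then show ?thesis using e True by simp
      qed
      then show "\<exists>no. \<forall>n\<ge>no. norm (g (S n * z) / S n - P * max z 0) < e" by blast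
    qed
  next
    case False
    have "g (S k * z) = 0" for k
    proof -
      have "S k * z \<le> 0" using False S(1)[of k] by (simp add: mult_nonneg_nonpos)
      then show ?thesis using gC(1)[of "S k * z"] g0[of "S k * z"] by simp
    qed
    then show ?thesis using False by simp
  qed
  have "(\<lambda>k. LINT \<omega>|M. g (S k * Z \<omega>) / S k) \<longlonglongrightarrow> (LINT \<omega>|M. P * max (Z \<omega>) 0)"
  proof (rule integral_dominated_convergence[where w = "\<lambda>\<omega>. C * \<bar>Z \<omega>\<bar>"])
    show "integrable M (\<lambda>\<omega>. C * \<bar>Z \<omega>\<bar>)" using Z by auto
  qed (use ptw bound in auto)
  then show "(\<lambda>k. (LINT \<omega>|M. g (S k * Z \<omega>)) / S k) \<longlonglongrightarrow> P * (LINT \<omega>|M. max (Z \<omega>) 0)" by simp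
  assume A: "filterlim A at_top sequentially"
  have "(\<lambda>k. LINT \<omega>|M. (if A k \<le> Z \<omega> then g (S k * Z \<omega>) else 0) / S k) \<longlonglongrightarrow> (LINT \<omega>|M. 0)"
  proof (rule integral_dominated_convergence[where w = "\<lambda>\<omega>. C * \<bar>Z \<omega>\<bar>"])
    show "integrable M (\<lambda>\<omega>. C * \<bar>Z \<omega>\<bar>)" using Z by auto
    show "AE \<omega> in M. (\<lambda>k. (if A k \<le> Z \<omega> then g (S k * Z \<omega>) else 0) / S k) \<longlonglongrightarrow> 0"
    proof (intro AE_I2 tendsto_eventually)
      fix \<omega>
      have "\<forall>\<^sub>F k in sequentially. Z \<omega> < A k" using A by (simp add: filterlim_at_top_dense)
      then show "\<forall>\<^sub>F k in sequentially. (if A k \<le> Z \<omega> then g (S k * Z \<omega>) else 0) / S k = 0"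
        by eventually_elim simp
    qed
    show "AE \<omega> in M. norm ((if A k \<le> Z \<omega> then g (S k * Z \<omega>) else 0) / S k) \<le> C * \<bar>Z \<omega>\<bar>" for k
      using bound gC(2) by (intro AE_I2) auto
  qed auto
  then show "(\<lambda>k. (LINT \<omega>|M. (if A k \<le> Z \<omega> then g (S k * Z \<omega>) else 0)) / S k) \<longlonglongrightarrow> 0" by simp
qed

context stable_subordination
begin

text \<open>This event and \<open>stays_in\<close> enclose survival from inside and from outside
  while referring to countably many times. A uniform positive distance from the complement passes to
  right limits, whereas membership in an open set does not.\<close>

definition stays_inside :: "(real^'n) set \<Rightarrow> real \<Rightarrow> real^'n \<Rightarrow> 'w set" where
  "stays_inside \<Omega> t x = {\<omega> \<in> space M. \<exists>m::nat. \<forall>s\<in>rational_times t. 1 / real (Suc m) \<le> infdist (x + X s \<omega>) (- \<Omega>)}"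

definition stays_in :: "(real^'n) set \<Rightarrow> real \<Rightarrow> real^'n \<Rightarrow> 'w set" where
  "stays_in \<Omega> t x = {\<omega> \<in> space M. \<forall>s\<in>rational_times t. x + X s \<omega> \<in> \<Omega>}"

lemma rational_times_nonneg: "0 \<le> t \<Longrightarrow> s \<in> rational_times t \<Longrightarrow> 0 \<le> s"
  using rational_times(2) by force

lemma stays_preds:
  assumes "0 \<le> t" "open \<Omega>"
  shows "Measurable.pred (lborel \<Otimes>\<^sub>M M) (\<lambda>z. \<exists>m::nat. \<forall>s\<in>rational_times t. 1 / real (Suc m) \<le> infdist (fst z + X s (snd z)) (- \<Omega>))"
    and "Measurable.pred (lborel \<Otimes>\<^sub>M M) (\<lambda>z. \<forall>s\<in>rational_times t. fst z + X s (snd z) \<in> \<Omega>)"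
proof -
  have inf: "(\<lambda>y. infdist y (- \<Omega>)) \<in> borel_measurable borel"
    by (intro borel_measurable_continuous_onI continuous_intros)
  have m: "(\<lambda>z. fst z + X s (snd z)) \<in> borel_measurable (lborel \<Otimes>\<^sub>M M)" if "s \<in> rational_times t" for s
  proof -
    have [measurable]: "X s \<in> borel_measurable M" using X_meas rational_times_nonneg[OF assms(1) that] .
    show ?thesis by measurable
  qed
  have "Measurable.pred (lborel \<Otimes>\<^sub>M M) (\<lambda>z. 1 / real (Suc k) \<le> infdist (fst z + X s (snd z)) (- \<Omega>))"
    if "s \<in> rational_times t" for s and k :: nat
  proof -
    have "(\<lambda>z. infdist (fst z + X s (snd z)) (- \<Omega>)) \<in> borel_measurable (lborel \<Otimes>\<^sub>M M)"
      by (rule measurable_compose[OF m[OF that] inf])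
    then show ?thesis unfolding pred_def by (rule borel_measurable_le[OF borel_measurable_const])
  qed
  then show "Measurable.pred (lborel \<Otimes>\<^sub>M M) (\<lambda>z. \<exists>m::nat. \<forall>s\<in>rational_times t. 1 / real (Suc m) \<le> infdist (fst z + X s (snd z)) (- \<Omega>))"
    by (intro pred_intros_countable(2) pred_countable_Ball rational_times(1))
  have "Measurable.pred (lborel \<Otimes>\<^sub>M M) (\<lambda>z. fst z + X s (snd z) \<in> \<Omega>)" if "s \<in> rational_times t" for s
    using m[OF that] assms(2) by (intro pred_sets2[where N = borel]) auto
  then show "Measurable.pred (lborel \<Otimes>\<^sub>M M) (\<lambda>z. \<forall>s\<in>rational_times t. fst z + X s (snd z) \<in> \<Omega>)"
    by (intro pred_countable_Ball rational_times(1))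
qed

lemma stays_events:
  assumes "0 \<le> t" "open \<Omega>"
  shows "stays_inside \<Omega> t x \<in> sets M" "stays_in \<Omega> t x \<in> sets M"
proof -
  have p: "(\<lambda>\<omega>. (x, \<omega>)) \<in> measurable M (lborel \<Otimes>\<^sub>M M)" by simp
  show "stays_inside \<Omega> t x \<in> sets M"
    using measurable_compose[OF p stays_preds(1)[OF assms]] unfolding stays_inside_def pred_def by simp
  show "stays_in \<Omega> t x \<in> sets M"
    using measurable_compose[OF p stays_preds(2)[OF assms]] unfolding stays_in_def pred_def by simp
qed

lemma survival_between:
  assumes t: "0 \<le> t" and \<Omega>: "open \<Omega>" "bounded \<Omega>" and \<omega>: "\<omega> \<in> space M"
  shows "\<omega> \<in> stays_inside \<Omega> t x \<Longrightarrow> ereal t < exit_time \<Omega> (\<lambda>s. x + X s \<omega>)"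
    and "ereal t < exit_time \<Omega> (\<lambda>s. x + X s \<omega>) \<Longrightarrow> \<omega> \<in> stays_in \<Omega> t x"
proof -
  have rc: "((\<lambda>r. x + X r \<omega>) \<longlongrightarrow> x + X s \<omega>) (at_right s)" if "0 \<le> s" for s
    by (intro tendsto_add tendsto_const X_right_continuous that)
  have iff: "ereal t < exit_time \<Omega> (\<lambda>s. x + X s \<omega>) \<longleftrightarrow> (\<forall>s\<in>{0..t}. x + X s \<omega> \<in> \<Omega>)"
    by (rule less_exit_time_iff[OF \<Omega>(1) t rc[OF t]])
  show "ereal t < exit_time \<Omega> (\<lambda>s. x + X s \<omega>)" if in1: "\<omega> \<in> stays_inside \<Omega> t x"
    unfolding iff
  proof
    fix s assume s: "s \<in> {0..t}"
    obtain m :: nat where m: "\<And>r. r \<in> rational_times t \<Longrightarrow> 1 / real (Suc m) \<le> infdist (x + X r \<omega>) (- \<Omega>)"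
      using in1 by (auto simp: stays_inside_def)
    have "x + X s \<omega> \<in> {y. 1 / real (Suc m) \<le> infdist y (- \<Omega>)}"
    proof (rule rational_times_dense[of "\<lambda>r. x + X r \<omega>" s t])
      show "closed {y. 1 / real (Suc m) \<le> infdist y (- \<Omega>)}" by (intro closed_Collect_le continuous_intros)
    qed (use s rc m in auto)
    then have "1 / real (Suc m) \<le> infdist (x + X s \<omega>) (- \<Omega>)" by simp
    moreover have "0 < 1 / real (Suc m)" by simp
    ultimately have "0 < infdist (x + X s \<omega>) (- \<Omega>)" by linarith
    then show "x + X s \<omega> \<in> \<Omega>" using infdist_zero[of "x + X s \<omega>" "- \<Omega>"] by (cases "x + X s \<omega> \<in> \<Omega>") auto
  qed
  show "\<omega> \<in> stays_in \<Omega> t x" if "ereal t < exit_time \<Omega> (\<lambda>s. x + X s \<omega>)"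
    using that \<omega> rational_times(2)[OF t] unfolding iff stays_in_def by auto
qed

text \<open>For a fixed path the exceptional starting points are null by
  \<open>grazing_translates_null\<close>. Joint measurability on the product space then allows the
  two almost-everywhere quantifiers to be exchanged.\<close>

lemma AE_stays_inside:
  assumes tb: "two_sided_ball R \<Omega> \<nu>" and \<Omega>: "open \<Omega>" "bounded \<Omega>" and t: "0 \<le> t"
  shows "AE x in lborel. AE \<omega> in M. \<omega> \<in> stays_in \<Omega> t x \<longrightarrow> \<omega> \<in> stays_inside \<Omega> t x"
proof -
  interpret P: pair_sigma_finite lborel M ..
  let ?Q1 = "\<lambda>x \<omega>. \<exists>m::nat. \<forall>s\<in>rational_times t. 1 / real (Suc m) \<le> infdist (x + X s \<omega>) (- \<Omega>)"
  let ?Q2 = "\<lambda>x \<omega>. \<forall>s\<in>rational_times t. x + X s \<omega> \<in> \<Omega>"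
  have "Measurable.pred (lborel \<Otimes>\<^sub>M M) (\<lambda>z. ?Q2 (fst z) (snd z) \<longrightarrow> ?Q1 (fst z) (snd z))"
    by (intro pred_intros_logic(4) stays_preds[OF t \<Omega>(1)])
  then have m: "{z \<in> space (lborel \<Otimes>\<^sub>M M). ?Q2 (fst z) (snd z) \<longrightarrow> ?Q1 (fst z) (snd z)} \<in> sets (lborel \<Otimes>\<^sub>M M)"
    by (simp add: pred_def)
  have "AE x in lborel. ?Q2 x \<omega> \<longrightarrow> ?Q1 x \<omega>" for \<omega>
  proof -
    let ?K = "(\<lambda>s. X s \<omega>) ` rational_times t"
    have K: "bounded ?K" "?K \<noteq> {}"
    proof -
      obtain B where "\<forall>s\<in>{0..t}. norm (X s \<omega>) \<le> B" using X_bounded by blast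
      then show "bounded ?K" using rational_times(2)[OF t] by (auto simp: bounded_iff)
      show "?K \<noteq> {}" using rational_times(3) by blast
    qed
    obtain N' where N': "N' \<in> null_sets lborel"
      "{x. (\<forall>k\<in>?K. x + k \<in> \<Omega>) \<and> \<not> (\<exists>m::nat. \<forall>k\<in>?K. 1 / real (Suc m) \<le> infdist (x + k) (- \<Omega>))} \<subseteq> N'"
      using grazing_translates_null[OF tb \<Omega> K] by blast
    show ?thesis
    proof (rule AE_I'[OF N'(1)])
      show "{x \<in> space lborel. \<not> (?Q2 x \<omega> \<longrightarrow> ?Q1 x \<omega>)} \<subseteq> N'" using N'(2) by auto
    qed
  qed
  then have "AE \<omega> in M. AE x in lborel. ?Q2 x \<omega> \<longrightarrow> ?Q1 x \<omega>" by simp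
  then have "AE x in lborel. AE \<omega> in M. ?Q2 x \<omega> \<longrightarrow> ?Q1 x \<omega>"
    using P.AE_commute[OF m] by simp
  then show ?thesis by eventually_elim (simp add: stays_in_def stays_inside_def)
qed

text \<open>Survival agrees almost surely with two events of equal probability between which it
  lies. It is therefore measurable in the completion, with that probability, although it need not be
  an event of \<open>M\<close>.\<close>

lemma survival_prob_eq:
  assumes tb: "two_sided_ball R \<Omega> \<nu>" and \<Omega>: "open \<Omega>" "bounded \<Omega>" and t: "0 \<le> t"
  shows "AE x in lborel. survival_prob M (time_change Y U) \<Omega> x t = prob (stays_inside \<Omega> t x) \<and>
      prob (stays_in \<Omega> t x) = prob (stays_inside \<Omega> t x)"
  using AE_stays_inside[OF assms]
proof eventually_elim
  case (elim x)
  let ?A = "{\<omega> \<in> space M. exit_time \<Omega> (\<lambda>s. x + time_change Y U s \<omega>) > ereal t}"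
  note ev = stays_events[OF t \<Omega>(1), of x]
  have ae: "AE \<omega> in M. \<omega> \<in> stays_inside \<Omega> t x \<longleftrightarrow> \<omega> \<in> ?A"
    using elim X_eq_time_change AE_space
  proof eventually_elim
    case (elim \<omega>)
    then have "(\<lambda>s. x + time_change Y U s \<omega>) = (\<lambda>s. x + X s \<omega>)" by simp
    then show ?case using elim survival_between[OF t \<Omega>, of \<omega> x] by auto
  qed
  have A: "?A \<in> sets (completion M)"
    by (rule completion.in_sets_AE[where A = "stays_inside \<Omega> t x"])
       (use AE_completion[OF ae] ev in auto)
  have "measure (completion M) (stays_inside \<Omega> t x) = measure (completion M) ?A"
    by (rule measure_eq_AE[OF AE_completion[OF ae]]) (use A ev in auto)
  then have "survival_prob M (time_change Y U) \<Omega> x t = prob (stays_inside \<Omega> t x)"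
    using ev by (simp add: survival_prob_def)
  moreover have "prob (stays_in \<Omega> t x) = prob (stays_inside \<Omega> t x)"
  proof (rule finite_measure_eq_AE)
    show "AE \<omega> in M. \<omega> \<in> stays_in \<Omega> t x \<longleftrightarrow> \<omega> \<in> stays_inside \<Omega> t x"
      using elim AE_space by eventually_elim (use survival_between[OF t \<Omega>] in blast)
  qed (use ev in auto)
  ultimately show ?case by blast
qed

lemma prob_stays_inside_meas:
  assumes "0 \<le> t" "open \<Omega>"
  shows "(\<lambda>x. prob (stays_inside \<Omega> t x)) \<in> borel_measurable borel"
  unfolding stays_inside_def
  by (rule integral_prob_swap(2)[where S = "{}", OF _ _ stays_preds(1)[OF assms]]) auto

lemma heat_content_deficit:
  assumes tb: "two_sided_ball R \<Omega> \<nu>" and \<Omega>: "open \<Omega>" "bounded \<Omega>" and t: "0 \<le> t"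
  shows "measure lebesgue \<Omega> - spectral_heat_content M (time_change Y U) \<Omega> t
    = (LINT x:\<Omega>|lborel. 1 - prob (stays_inside \<Omega> t x))"
proof -
  let ?p = "\<lambda>x. prob (stays_inside \<Omega> t x)" and ?s = "\<lambda>x. survival_prob M (time_change Y U) \<Omega> x t"
  have pm [measurable]: "?p \<in> borel_measurable borel" by (rule prob_stays_inside_meas[OF t \<Omega>(1)])
  have \<Omega>m [measurable]: "\<Omega> \<in> sets borel" using \<Omega> by simp
  have fin: "emeasure lborel \<Omega> < \<infinity>" by (rule emeasure_bounded_finite[OF \<Omega>(2)])
  have f: "(\<lambda>x. indicator \<Omega> x *\<^sub>R ?p x) \<in> borel_measurable lborel" by measurable
  have ae: "AE x in lborel. indicator \<Omega> x *\<^sub>R ?s x = indicator \<Omega> x *\<^sub>R ?p x"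
    using survival_prob_eq[OF assms] by eventually_elim simp
  have "spectral_heat_content M (time_change Y U) \<Omega> t = (LINT x|lebesgue. indicator \<Omega> x *\<^sub>R ?s x)"
    by (simp add: spectral_heat_content_def set_lebesgue_integral_def)
  also have "\<dots> = (LINT x|lebesgue. indicator \<Omega> x *\<^sub>R ?p x)"
  proof (rule integral_cong_AE)
    show "(\<lambda>x. indicator \<Omega> x *\<^sub>R ?p x) \<in> borel_measurable lebesgue" by (rule measurable_completion[OF f])
    then show "(\<lambda>x. indicator \<Omega> x *\<^sub>R ?s x) \<in> borel_measurable lebesgue"
      by (rule borel_measurable_completion_cong_AE) (rule ae)
  qed (rule AE_completion[OF ae])
  also have "\<dots> = (LINT x:\<Omega>|lborel. ?p x)"
    using integral_completion[OF f] by (simp add: set_lebesgue_integral_def)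
  finally have q: "spectral_heat_content M (time_change Y U) \<Omega> t = (LINT x:\<Omega>|lborel. ?p x)" .
  have i1: "set_integrable lborel \<Omega> ?p"
    unfolding set_integrable_def
    by (rule integrableI_bounded_set[where A = \<Omega> and B = 1]) (use fin in \<open>auto simp: indicator_def\<close>)
  have i2: "set_integrable lborel \<Omega> (\<lambda>_. 1 :: real)"
    unfolding set_integrable_def
    by (rule integrableI_bounded_set[where A = \<Omega> and B = 1]) (use fin in \<open>auto simp: indicator_def\<close>)
  have "(LINT x:\<Omega>|lborel. 1 - ?p x) = (LINT x:\<Omega>|lborel. 1) - (LINT x:\<Omega>|lborel. ?p x)"
    by (rule set_integral_diff(2)[OF i2 i1])
  also have "(LINT x:\<Omega>|lborel. (1::real)) = measure lborel \<Omega>"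
    using fin by (simp add: set_lebesgue_integral_def)
  finally show ?thesis using q by simp
qed

section \<open>Exit probability against tails of one coordinate supremum\<close>

definition axes :: "(real^'n) set" where
  "axes = Basis \<union> uminus ` Basis"

lemma axes: "finite axes" "real (card axes) \<le> 2 * real DIM(real^'n)" "b \<in> axes \<Longrightarrow> norm b = 1"
proof -
  have "card axes \<le> card (Basis :: (real^'n) set) + card (uminus ` Basis :: (real^'n) set)"
    unfolding axes_def by (rule card_Un_le)
  also have "\<dots> \<le> 2 * DIM(real^'n)" using card_image_le[of Basis uminus] by (simp del: DIM_cart)
  finally show "real (card axes) \<le> 2 * real DIM(real^'n)" by (simp del: DIM_cart)
qed (auto simp: axes_def)

lemma exists_axis_ge:
  fixes w :: "real^'n"
  shows "\<exists>b\<in>axes. norm w / real DIM(real^'n) \<le> b \<bullet> w"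
proof (rule ccontr)
  assume "\<not> ?thesis"
  then have lt: "b \<bullet> w < norm w / real DIM(real^'n)" if "b \<in> axes" for b using that by (auto simp: not_le)
  have "\<bar>w \<bullet> b\<bar> < norm w / real DIM(real^'n)" if "b \<in> Basis" for b
    using lt[of b] lt[of "- b"] that by (simp add: axes_def inner_commute abs_less_iff del: DIM_cart)
  then have "(\<Sum>b\<in>Basis. \<bar>w \<bullet> b\<bar>) < (\<Sum>b\<in>(Basis :: (real^'n) set). norm w / real DIM(real^'n))"
    by (intro sum_strict_mono) auto
  then show False using norm_le_l1[of w] by simp
qed

text \<open>A displacement \<open>w\<close> with \<open>c * norm w \<le> A\<close> obeys the half
  space comparison with an error of at most \<open>\<eta>\<close> after scaling by \<open>c\<close>.
  A larger one has a component of at least \<open>norm w / n\<close> along some signed axis, which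
  costs a union bound over at most \<open>2 * n\<close> directions of equal law. Leaving also
  requires \<open>norm w\<close> to be at least \<open>d\<close>, hence the maximum of
  \<open>c * d\<close> and \<open>A\<close>.\<close>

lemma exit_prob_bounds:
  fixes t \<eta> A :: real and x :: "real^'n" and \<Omega> :: "(real^'n) set"
  defines "c \<equiv> t powr (- \<beta> / \<alpha>)" and "n \<equiv> real DIM(real^'n)" and "d \<equiv> infdist x (- \<Omega>)"
  assumes tb: "two_sided_ball R \<Omega> \<nu>" and \<Omega>: "open \<Omega>" "bounded \<Omega>" and t: "0 < t" and x: "x \<in> \<Omega>"
    and \<eta>: "0 < \<eta>" and A: "0 \<le> A" "2 * A\<^sup>2 / (c * R) \<le> \<eta>" and e: "norm e = 1"
  shows "1 - prob (stays_in \<Omega> t x) \<le> prob {\<omega> \<in> space M. c * d - \<eta> \<le> scaled_sup 1 e \<omega>}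
      + 2 * n * prob {\<omega> \<in> space M. max (c * d) A / n \<le> scaled_sup 1 e \<omega>}"
    and "prob {\<omega> \<in> space M. c * d + 2 * \<eta> \<le> scaled_sup 1 e \<omega>}
      - 2 * n * prob {\<omega> \<in> space M. max (c * d) A / n \<le> scaled_sup 1 e \<omega>} \<le> 1 - prob (stays_inside \<Omega> t x)"
proof -
  have t0: "0 \<le> t" using t by simp
  have c: "0 < c" using t by (simp add: c_def)
  have n: "0 < n" by (simp add: n_def del: DIM_cart)
  have R: "0 < R" using tb by (simp add: two_sided_ball_def)
  have d: "0 < d" unfolding d_def by (rule open_infdist_pos[OF \<Omega> x])
  obtain v where v: "norm v = 1" and far: "\<And>w. x + w \<notin> \<Omega> \<Longrightarrow> d \<le> norm w"
    and out: "\<And>w. x + w \<notin> \<Omega> \<Longrightarrow> d - 2 * (norm w)\<^sup>2 / R \<le> v \<bullet> w"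
    and ins: "\<And>w. x + w \<in> \<Omega> \<Longrightarrow> d \<le> norm w \<Longrightarrow> v \<bullet> w \<le> d + 2 * (norm w)\<^sup>2 / R"
    by (rule exit_halfspace_comparison[OF tb \<Omega> x, folded d_def]) (rule that)
  let ?D = "max (c * d) A"
  define F where "F b = {\<omega> \<in> space M. ?D / n \<le> scaled_sup t b \<omega>}" for b
  have Fm: "F b \<in> sets M" for b unfolding F_def using scaled_sup_meas[OF t] by measurable
  have err: "c * (2 * (norm w)\<^sup>2 / R) \<le> \<eta>" if w: "c * norm w \<le> A" for w :: "real^'n"
  proof -
    have "(c * norm w)\<^sup>2 \<le> A\<^sup>2" using w c by (intro power_mono) auto
    then have "2 * (c * norm w)\<^sup>2 / (c * R) \<le> 2 * A\<^sup>2 / (c * R)" using c R by (intro divide_right_mono) auto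
    moreover have "2 * (c * norm w)\<^sup>2 / (c * R) = c * (2 * (norm w)\<^sup>2 / R)"
      using c R by (simp add: power2_eq_square)
    ultimately show ?thesis using A(2) by linarith
  qed
  have bigF: "\<omega> \<in> (\<Union>b\<in>axes. F b)" if \<omega>: "\<omega> \<in> space M" and s: "s \<in> {0..t}" and big: "?D \<le> c * norm (X s \<omega>)" for \<omega> s
  proof -
    obtain b where b: "b \<in> axes" "norm (X s \<omega>) / n \<le> b \<bullet> X s \<omega>"
      using exists_axis_ge[of "X s \<omega>"] unfolding n_def by blast
    have "?D / n \<le> c * norm (X s \<omega>) / n" using big n by (intro divide_right_mono) auto
    also have "\<dots> = c * (norm (X s \<omega>) / n)" by simp
    also have "\<dots> \<le> c * (b \<bullet> X s \<omega>)" using b(2) c by (intro mult_left_mono) auto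
    also have "\<dots> \<le> scaled_sup t b \<omega>" unfolding c_def by (rule scaled_sup_ge[OF s])
    finally show ?thesis using b(1) \<omega> by (auto simp: F_def)
  qed
  have pF: "prob (\<Union>b\<in>axes. F b) \<le> 2 * n * prob {\<omega> \<in> space M. ?D / n \<le> scaled_sup 1 e \<omega>}"
  proof -
    have "prob (\<Union>b\<in>axes. F b) \<le> (\<Sum>b\<in>axes. prob (F b))"
      using Fm axes(1) by (intro finite_measure_subadditive_finite) auto
    also have "\<dots> = real (card axes) * prob {\<omega> \<in> space M. ?D / n \<le> scaled_sup 1 e \<omega>}"
      unfolding F_def using prob_scaled_sup_ge[OF t axes(3) e] by simp
    also have "\<dots> \<le> 2 * n * prob {\<omega> \<in> space M. ?D / n \<le> scaled_sup 1 e \<omega>}"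
      unfolding n_def by (intro mult_right_mono axes(2)) simp
    finally show ?thesis .
  qed
  have Gm: "{\<omega> \<in> space M. a \<le> scaled_sup t b \<omega>} \<in> sets M" for a b
    using scaled_sup_meas[OF t] by measurable
  note ev = stays_events[OF t0 \<Omega>(1), of x]
  have "space M - stays_in \<Omega> t x \<subseteq> {\<omega> \<in> space M. c * d - \<eta> \<le> scaled_sup t v \<omega>} \<union> (\<Union>b\<in>axes. F b)"
  proof
    fix \<omega> assume \<omega>: "\<omega> \<in> space M - stays_in \<Omega> t x"
    then obtain s where "s \<in> rational_times t" and y: "x + X s \<omega> \<notin> \<Omega>" by (auto simp: stays_in_def)
    then have s: "s \<in> {0..t}" using rational_times(2)[OF t0] by blast
    show "\<omega> \<in> {\<omega> \<in> space M. c * d - \<eta> \<le> scaled_sup t v \<omega>} \<union> (\<Union>b\<in>axes. F b)"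
    proof (cases "?D \<le> c * norm (X s \<omega>)")
      case True then show ?thesis using bigF[OF _ s True] \<omega> by blast
    next
      case False
      have "c * d \<le> c * norm (X s \<omega>)" using far[OF y] c by (intro mult_left_mono) auto
      then have "c * norm (X s \<omega>) \<le> A" using False by linarith
      then have "c * (2 * (norm (X s \<omega>))\<^sup>2 / R) \<le> \<eta>" by (rule err)
      moreover have "c * (d - 2 * (norm (X s \<omega>))\<^sup>2 / R) \<le> c * (v \<bullet> X s \<omega>)"
        using out[OF y] c by (intro mult_left_mono) auto
      moreover have "c * (v \<bullet> X s \<omega>) \<le> scaled_sup t v \<omega>" unfolding c_def by (rule scaled_sup_ge[OF s])
      ultimately have "c * d - \<eta> \<le> scaled_sup t v \<omega>" by (simp add: right_diff_distrib)
      then show ?thesis using \<omega> by blast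
    qed
  qed
  then have "prob (space M - stays_in \<Omega> t x) \<le> prob ({\<omega> \<in> space M. c * d - \<eta> \<le> scaled_sup t v \<omega>} \<union> (\<Union>b\<in>axes. F b))"
    using Gm Fm axes(1) by (intro finite_measure_mono sets.Un sets.finite_UN) auto
  also have "\<dots> \<le> prob {\<omega> \<in> space M. c * d - \<eta> \<le> scaled_sup t v \<omega>} + prob (\<Union>b\<in>axes. F b)"
    using Gm Fm axes(1) by (intro measure_Un_le sets.finite_UN) auto
  finally show "1 - prob (stays_in \<Omega> t x) \<le> prob {\<omega> \<in> space M. c * d - \<eta> \<le> scaled_sup 1 e \<omega>}
      + 2 * n * prob {\<omega> \<in> space M. ?D / n \<le> scaled_sup 1 e \<omega>}"
    using pF prob_compl[OF ev(2)] prob_scaled_sup_ge[OF t v e] by simp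
  have "{\<omega> \<in> space M. c * d + 2 * \<eta> \<le> scaled_sup t v \<omega>} \<subseteq> (space M - stays_inside \<Omega> t x) \<union> (\<Union>b\<in>axes. F b)"
  proof (rule subsetI, rule ccontr)
    fix \<omega> assume w1: "\<omega> \<in> {\<omega> \<in> space M. c * d + 2 * \<eta> \<le> scaled_sup t v \<omega>}"
      and w2: "\<omega> \<notin> (space M - stays_inside \<Omega> t x) \<union> (\<Union>b\<in>axes. F b)"
    have \<omega>: "\<omega> \<in> space M" "\<omega> \<in> stays_inside \<Omega> t x" using w1 w2 by auto
    then have "ereal t < exit_time \<Omega> (\<lambda>s. x + X s \<omega>)" using survival_between(1)[OF t0 \<Omega> \<omega>(1)] by blast
    moreover have "((\<lambda>s. x + X s \<omega>) \<longlongrightarrow> x + X t \<omega>) (at_right t)"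
      by (intro tendsto_add tendsto_const X_right_continuous[OF t0])
    ultimately have inside: "x + X s \<omega> \<in> \<Omega>" if "s \<in> {0..t}" for s
      using less_exit_time_iff[OF \<Omega>(1) t0] that by blast
    have small: "c * norm (X s \<omega>) < ?D" if "s \<in> {0..t}" for s
      using bigF[OF \<omega>(1) that] w2 by force
    \<comment> \<open>A displacement shorter than \<open>d\<close> has component at most
      \<open>d\<close> by Cauchy-Schwarz; otherwise the curvature estimate applies. The second
      \<open>\<eta>\<close> in \<open>2 * \<eta>\<close> makes the contradiction strict after
      passing to the supremum.\<close>
    have "v \<bullet> X s \<omega> * c \<le> c * d + \<eta>" if s: "s \<in> {0..t}" for s
    proof (cases "d \<le> norm (X s \<omega>)")
      case True
      then have "c * d \<le> c * norm (X s \<omega>)" using c by (intro mult_left_mono) auto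
      then have "c * norm (X s \<omega>) \<le> A" using small[OF s] by linarith
      then have "c * (2 * (norm (X s \<omega>))\<^sup>2 / R) \<le> \<eta>" by (rule err)
      moreover have "c * (v \<bullet> X s \<omega>) \<le> c * (d + 2 * (norm (X s \<omega>))\<^sup>2 / R)"
        using ins[OF inside[OF s] True] c by (intro mult_left_mono) auto
      ultimately show ?thesis by (simp add: distrib_left mult.commute)
    next
      case False
      have "v \<bullet> X s \<omega> \<le> norm (X s \<omega>)" using norm_cauchy_schwarz[of v "X s \<omega>"] v by simp
      also have "\<dots> \<le> d" using False by simp
      finally have "c * (v \<bullet> X s \<omega>) \<le> c * d" using c by (intro mult_left_mono) auto
      then show ?thesis using \<eta> by (simp add: mult.commute)
    qed
    then have "scaled_sup t v \<omega> \<le> c * d + \<eta>"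
      unfolding scaled_sup_def c_def[symmetric] using t0 by (intro cSUP_least) (auto simp: mult.commute)
    then show False using w1 \<eta> by simp
  qed
  then have "prob {\<omega> \<in> space M. c * d + 2 * \<eta> \<le> scaled_sup t v \<omega>}
      \<le> prob ((space M - stays_inside \<Omega> t x) \<union> (\<Union>b\<in>axes. F b))"
    using ev Fm axes(1) by (intro finite_measure_mono sets.Un sets.finite_UN) auto
  also have "\<dots> \<le> prob (space M - stays_inside \<Omega> t x) + prob (\<Union>b\<in>axes. F b)"
    using ev Fm axes(1) by (intro measure_Un_le sets.finite_UN) auto
  finally show "prob {\<omega> \<in> space M. c * d + 2 * \<eta> \<le> scaled_sup 1 e \<omega>}
      - 2 * n * prob {\<omega> \<in> space M. ?D / n \<le> scaled_sup 1 e \<omega>} \<le> 1 - prob (stays_inside \<Omega> t x)"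
    using pF prob_compl[OF ev(1)] prob_scaled_sup_ge[OF t v e] by simp
qed

section \<open>The limit\<close>

text \<open>Integration over the starting point and Tonelli turn tail events into inner tubes:
  \<open>c * d + \<theta> \<le> H\<close> says that the depth \<open>d\<close> of the point is at
  most \<open>\<epsilon> * (H - \<theta>)\<close>. The term \<open>L\<close> collects the large
  displacements, and its cutoff involves \<open>H\<close> alone.\<close>

lemma heat_content_deficit_bounds:
  assumes tb: "two_sided_ball R \<Omega> \<nu>" and \<Omega>: "open \<Omega>" "bounded \<Omega>" and t: "0 < t" and e: "norm e = 1"
    and \<eta>: "0 < \<eta>" and A: "0 \<le> A" "2 * A\<^sup>2 / (t powr (- \<beta> / \<alpha>) * R) \<le> \<eta>"
  defines "\<epsilon> \<equiv> t powr (\<beta> / \<alpha>)" and "n \<equiv> real DIM(real^'n)" and "H \<equiv> scaled_sup 1 e"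
  defines "D \<equiv> measure lebesgue \<Omega> - spectral_heat_content M (time_change Y U) \<Omega> t"
    and "J \<equiv> \<lambda>\<theta>. LINT \<omega>|M. tube_volume \<Omega> (\<epsilon> * (H \<omega> - \<theta>))"
    and "L \<equiv> LINT \<omega>|M. (if A \<le> n * H \<omega> then tube_volume \<Omega> (\<epsilon> * (n * H \<omega>)) else 0)"
  shows "D \<le> J (- \<eta>) + 2 * n * L" "J (2 * \<eta>) - 2 * n * L \<le> D"
proof -
  define c where "c = t powr (- \<beta> / \<alpha>)"
  have c: "0 < c" using t by (simp add: c_def)
  have \<epsilon>: "0 < \<epsilon>" using t by (simp add: \<epsilon>_def)
  have c\<epsilon>: "c * y \<le> z \<longleftrightarrow> y \<le> \<epsilon> * z" for y z
  proof -
    have "c = inverse \<epsilon>" unfolding c_def \<epsilon>_def by (simp add: powr_minus)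
    then show ?thesis using \<epsilon> by (simp add: inverse_eq_divide pos_divide_le_eq mult.commute)
  qed
  have n: "0 < n" by (simp add: n_def del: DIM_cart)
  have [measurable]: "H \<in> borel_measurable M" by (simp add: H_def)
  have [measurable]: "(\<lambda>y. infdist y (- \<Omega>)) \<in> borel_measurable borel"
    by (intro borel_measurable_continuous_onI continuous_intros)
  have S: "\<Omega> \<in> sets borel" "emeasure lborel \<Omega> < \<infinity>"
    using \<Omega> emeasure_bounded_finite by auto
  let ?p1 = "\<lambda>\<theta> x. prob {\<omega> \<in> space M. c * infdist x (- \<Omega>) + \<theta> \<le> H \<omega>}"
  let ?p2 = "\<lambda>x. prob {\<omega> \<in> space M. max (c * infdist x (- \<Omega>)) A / n \<le> H \<omega>}"
  have q1: "Measurable.pred (lborel \<Otimes>\<^sub>M M) (\<lambda>z. c * infdist (fst z) (- \<Omega>) + \<theta> \<le> H (snd z))" for \<theta>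
    by measurable
  have q2: "Measurable.pred (lborel \<Otimes>\<^sub>M M) (\<lambda>z. max (c * infdist (fst z) (- \<Omega>)) A / n \<le> H (snd z))"
    by measurable
  have J: "(LINT x:\<Omega>|lborel. ?p1 \<theta> x) = J \<theta>" for \<theta>
  proof -
    have set: "{x \<in> \<Omega>. c * infdist x (- \<Omega>) + \<theta> \<le> H \<omega>} = inner_tube \<Omega> (\<epsilon> * (H \<omega> - \<theta>))" for \<omega>
      using c\<epsilon>[of _ "H \<omega> - \<theta>"] unfolding inner_tube_def by (auto simp: le_diff_eq)
    show ?thesis unfolding J_def tube_volume_def set[symmetric] by (rule integral_prob_swap(1)[OF S q1])
  qed
  have L: "(LINT x:\<Omega>|lborel. ?p2 x) = L"
  proof -
    have "measure lborel {x \<in> \<Omega>. max (c * infdist x (- \<Omega>)) A / n \<le> H \<omega>}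
        = (if A \<le> n * H \<omega> then tube_volume \<Omega> (\<epsilon> * (n * H \<omega>)) else 0)" for \<omega>
    proof -
      have "{x \<in> \<Omega>. max (c * infdist x (- \<Omega>)) A / n \<le> H \<omega>} = (if A \<le> n * H \<omega> then inner_tube \<Omega> (\<epsilon> * (n * H \<omega>)) else {})"
        using n c\<epsilon>[of _ "n * H \<omega>"] unfolding inner_tube_def by (auto simp: pos_divide_le_eq mult.commute[of n])
      then show ?thesis by (simp add: tube_volume_def)
    qed
    then show ?thesis unfolding L_def integral_prob_swap(1)[OF S q2] by simp
  qed
  have int: "set_integrable lborel \<Omega> f" if "f \<in> borel_measurable borel" "\<And>x. 0 \<le> f x" "\<And>x. f x \<le> 1" for f :: "real^'n \<Rightarrow> real"
    unfolding set_integrable_def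
    by (rule integrableI_bounded_set[where A = \<Omega> and B = 1]) (use S that in \<open>auto simp: indicator_def\<close>)
  have i1: "set_integrable lborel \<Omega> (?p1 \<theta>)" for \<theta>
    using integral_prob_swap(2)[OF S q1] by (intro int) auto
  have i2: "set_integrable lborel \<Omega> (\<lambda>x. 2 * n * ?p2 x)"
    using integral_prob_swap(2)[OF S q2] by (intro set_integrable_mult_right int) auto
  have i3: "set_integrable lborel \<Omega> (\<lambda>x. 1 - prob (stays_inside \<Omega> t x))"
    using prob_stays_inside_meas[of t \<Omega>] t \<Omega> by (intro int) auto
  have D: "D = (LINT x:\<Omega>|lborel. 1 - prob (stays_inside \<Omega> t x))"
    unfolding D_def using heat_content_deficit[OF tb \<Omega>, of t] t by simp
  note bounds = exit_prob_bounds[OF tb \<Omega> t _ \<eta> A e, folded c_def n_def H_def]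
  have ae: "AE x in lborel. prob (stays_in \<Omega> t x) = prob (stays_inside \<Omega> t x)"
    using survival_prob_eq[OF tb \<Omega>, of t] t by auto
  have "D \<le> (LINT x:\<Omega>|lborel. ?p1 (- \<eta>) x + 2 * n * ?p2 x)"
    unfolding D
  proof (rule set_integral_mono_AE[OF i3 set_integral_add(1)[OF i1 i2]])
    show "AE x\<in>\<Omega> in lborel. 1 - prob (stays_inside \<Omega> t x) \<le> ?p1 (- \<eta>) x + 2 * n * ?p2 x"
      using ae by eventually_elim (use bounds(1) in force)
  qed
  also have "\<dots> = J (- \<eta>) + 2 * n * L"
    unfolding set_integral_add(2)[OF i1 i2] set_integral_mult_right J L ..
  finally show "D \<le> J (- \<eta>) + 2 * n * L" .
  have "J (2 * \<eta>) - 2 * n * L = (LINT x:\<Omega>|lborel. ?p1 (2 * \<eta>) x - 2 * n * ?p2 x)"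
    unfolding set_integral_diff(2)[OF i1 i2] set_integral_mult_right J L ..
  also have "\<dots> \<le> D"
    unfolding D
    by (rule set_integral_mono[OF set_integral_diff(1)[OF i1 i2] i3]) (rule bounds(2))
  finally show "J (2 * \<eta>) - 2 * n * L \<le> D" .
qed

lemma heat_content_deficit_limit:
  assumes tb: "two_sided_ball R \<Omega> \<nu>" and \<Omega>: "open \<Omega>" "bounded \<Omega>" and e: "norm e = 1"
    and H: "integrable M (scaled_sup 1 e)" and per: "perimeter \<Omega> = ereal P"
  shows "((\<lambda>t. (measure lebesgue \<Omega> - spectral_heat_content M (time_change Y U) \<Omega> t) / t powr (\<beta> / \<alpha>))
    \<longlongrightarrow> (LINT \<omega>|M. scaled_sup 1 e \<omega>) * P) (at_right 0)"
proof (rule tendsto_at_right_sequentially[of 0 1])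
  fix S :: "nat \<Rightarrow> real" assume S0: "\<And>k. 0 < S k" and S: "S \<longlonglongrightarrow> 0"
  let ?H = "scaled_sup 1 e" and ?M = "tube_volume \<Omega>"
  define \<epsilon> where "\<epsilon> k = S k powr (\<beta> / \<alpha>)" for k
  define n where "n = real DIM(real^'n)"
  define D where "D k = measure lebesgue \<Omega> - spectral_heat_content M (time_change Y U) \<Omega> (S k)" for k
  have R: "0 < R" using tb by (simp add: two_sided_ball_def)
  have n: "0 < n" by (simp add: n_def del: DIM_cart)
  have \<epsilon>0: "0 < \<epsilon> k" for k using S0[of k] by (simp add: \<epsilon>_def)
  have \<epsilon>lim: "\<epsilon> \<longlonglongrightarrow> 0"
    unfolding \<epsilon>_def
  proof (rule tendsto_zero_powrI[OF S tendsto_const])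
    show "\<forall>\<^sub>F k in sequentially. 0 \<le> S k" using S0 by (intro always_eventually allI less_imp_le)
  qed (use alpha beta in simp)
  obtain P' C where "perimeter \<Omega> = ereal P'" "0 \<le> P'" "0 \<le> C" and MC: "\<And>s. ?M s \<le> C * max s 0"
    and lim: "\<And>\<epsilon>. 0 < \<epsilon> \<Longrightarrow> \<exists>s0>0. \<forall>s. 0 < s \<longrightarrow> s < s0 \<longrightarrow> \<bar>?M s - P' * s\<bar> \<le> \<epsilon> * s"
    by (rule tube_volume_perimeter[OF tb \<Omega>]) (rule that)
  then have [simp]: "P' = P" and P: "0 \<le> P" and C: "0 \<le> C" using per by auto
  have nonneg: "0 \<le> ?H \<omega>" for \<omega> by (simp add: scaled_sup_nonneg)
  note tl = integral_tube_volume_tendsto[OF tube_volume_measurable[OF \<Omega>] tube_volume_nonneg MC C lim[unfolded \<open>P' = P\<close>] _ \<epsilon>0 \<epsilon>lim]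
  define J where "J \<theta> k = (LINT \<omega>|M. ?M (\<epsilon> k * (?H \<omega> - \<theta>)))" for \<theta> k
  have Jlim: "(\<lambda>k. J \<theta> k / \<epsilon> k) \<longlonglongrightarrow> P * (LINT \<omega>|M. max (?H \<omega> - \<theta>) 0)" for \<theta>
    unfolding J_def using H by (intro tl(1)) auto
  have bounds: "\<exists>L. (\<lambda>k. L k / \<epsilon> k) \<longlonglongrightarrow> 0 \<and> (\<forall>k. D k \<le> J (- \<eta>) k + 2 * n * L k \<and> J (2 * \<eta>) k - 2 * n * L k \<le> D k)"
    if \<eta>: "0 < \<eta>" for \<eta>
  proof -
    \<comment> \<open>The largest cutoff for which the scaled curvature error is at most
      \<open>\<eta>\<close>. It tends to infinity as \<open>\<epsilon> k\<close> tends to 0, which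
      makes \<open>L\<close> negligible.\<close>
    define A where "A k = sqrt (\<eta> * R / 2 / \<epsilon> k)" for k
    define L where "L k = (LINT \<omega>|M. (if A k \<le> n * ?H \<omega> then ?M (\<epsilon> k * (n * ?H \<omega>)) else 0))" for k
    have "filterlim (\<lambda>k. \<eta> * R / 2 / \<epsilon> k) at_top sequentially"
      using \<epsilon>lim \<epsilon>0 \<eta> R by (intro LIM_at_top_divide[OF tendsto_const]) auto
    then have "filterlim A at_top sequentially"
      unfolding A_def by (rule filterlim_compose[OF sqrt_at_top])
    then have "(\<lambda>k. L k / \<epsilon> k) \<longlonglongrightarrow> 0"
      unfolding L_def using H by (intro tl(2)) auto
    moreover have "D k \<le> J (- \<eta>) k + 2 * n * L k \<and> J (2 * \<eta>) k - 2 * n * L k \<le> D k" for k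
    proof -
      have A0: "0 \<le> A k" using \<eta> R \<epsilon>0[of k] by (simp add: A_def)
      have c: "S k powr (- \<beta> / \<alpha>) = inverse (\<epsilon> k)" unfolding \<epsilon>_def by (simp add: powr_minus)
      have "(A k)\<^sup>2 = \<eta> * R / 2 / \<epsilon> k" using \<eta> R \<epsilon>0[of k] by (simp add: A_def)
      then have "2 * (A k)\<^sup>2 / (S k powr (- \<beta> / \<alpha>) * R) \<le> \<eta>"
        unfolding c using \<epsilon>0[of k] R by (simp add: field_simps)
      from heat_content_deficit_bounds[OF tb \<Omega> S0 e \<eta> A0 this]
      show ?thesis unfolding D_def J_def L_def \<epsilon>_def n_def by blast
    qed
    ultimately show ?thesis by blast
  qed
  have maxint: "integrable M (\<lambda>\<omega>. max (?H \<omega> - \<theta>) 0)" for \<theta> using H by auto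
  let ?I = "LINT \<omega>|M. ?H \<omega>"
  \<comment> \<open>The supremum is nonnegative because it includes time 0, so the positive part
    disappears on this side.\<close>
  have up: "(LINT \<omega>|M. max (?H \<omega> - - \<eta>) 0) = ?I + \<eta>" if "0 < \<eta>" for \<eta>
  proof -
    have "max (?H \<omega> - - \<eta>) 0 = ?H \<omega> + \<eta>" for \<omega> using nonneg[of \<omega>] that by simp
    then show ?thesis using H by (simp add: prob_space)
  qed
  have lo: "?I - 2 * \<eta> \<le> (LINT \<omega>|M. max (?H \<omega> - 2 * \<eta>) 0)" for \<eta>
  proof -
    have "?I - 2 * \<eta> = (LINT \<omega>|M. ?H \<omega> - 2 * \<eta>)" using H by (simp add: prob_space)
    also have "\<dots> \<le> (LINT \<omega>|M. max (?H \<omega> - 2 * \<eta>) 0)" using H maxint by (intro integral_mono) auto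
    finally show ?thesis .
  qed
  have cancel: "(P + 1) * (y / (P + 1)) = y" for y using P by simp
  have "(\<lambda>k. D k / \<epsilon> k) \<longlonglongrightarrow> ?I * P"
  proof (rule order_tendstoI)
    fix r assume r: "?I * P < r"
    \<comment> \<open>Division by \<open>P + 1\<close> makes \<open>P * \<eta>\<close> smaller than
      the gap and keeps \<open>\<eta>\<close> defined when \<open>P = 0\<close>.\<close>
    define \<eta> where "\<eta> = (r - ?I * P) / 2 / (P + 1)"
    have \<eta>: "0 < \<eta>" using r P by (simp add: \<eta>_def)
    have "P * \<eta> < r - ?I * P"
    proof -
      have "P * \<eta> \<le> (P + 1) * \<eta>" using \<eta> by simp
      also have "\<dots> = (r - ?I * P) / 2" unfolding \<eta>_def by (rule cancel)
      finally show ?thesis using r by simp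
    qed
    then have lt: "P * (?I + \<eta>) + 2 * n * 0 < r" by (simp add: algebra_simps)
    obtain L where L: "(\<lambda>k. L k / \<epsilon> k) \<longlonglongrightarrow> 0" "\<And>k. D k \<le> J (- \<eta>) k + 2 * n * L k"
      using bounds[OF \<eta>] by blast
    have "(\<lambda>k. J (- \<eta>) k / \<epsilon> k + 2 * n * (L k / \<epsilon> k)) \<longlonglongrightarrow> P * (?I + \<eta>) + 2 * n * 0"
      using Jlim[of "- \<eta>"] L(1) unfolding up[OF \<eta>] by (intro tendsto_add tendsto_mult tendsto_const)
    then have "\<forall>\<^sub>F k in sequentially. J (- \<eta>) k / \<epsilon> k + 2 * n * (L k / \<epsilon> k) < r"
      using lt by (rule order_tendstoD(2))
    then show "\<forall>\<^sub>F k in sequentially. D k / \<epsilon> k < r"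
    proof eventually_elim
      case (elim k)
      have "D k / \<epsilon> k \<le> (J (- \<eta>) k + 2 * n * L k) / \<epsilon> k" using L(2)[of k] \<epsilon>0[of k] by (intro divide_right_mono) auto
      also have "\<dots> = J (- \<eta>) k / \<epsilon> k + 2 * n * (L k / \<epsilon> k)" by (simp add: add_divide_distrib)
      finally show ?case using elim by simp
    qed
  next
    fix r assume r: "r < ?I * P"
    define \<eta> where "\<eta> = (?I * P - r) / 4 / (P + 1)"
    have \<eta>: "0 < \<eta>" using r P by (simp add: \<eta>_def)
    have "P * (2 * \<eta>) < ?I * P - r"
    proof -
      have "P * (2 * \<eta>) \<le> 2 * ((P + 1) * \<eta>)" using \<eta> by (simp add: algebra_simps)
      also have "(P + 1) * \<eta> = (?I * P - r) / 4" unfolding \<eta>_def by (rule cancel)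
      finally show ?thesis using r by simp
    qed
    then have "r < P * (?I - 2 * \<eta>)" by (simp add: algebra_simps)
    also have "\<dots> \<le> P * (LINT \<omega>|M. max (?H \<omega> - 2 * \<eta>) 0)" using lo P by (rule mult_left_mono)
    finally have lt: "r < P * (LINT \<omega>|M. max (?H \<omega> - 2 * \<eta>) 0) - 2 * n * 0" by simp
    obtain L where L: "(\<lambda>k. L k / \<epsilon> k) \<longlonglongrightarrow> 0" "\<And>k. J (2 * \<eta>) k - 2 * n * L k \<le> D k"
      using bounds[OF \<eta>] by blast
    have "(\<lambda>k. J (2 * \<eta>) k / \<epsilon> k - 2 * n * (L k / \<epsilon> k)) \<longlonglongrightarrow> P * (LINT \<omega>|M. max (?H \<omega> - 2 * \<eta>) 0) - 2 * n * 0"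
      using Jlim[of "2 * \<eta>"] L(1) by (intro tendsto_diff tendsto_mult tendsto_const)
    then have "\<forall>\<^sub>F k in sequentially. r < J (2 * \<eta>) k / \<epsilon> k - 2 * n * (L k / \<epsilon> k)"
      using lt by (rule order_tendstoD(1))
    then show "\<forall>\<^sub>F k in sequentially. r < D k / \<epsilon> k"
    proof eventually_elim
      case (elim k)
      have "J (2 * \<eta>) k / \<epsilon> k - 2 * n * (L k / \<epsilon> k) = (J (2 * \<eta>) k - 2 * n * L k) / \<epsilon> k" by (simp add: diff_divide_distrib)
      also have "\<dots> \<le> D k / \<epsilon> k" using L(2)[of k] \<epsilon>0[of k] by (intro divide_right_mono) auto
      finally show ?case using elim by simp
    qed
  qed
  then show "(\<lambda>k. (measure lebesgue \<Omega> - spectral_heat_content M (time_change Y U) \<Omega> (S k)) / S k powr (\<beta> / \<alpha>))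
      \<longlonglongrightarrow> ?I * P"
    unfolding D_def \<epsilon>_def .
qed simp

text \<open>The supremum over uncountably many times agrees almost surely with the measurable
  \<open>scaled_sup\<close> of \<open>X\<close>, hence is measurable for the completion and has the
  same integral.\<close>

lemma expected_sup_eq:
  "(LINT \<omega>|completion M. (SUP s\<in>{0..1}. time_change Y U s \<omega> $ k)) = (LINT \<omega>|M. scaled_sup 1 (axis k 1) \<omega>)"
proof -
  let ?H = "scaled_sup 1 (axis k 1)" and ?S = "\<lambda>\<omega>. SUP s\<in>{0..1}. time_change Y U s \<omega> $ k"
  have H: "?H \<in> borel_measurable M" by simp
  have ae: "AE \<omega> in M. ?S \<omega> = ?H \<omega>"
    using X_eq_time_change by eventually_elim (simp add: scaled_sup_def inner_axis')
  have "(LINT \<omega>|completion M. ?S \<omega>) = (LINT \<omega>|completion M. ?H \<omega>)"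
  proof (rule integral_cong_AE)
    show "?H \<in> borel_measurable (completion M)" by (rule measurable_completion[OF H])
    then show "?S \<in> borel_measurable (completion M)" by (rule borel_measurable_completion_cong_AE) (rule ae)
  qed (rule AE_completion[OF ae])
  then show ?thesis using integral_completion[OF H] by simp
qed

end

theorem proposition2p8:
  fixes M :: "'w measure"
    and Y :: "real \<Rightarrow> 'w \<Rightarrow> real^'n::finite"
    and U :: "real \<Rightarrow> 'w \<Rightarrow> real"
    and \<alpha> \<beta> p :: real
    and \<Omega> :: "(real^'n) set"
    and k :: 'n
  assumes "prob_space M"
    and "1 < \<alpha>" "\<alpha> \<le> 2" "0 < \<beta>"
    and "isotropic_stable M \<alpha> Y"
    and "stochastic_process M U"
    and "AE \<omega> in M. U 0 \<omega> = 0"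
    and "AE \<omega> in M. \<forall>t>0. 0 < U t \<omega>"
    and "AE \<omega> in M. mono_on {0..} (\<lambda>t. U t \<omega>)"
    and "AE \<omega> in M. cadlag (\<lambda>t. U t \<omega>)"
    and "self_similar M \<beta> U"
    and "independent_processes M U Y"
    and "1 < p" "integrable M (\<lambda>\<omega>. U 1 \<omega> powr (p / \<alpha>))"
    and "open \<Omega>" "bounded \<Omega>" "C1_holder_boundary 1 \<Omega>"
  shows "((\<lambda>t. ereal ((measure lebesgue \<Omega> - spectral_heat_content M (time_change Y U) \<Omega> t) / t powr (\<beta> / \<alpha>)))
          \<longlongrightarrow> ereal (LINT \<omega>|completion M. (SUP s\<in>{0..1}. time_change Y U s \<omega> $ k)) * perimeter \<Omega>) (at_right 0)"
proof -
  interpret stable_subordination M Y U \<alpha> \<beta>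
    using assms by (intro stable_subordination.intro stable_subordination_axioms.intro)
  obtain R \<nu> where tb: "two_sided_ball R \<Omega> \<nu>"
    by (rule C1_holder_two_sided_ball[OF assms(15-17)])
  obtain P C where P: "perimeter \<Omega> = ereal P" by (rule tube_volume_perimeter[OF tb assms(15,16)])
  have e: "norm (axis k 1 :: real^'n) = 1" by simp
  have "((\<lambda>t. (measure lebesgue \<Omega> - spectral_heat_content M (time_change Y U) \<Omega> t) / t powr (\<beta> / \<alpha>))
    \<longlongrightarrow> (LINT \<omega>|M. scaled_sup 1 (axis k 1) \<omega>) * P) (at_right 0)"
    by (rule heat_content_deficit_limit[OF tb assms(15,16) e integrable_scaled_sup[OF e assms(13,14)] P])
  then show ?thesis unfolding expected_sup_eq P by simp
qed

end
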